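(* Let $A,B$ be finite-dimensional Hilbert spaces, $\rho_{AB}\in \mathrm{S}(A\otimes B)$, $\sigma_A\in\mathrm{S}(A)$, and $\alpha\in[\tfrac12,1)\cup(1,\infty]$. Then $$D_\alpha(\rho_A\|\sigma_A)=D_\alpha^\infty(\rho_{AB}\|\mathcal{C}^{\sigma_A}_{AB}),$$ where $\rho_A=\mathrm{tr}_B[\rho_{AB}]$ and $$D_\alpha^\infty(\rho_{AB}\|\mathcal{C}^{\sigma_A}_{AB}):=\lim_{n\to\infty}\frac1n D_\alpha(\rho_{AB}^{\otimes n}\|\mathcal{C}^{\sigma_A}_{AB,n}).$$
   Context: $\mathrm{S}(A)$ is the set of density matrices (positive semidefinite, trace one) on the finite-dimensional Hilbert space $A$; $\log$ is to base $2$. Write $A_1^n=A^{\otimes n}$, $B_1^n=B^{\otimes n}$. For $n\in\mathbb{N}$, $\mathcal{C}^{\sigma_A}_{AB,n}:=\{\sigma'\in\mathrm{S}(A_1^n\otimes B_1^n):\mathrm{tr}_{B_1^n}[\sigma']=\sigma_A^{\otimes n}\}$ is the set of extensions of $\sigma_A^{\otimes n}$, and $\mathcal{C}^{\sigma_A}_{AB}:=\mathcal{C}^{\sigma_A}_{AB,1}$. The (sandwiched) Rényi relative entropy for $\alpha\in[\frac12,1)\cup(1,\infty)$ is $D_\alpha(\rho\|\sigma):=\frac{1}{\alpha-1}\log \mathrm{tr}\big[(\sigma^{\frac{1-\alpha}{2\alpha}}\rho\,\sigma^{\frac{1-\alpha}{2\alpha}})^\alpha\big]$ if $\alpha<1$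 or $\mathrm{supp}\,\rho\subseteq\mathrm{supp}\,\sigma$, and $+\infty$ otherwise (negative powers are taken on the support; $\log 0=-\infty$). For $\alpha=\infty$, $D_\infty(\rho\|\sigma)=D_{\max}(\rho\|\sigma):=\inf\{\lambda\in\mathbb{R}:\rho\le 2^\lambda\sigma\}$ (with $\inf\emptyset=+\infty$). For a set $\mathcal{S}$ of density matrices, $D_\alpha(\rho\|\mathcal{S}):=\inf_{\sigma\in\mathcal{S}}D_\alpha(\rho\|\sigma)$. The limit defining $D_\alpha^\infty$ exists and equals the infimum over $n\in\mathbb{N}$, by subadditivity (Fekete's lemma). *)

theory Defs
  imports
    "HOL-Library.Extended_Real"
    "Jordan_Normal_Form.Matrix_Kernel"
    "Jordan_Normal_Form.Schur_Decomposition"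
begin

text \<open>
  A Hilbert space of dimension \<open>d\<close> is represented, after choosing an orthonormal basis, by the
  complex vectors of dimension \<open>d\<close>, and its operators by the complex \<open>d \<times> d\<close> matrices.
  The basis vector \<open>e\<^sub>i \<otimes> f\<^sub>j\<close> of a tensor product of spaces of dimensions \<open>dA\<close> and \<open>dB\<close> has
  index \<open>i * dB + j\<close>.
\<close>

definition unitary_mat :: "nat \<Rightarrow> complex mat \<Rightarrow> bool" where
  "unitary_mat d U \<longleftrightarrow>
     U \<in> carrier_mat d d \<and> mat_adjoint U * U = 1\<^sub>m d \<and> U * mat_adjoint U = 1\<^sub>m d"

definition psd :: "nat \<Rightarrow> complex mat \<Rightarrow> bool" where
  "psd d M \<longleftrightarrow>
     M \<in> carrier_mat d d \<and> mat_adjoint M = M \<and>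
     (\<forall>v \<in> carrier_vec d. 0 \<le> Re ((M *\<^sub>v v) \<bullet>c v))"

definition mat_tr :: "complex mat \<Rightarrow> complex" where
  "mat_tr M = (\<Sum>i<dim_row M. M $$ (i, i))"

definition density :: "nat \<Rightarrow> complex mat set" where
  "density d = {\<rho>. psd d \<rho> \<and> mat_tr \<rho> = 1}"

text \<open>
  Real powers of a positive semidefinite matrix, by functional calculus: any two spectral
  decompositions of \<open>M\<close> give the same \<open>X\<close>. Since \<open>0 powr p = 0\<close> for every \<open>p\<close>, the power is
  taken on the support, also for negative \<open>p\<close>.
\<close>

definition mat_powr :: "complex mat \<Rightarrow> real \<Rightarrow> complex mat" where
  "mat_powr M p = (THE X. \<exists>U l.
     unitary_mat (dim_row M) U \<and>
     M = U * mat_diag (dim_row M) (\<lambda>i. complex_of_real (l i)) * mat_adjoint U \<and>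
     X = U * mat_diag (dim_row M) (\<lambda>i. complex_of_real (l i powr p)) * mat_adjoint U)"

text \<open>The support is the orthogonal complement of the kernel.\<close>

definition mat_supp :: "complex mat \<Rightarrow> complex vec set" where
  "mat_supp M = {v \<in> carrier_vec (dim_col M). \<forall>w \<in> mat_kernel M. v \<bullet>c w = 0}"

text \<open>Logarithm to base 2 on the nonnegative reals, with \<open>log 0 = -\<infinity>\<close>.\<close>

definition elog2 :: "real \<Rightarrow> ereal" where
  "elog2 x = (if 0 < x then ereal (log 2 x) else -\<infinity>)"

definition D_max :: "complex mat \<Rightarrow> complex mat \<Rightarrow> ereal" where
  "D_max \<rho> \<sigma> =
     Inf (ereal ` {r. psd (dim_row \<rho>) (complex_of_real (2 powr r) \<cdot>\<^sub>m \<sigma> - \<rho>)})"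

definition D_sandwiched :: "real \<Rightarrow> complex mat \<Rightarrow> complex mat \<Rightarrow> ereal" where
  "D_sandwiched \<alpha> \<rho> \<sigma> =
     (if \<alpha> < 1 \<or> mat_supp \<rho> \<subseteq> mat_supp \<sigma> then
        ereal (1 / (\<alpha> - 1)) *
        elog2 (Re (mat_tr (mat_powr
          (mat_powr \<sigma> ((1 - \<alpha>) / (2 * \<alpha>)) * \<rho> * mat_powr \<sigma> ((1 - \<alpha>) / (2 * \<alpha>))) \<alpha>)))
      else \<infinity>)"

definition D_renyi :: "ereal \<Rightarrow> complex mat \<Rightarrow> complex mat \<Rightarrow> ereal" where
  "D_renyi \<alpha> \<rho> \<sigma> =
     (if \<alpha> = \<infinity> then D_max \<rho> \<sigma> else D_sandwiched (real_of_ereal \<alpha>) \<rho> \<sigma>)"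

definition D_renyi_set :: "ereal \<Rightarrow> complex mat \<Rightarrow> complex mat set \<Rightarrow> ereal" where
  "D_renyi_set \<alpha> \<rho> S = (INF \<sigma>\<in>S. D_renyi \<alpha> \<rho> \<sigma>)"

text \<open>\<open>partial_trace dA dB\<close> traces out the second factor.\<close>

definition partial_trace :: "nat \<Rightarrow> nat \<Rightarrow> complex mat \<Rightarrow> complex mat" where
  "partial_trace dA dB M = mat dA dA (\<lambda>(i, i'). \<Sum>j<dB. M $$ (i * dB + j, i' * dB + j))"

text \<open>
  The basis vectors of the \<open>n\<close>-fold tensor power of a \<open>d\<close>-dimensional space are indexed by
  \<open>k < d ^ n\<close>, the index in the \<open>t\<close>-th factor being the \<open>t\<close>-th digit of \<open>k\<close> in base \<open>d\<close>.
\<close>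

definition digit :: "nat \<Rightarrow> nat \<Rightarrow> nat \<Rightarrow> nat" where
  "digit d t k = k div d ^ t mod d"

definition tensor_power :: "nat \<Rightarrow> nat \<Rightarrow> complex mat \<Rightarrow> complex mat" where
  "tensor_power d n M =
     mat (d ^ n) (d ^ n) (\<lambda>(k, l). \<Prod>t<n. M $$ (digit d t k, digit d t l))"

text \<open>
  The \<open>n\<close>-fold tensor power of an operator on \<open>A \<otimes> B\<close>, with the tensor factors reordered so
  that it acts on \<open>A\<^sup>n \<otimes> B\<^sup>n\<close>: an index of that space is \<open>a * dB ^ n + b\<close> with \<open>a < dA ^ n\<close> and
  \<open>b < dB ^ n\<close>, and \<open>pair_digit\<close> is the index in the \<open>t\<close>-th copy of \<open>A \<otimes> B\<close>.
\<close>

definition pair_digit :: "nat \<Rightarrow> nat \<Rightarrow> nat \<Rightarrow> nat \<Rightarrow> nat \<Rightarrow> nat" where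
  "pair_digit dA dB n t k = digit dA t (k div dB ^ n) * dB + digit dB t (k mod dB ^ n)"

definition bipartite_tensor_power :: "nat \<Rightarrow> nat \<Rightarrow> nat \<Rightarrow> complex mat \<Rightarrow> complex mat" where
  "bipartite_tensor_power dA dB n M =
     mat (dA ^ n * dB ^ n) (dA ^ n * dB ^ n)
       (\<lambda>(k, l). \<Prod>t<n. M $$ (pair_digit dA dB n t k, pair_digit dA dB n t l))"

definition extensions :: "nat \<Rightarrow> nat \<Rightarrow> nat \<Rightarrow> complex mat \<Rightarrow> complex mat set" where
  "extensions dA dB n \<sigma> =
     {\<sigma>' \<in> density (dA ^ n * dB ^ n). partial_trace (dA ^ n) (dB ^ n) \<sigma>' = tensor_power dA n \<sigma>}"

definition D_renyi_rate ::
    "ereal \<Rightarrow> nat \<Rightarrow> nat \<Rightarrow> complex mat \<Rightarrow> complex mat \<Rightarrow> nat \<Rightarrow> ereal" where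
  "D_renyi_rate \<alpha> dA dB \<rho> \<sigma> n =
     D_renyi_set \<alpha> (bipartite_tensor_power dA dB n \<rho>) (extensions dA dB n \<sigma>) / ereal (real n)"

text \<open>Meaningful when the sequence \<open>D_renyi_rate \<alpha> dA dB \<rho> \<sigma>\<close> converges in the extended reals.\<close>

definition D_renyi_reg ::
    "ereal \<Rightarrow> nat \<Rightarrow> nat \<Rightarrow> complex mat \<Rightarrow> complex mat \<Rightarrow> ereal" where
  "D_renyi_reg \<alpha> dA dB \<rho> \<sigma> = lim (D_renyi_rate \<alpha> dA dB \<rho> \<sigma>)"

end

theory Submission
  imports
    "HOL-Analysis.Analysis"
    "HOL-Real_Asymp.Real_Asymp"
    "Jordan_Normal_Form.Spectral_Radius"
    Defs
begin

text \<open>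
  On \<open>A\<^sup>n\<close> take projections \<open>\<Pi>\<^sub>k\<close> that refine the eigenspaces of \<open>\<sigma>\<^sub>A\<^sup>n\<close> and on whose ranges the ratio
  of the eigenvalues of the pinched \<open>\<rho>\<^sub>A\<^sup>n\<close> and of \<open>\<sigma>\<^sub>A\<^sup>n\<close> varies by at most a factor of 2. Since
  \<open>\<sigma>\<^sub>A\<^sup>n\<close> has polynomially many eigenvalues and ratios outside an interval of the form
  \<open>2\<^sup>-\<^sup>C\<^sup>n, \<dots>, 2\<^sup>C\<^sup>n\<close> are negligible, polynomially many projections suffice. Every loss below is a
  power of their number and disappears after division by \<open>n\<close>.

  Measuring the \<open>\<Pi>\<^sub>k \<otimes> 1\<close> bounds the divergence of \<open>\<rho>\<^sub>A\<^sub>B\<^sup>n\<close> from any extension of \<open>\<sigma>\<^sub>A\<^sup>n\<close> from below by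
  that of \<open>\<rho>\<^sub>A\<^sup>n\<close> from \<open>\<sigma>\<^sub>A\<^sup>n\<close>. Conversely, let \<open>R\<^sub>k = (\<Pi>\<^sub>k \<otimes> 1) \<rho>\<^sub>A\<^sub>B\<^sup>n (\<Pi>\<^sub>k \<otimes> 1)\<close>, let
  \<open>c\<^sub>k\<close> be the dyadic scale with \<open>c\<^sub>k tr\<^sub>B R\<^sub>k \<le> \<Pi>\<^sub>k \<sigma>\<^sub>A\<^sup>n\<close>, and let \<open>\<omega> = \<Sum>\<^sub>k c\<^sub>k R\<^sub>k\<close>. Then
  \<open>\<omega> + (\<sigma>\<^sub>A\<^sup>n - tr\<^sub>B \<omega>) \<otimes> 1 / d\<^sub>B\<^sup>n\<close> is an extension. It dominates \<open>\<omega>\<close>, so the Loewner-Heinz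
  inequality reduces its divergence to that from \<open>\<omega>\<close>, which commutes with \<open>\<Sum>\<^sub>k R\<^sub>k\<close>. For
  \<open>\<alpha> = \<infinity>\<close> a single projection suffices and nothing is lost.
\<close>

section \<open>Complex matrices of finite support\<close>

text \<open>Between both sides stands the classical sum of r^a s^(1-a), with r and s the diagonals
  of the pinched \<open>\<rho>\<^sub>A\<^sup>n\<close> and of
  \<open>\<sigma>\<^sub>A\<^sup>n\<close> in a joint eigenbasis. Scaling the state by s/r on A would
  give exactly this value, since (s/r)^(1-a) r = r^a s^(1-a), but such an operator need not commute
  with a state correlated with B. Rounding s/r to powers of 2 makes it constant on each
  \<open>\<Pi>\<^sub>k\<close>, hence commuting with the state pinched by the
  \<open>\<Pi>\<^sub>k\<close>, while the number of blocks, the price of the pinching, stays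
  polynomial. The exponents must stay in a range from -L to L with L = C n. For a > 1, finite
  divergence means \<open>\<rho>\<^sub>A\<close> \<le> 2^C \<open>\<sigma>\<^sub>A\<close> for some
  C, so s/r never falls below the range. For a < 1 it may leave on both sides, and C makes the
  resulting errors small against the n-th power of the single-copy trace. If that trace is 0, L
  tends to infinity at fixed n instead.\<close>

text \<open>
  Matrices of all sizes live in one type, where they form a ring without unit;
  \<open>fits d A\<close> says that \<open>A\<close> is a \<open>d \<times> d\<close> matrix, padded with zeros. Vectors are columns of matrices.
\<close>

typedef cmat = "{f :: nat \<Rightarrow> nat \<Rightarrow> complex. \<exists>d. \<forall>i j. d \<le> i \<or> d \<le> j \<longrightarrow> f i j = 0}"
  morphisms ent Cmat
  by (rule exI[of _ "\<lambda>_ _. 0"]) simp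

setup_lifting type_definition_cmat

definition fits :: "nat \<Rightarrow> cmat \<Rightarrow> bool" where
  "fits d A \<longleftrightarrow> (\<forall>i j. d \<le> i \<or> d \<le> j \<longrightarrow> ent A i j = 0)"

lemma ex_dim: "\<exists>d. fits d A"
  unfolding fits_def using ent[of A] by simp

lemma fits_mono: "fits d A \<Longrightarrow> d \<le> e \<Longrightarrow> fits e A"
  unfolding fits_def by auto

lemma ex_dim2: "\<exists>d. fits d A \<and> fits d B"
  by (meson fits_mono ex_dim max.cobounded1 max.cobounded2)

lemma cmat_eqI: "(\<And>i j. ent A i j = ent B i j) \<Longrightarrow> A = B"
  by (metis ent_inject ext)

lemma cmat_eqI': "fits d A \<Longrightarrow> fits d B \<Longrightarrow> (\<And>i j. i < d \<Longrightarrow> j < d \<Longrightarrow> ent A i j = ent B i j) \<Longrightarrow> A = B"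
  by (intro cmat_eqI) (metis fits_def not_le)

lift_definition mk :: "nat \<Rightarrow> (nat \<Rightarrow> nat \<Rightarrow> complex) \<Rightarrow> cmat" is
  "\<lambda>d f i j. if i < d \<and> j < d then f i j else 0"
  by (metis not_le)

lemma ent_mk: "ent (mk d f) i j = (if i < d \<and> j < d then f i j else 0)"
  by transfer simp

lemma fits_mk [simp, intro]: "fits d (mk d f)"
  by (auto simp: fits_def ent_mk)

lemma mk_cong: "(\<And>i j. i < d \<Longrightarrow> j < d \<Longrightarrow> f i j = g i j) \<Longrightarrow> mk d f = mk d g"
  by (intro cmat_eqI) (simp add: ent_mk)

instantiation cmat :: real_algebra
begin

lift_definition zero_cmat :: cmat is "\<lambda>_ _. 0"
  by simp

lift_definition plus_cmat :: "cmat \<Rightarrow> cmat \<Rightarrow> cmat" is "\<lambda>f g i j. f i j + g i j"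
proof -
  fix f g :: "nat \<Rightarrow> nat \<Rightarrow> complex"
  assume "\<exists>d. \<forall>i j. d \<le> i \<or> d \<le> j \<longrightarrow> f i j = 0" "\<exists>d. \<forall>i j. d \<le> i \<or> d \<le> j \<longrightarrow> g i j = 0"
  then obtain d e where "\<forall>i j. d \<le> i \<or> d \<le> j \<longrightarrow> f i j = 0" "\<forall>i j. e \<le> i \<or> e \<le> j \<longrightarrow> g i j = 0"
    by blast
  then show "\<exists>d. \<forall>i j. d \<le> i \<or> d \<le> j \<longrightarrow> f i j + g i j = 0"
    by (intro exI[of _ "max d e"]) auto
qed

lift_definition uminus_cmat :: "cmat \<Rightarrow> cmat" is "\<lambda>f i j. - f i j"
  by simp

definition minus_cmat :: "cmat \<Rightarrow> cmat \<Rightarrow> cmat" where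
  "minus_cmat A B = A + - B"

lift_definition scaleR_cmat :: "real \<Rightarrow> cmat \<Rightarrow> cmat" is "\<lambda>c f i j. complex_of_real c * f i j"
  by auto

text \<open>The sum runs over the nonzero entries of row \<open>i\<close>, a finite set, so that the
  product refers to no dimension.\<close>

lift_definition times_cmat :: "cmat \<Rightarrow> cmat \<Rightarrow> cmat" is
  "\<lambda>f g i j. \<Sum>k | f i k \<noteq> 0. f i k * g k j"
proof -
  fix f g :: "nat \<Rightarrow> nat \<Rightarrow> complex"
  assume "\<exists>d. \<forall>i j. d \<le> i \<or> d \<le> j \<longrightarrow> f i j = 0" "\<exists>d. \<forall>i j. d \<le> i \<or> d \<le> j \<longrightarrow> g i j = 0"
  then obtain d e where "\<forall>i j. d \<le> i \<or> d \<le> j \<longrightarrow> f i j = 0" "\<forall>i j. e \<le> i \<or> e \<le> j \<longrightarrow> g i j = 0"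
    by blast
  then show "\<exists>d. \<forall>i j. d \<le> i \<or> d \<le> j \<longrightarrow> (\<Sum>k | f i k \<noteq> 0. f i k * g k j) = 0"
    by (intro exI[of _ "max d e"]) (auto intro!: sum.neutral)
qed

lemma ent_plus': "ent (A + B) i j = ent A i j + ent B i j"
  by transfer simp

lemma ent_mult_aux:
  assumes "\<And>i k. d \<le> k \<Longrightarrow> ent A i k * ent B k j = 0"
  shows "ent (A * B) i j = (\<Sum>k<d. ent A i k * ent B k j)"
proof -
  have fin: "finite {k. ent A i k \<noteq> 0}"
  proof -
    obtain e where "fits e A" using ex_dim by blast
    then have "{k. ent A i k \<noteq> 0} \<subseteq> {..<e}" by (auto simp: fits_def not_le[symmetric])
    then show ?thesis by (rule finite_subset) simp
  qed
  have "ent (A * B) i j = (\<Sum>k | ent A i k \<noteq> 0. ent A i k * ent B k j)"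
    by transfer simp
  also have "\<dots> = (\<Sum>k \<in> {k. ent A i k \<noteq> 0} \<union> {..<d}. ent A i k * ent B k j)"
    by (rule sum.mono_neutral_left) (use fin in auto)
  also have "\<dots> = (\<Sum>k<d. ent A i k * ent B k j)"
    by (rule sum.mono_neutral_right) (use fin assms in \<open>auto simp: not_less\<close>)
  finally show ?thesis .
qed

lemma ent_mult_l: "fits d A \<Longrightarrow> ent (A * B) i j = (\<Sum>k<d. ent A i k * ent B k j)"
  by (rule ent_mult_aux) (auto simp: fits_def)

lemma ent_mult_r: "fits d B \<Longrightarrow> ent (A * B) i j = (\<Sum>k<d. ent A i k * ent B k j)"
  by (rule ent_mult_aux) (auto simp: fits_def)

instance
proof
  fix A B C :: cmat and a b :: real
  show "A + B + C = A + (B + C)" by transfer (simp add: add.assoc)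
  show "A + B = B + A" by transfer (simp add: add.commute)
  show "0 + A = A" by transfer simp
  show "- A + A = 0" by transfer simp
  show "A - B = A + - B" by (rule minus_cmat_def)
  show "a *\<^sub>R (A + B) = a *\<^sub>R A + a *\<^sub>R B" by transfer (simp add: algebra_simps)
  show "(a + b) *\<^sub>R A = a *\<^sub>R A + b *\<^sub>R A" by transfer (simp add: algebra_simps)
  show "a *\<^sub>R b *\<^sub>R A = (a * b) *\<^sub>R A" by transfer (simp add: algebra_simps)
  show "1 *\<^sub>R A = A" by transfer simp
  have sc: "ent (a *\<^sub>R A) i j = a * ent A i j" for a A i j by transfer simp
  obtain d where d: "fits d A" "fits d B" using ex_dim2 by blast
  then have d': "fits d (a *\<^sub>R A)" by (auto simp: fits_def sc)
  show "a *\<^sub>R A * B = a *\<^sub>R (A * B)"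
    by (rule cmat_eqI) (simp add: sc ent_mult_l[OF d(1)] ent_mult_l[OF d'] sum_distrib_left mult.assoc)
  show "A * a *\<^sub>R B = a *\<^sub>R (A * B)"
    by (rule cmat_eqI) (simp add: sc ent_mult_l[OF d(1)] sum_distrib_left algebra_simps)
  show "(A + B) * C = A * C + B * C"
  proof -
    have "fits d (A + B)" using d by (auto simp: fits_def ent_plus')
    then show ?thesis
      by (intro cmat_eqI)
        (simp add: ent_mult_l[OF d(1)] ent_mult_l[OF d(2)] ent_mult_l ent_plus' algebra_simps sum.distrib)
  qed
  show "C * (A + B) = C * A + C * B"
  proof -
    have "fits d (A + B)" using d by (auto simp: fits_def ent_plus')
    then show ?thesis
      by (intro cmat_eqI)
        (simp add: ent_mult_r[OF d(1)] ent_mult_r[OF d(2)] ent_mult_r ent_plus' algebra_simps sum.distrib)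
  qed
  show "A * B * C = A * (B * C)"
  proof (rule cmat_eqI)
    fix i j
    obtain e where e: "fits e C" using ex_dim by blast
    have dAB: "ent (A * B * C) i j = (\<Sum>k<e. ent (A * B) i k * ent C k j)"
      by (rule ent_mult_r[OF e])
    also have "\<dots> = (\<Sum>k<e. \<Sum>m<d. ent A i m * ent B m k * ent C k j)"
      by (simp add: ent_mult_l[OF d(1)] sum_distrib_right)
    also have "\<dots> = (\<Sum>m<d. \<Sum>k<e. ent A i m * ent B m k * ent C k j)"
      by (rule sum.swap)
    also have "\<dots> = (\<Sum>m<d. ent A i m * ent (B * C) m j)"
      by (simp add: ent_mult_r[OF e] sum_distrib_left mult.assoc)
    also have "\<dots> = ent (A * (B * C)) i j"
      by (simp add: ent_mult_l[OF d(1)])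
    finally show "ent (A * B * C) i j = ent (A * (B * C)) i j" .
  qed
qed

end

lemma ent_0 [simp]: "ent 0 i j = 0"
  by transfer simp

lemma ent_plus [simp]: "ent (A + B) i j = ent A i j + ent B i j"
  by transfer simp

lemma ent_uminus [simp]: "ent (- A) i j = - ent A i j"
  by transfer simp

lemma ent_minus [simp]: "ent (A - B) i j = ent A i j - ent B i j"
  unfolding minus_cmat_def by (simp only: ent_plus ent_uminus diff_conv_add_uminus)

lemma ent_scaleR [simp]: "ent (c *\<^sub>R A) i j = complex_of_real c * ent A i j"
  by transfer simp

lemma ent_sum: "ent (sum f S) i j = (\<Sum>x\<in>S. ent (f x) i j)"
  by (induction S rule: infinite_finite_induct) auto

lemma fits_0 [simp, intro]: "fits d 0"
  and fits_plus [simp, intro]: "fits d A \<Longrightarrow> fits d B \<Longrightarrow> fits d (A + B)"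
  and fits_uminus [simp, intro]: "fits d A \<Longrightarrow> fits d (- A)"
  and fits_minus [simp, intro]: "fits d A \<Longrightarrow> fits d B \<Longrightarrow> fits d (A - B)"
  and fits_scaleR [simp, intro]: "fits d A \<Longrightarrow> fits d (c *\<^sub>R A)"
  by (auto simp: fits_def)

lemma fits_mult [simp, intro]: "fits d A \<Longrightarrow> fits d B \<Longrightarrow> fits d (A * B)"
  unfolding fits_def[of d "A * B"] by (auto simp: ent_mult_l fits_def intro!: sum.neutral)

lemma fits_sum [intro]: "(\<And>x. x \<in> S \<Longrightarrow> fits d (f x)) \<Longrightarrow> fits d (sum f S)"
  by (auto simp: fits_def ent_sum intro!: sum.neutral)

section \<open>Adjoint, trace, diagonal matrices and positivity\<close>

lift_definition adj :: "cmat \<Rightarrow> cmat" is "\<lambda>f i j. cnj (f j i)"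
  by auto

lemma ent_adj [simp]: "ent (adj A) i j = cnj (ent A j i)"
  by transfer simp

lemma adj_adj [simp]: "adj (adj A) = A"
  and adj_plus [simp]: "adj (A + B) = adj A + adj B"
  and adj_minus [simp]: "adj (A - B) = adj A - adj B"
  and adj_uminus [simp]: "adj (- A) = - adj A"
  and adj_scaleR [simp]: "adj (c *\<^sub>R A) = c *\<^sub>R adj A"
  and adj_0 [simp]: "adj 0 = 0"
  by (rule cmat_eqI; simp)+

lemma adj_sum: "adj (sum f S) = (\<Sum>x\<in>S. adj (f x))"
  by (rule cmat_eqI) (simp add: ent_sum cnj_sum)

lemma fits_adj [simp]: "fits d (adj A) \<longleftrightarrow> fits d A"
  by (auto simp: fits_def)

lemma adj_mult [simp]: "adj (A * B) = adj B * adj A"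
proof (rule cmat_eqI)
  fix i j
  obtain d where d: "fits d A" using ex_dim by blast
  then have d': "fits d (adj A)" by simp
  show "ent (adj (A * B)) i j = ent (adj B * adj A) i j"
    by (simp add: ent_mult_l[OF d] ent_mult_r[OF d'] cnj_sum mult.commute)
qed

definition tr :: "cmat \<Rightarrow> complex" where
  "tr A = (\<Sum>i | ent A i i \<noteq> 0. ent A i i)"

lemma tr_eq: "fits d A \<Longrightarrow> tr A = (\<Sum>i<d. ent A i i)"
  unfolding tr_def by (rule sum.mono_neutral_left) (auto simp: fits_def not_le[symmetric])

lemma tr_0 [simp]: "tr 0 = 0"
  by (simp add: tr_def)

lemma tr_plus [simp]: "tr (A + B) = tr A + tr B"
proof -
  obtain d where "fits d A" "fits d B" using ex_dim2 by blast
  then show ?thesis by (simp add: tr_eq[of d] sum.distrib)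
qed

lemma tr_scaleR [simp]: "tr (c *\<^sub>R A) = c * tr A"
proof -
  obtain d where "fits d A" using ex_dim by blast
  then show ?thesis by (simp add: tr_eq[of d] sum_distrib_left)
qed

lemma tr_uminus [simp]: "tr (- A) = - tr A"
  using tr_plus[of A "- A"] by (simp add: eq_neg_iff_add_eq_0 add.commute)

lemma tr_minus [simp]: "tr (A - B) = tr A - tr B"
  using tr_plus[of A "- B"] by simp

lemma tr_sum: "tr (sum f S) = (\<Sum>x\<in>S. tr (f x))"
  by (induction S rule: infinite_finite_induct) auto

lemma tr_adj: "tr (adj A) = cnj (tr A)"
proof -
  obtain d where "fits d A" using ex_dim by blast
  then show ?thesis by (simp add: tr_eq[of d] cnj_sum)
qed

lemma tr_mult_commute: "tr (A * B) = tr (B * A)"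
proof -
  obtain d where d: "fits d A" "fits d B" using ex_dim2 by blast
  show ?thesis
    by (simp add: tr_eq[of d] d ent_mult_l[of d] mult.commute) (rule sum.swap)
qed

definition dg :: "nat \<Rightarrow> (nat \<Rightarrow> complex) \<Rightarrow> cmat" where
  "dg d l = mk d (\<lambda>i j. if i = j then l i else 0)"

abbreviation idm :: "nat \<Rightarrow> cmat" where
  "idm d \<equiv> dg d (\<lambda>_. 1)"

lemma ent_dg: "ent (dg d l) i j = (if i < d \<and> i = j then l i else 0)"
  by (auto simp: dg_def ent_mk)

lemma fits_dg [simp, intro]: "fits d (dg d l)"
  by (simp add: dg_def)

lemma ent_dg_mult: "ent (dg d l * A) i j = (if i < d then l i * ent A i j else 0)"
proof -
  have "(\<Sum>k<d. ent (dg d l) i k * ent A k j) = (\<Sum>k<d. if k = i then l i * ent A i j else 0)"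
    by (rule sum.cong) (auto simp: ent_dg)
  then show ?thesis by (simp add: ent_mult_l[OF fits_dg])
qed

lemma ent_mult_dg: "ent (A * dg d l) i j = (if j < d then ent A i j * l j else 0)"
proof -
  have "(\<Sum>k<d. ent A i k * ent (dg d l) k j) = (\<Sum>k<d. if k = j then ent A i j * l j else 0)"
    by (rule sum.cong) (auto simp: ent_dg)
  then show ?thesis by (simp add: ent_mult_r[OF fits_dg])
qed

lemma idm_mult [simp]: "fits d A \<Longrightarrow> idm d * A = A"
  by (rule cmat_eqI) (auto simp: ent_dg_mult fits_def)

lemma mult_idm [simp]: "fits d A \<Longrightarrow> A * idm d = A"
  by (rule cmat_eqI) (auto simp: ent_mult_dg fits_def)

lemma adj_dg: "adj (dg d l) = dg d (\<lambda>i. cnj (l i))"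
  by (rule cmat_eqI) (auto simp: ent_dg)

lemma dg_mult_dg: "dg d l * dg d m = dg d (\<lambda>i. l i * m i)"
  by (rule cmat_eqI) (auto simp: ent_dg_mult ent_dg)

lemma dg_cong: "(\<And>i. i < d \<Longrightarrow> l i = m i) \<Longrightarrow> dg d l = dg d m"
  by (rule cmat_eqI) (auto simp: ent_dg)

lemma tr_dg: "tr (dg d l) = (\<Sum>i<d. l i)"
  by (simp add: tr_eq[OF fits_dg] ent_dg)

lemma ent_gram: "fits d A \<Longrightarrow> ent (adj A * B) i j = (\<Sum>k<d. cnj (ent A k i) * ent B k j)"
  by (subst ent_mult_l[of d]) auto

lemma ent_gram_diag: "fits d A \<Longrightarrow> ent (adj A * A) i i = complex_of_real (\<Sum>k<d. (cmod (ent A k i))\<^sup>2)"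
  by (simp add: ent_gram complex_norm_square mult.commute flip: of_real_power)

text \<open>Each diagonal entry of the Gram matrix is the squared norm of a column of
  \<open>A\<close>.\<close>

lemma gram_eq_0_iff: "adj A * A = 0 \<longleftrightarrow> A = 0"
proof
  assume A: "adj A * A = 0"
  obtain d where d: "fits d A" using ex_dim by blast
  show "A = 0"
  proof (rule cmat_eqI'[OF d fits_0])
    fix i j assume ij: "i < d" "j < d"
    have "complex_of_real (\<Sum>k<d. (cmod (ent A k j))\<^sup>2) = 0"
      using ent_gram_diag[OF d, of j] A by simp
    then have "(\<Sum>k<d. (cmod (ent A k j))\<^sup>2) = 0"
      by (simp only: of_real_eq_0_iff)
    then show "ent A i j = ent 0 i j"
      using ij by (simp add: sum_nonneg_eq_0_iff)
  qed
qed simp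

text \<open>The test vectors are the columns of all \<open>V\<close>. They may be longer than
  \<open>M\<close> is large; the surplus entries meet only zeros of \<open>M\<close>.\<close>

definition psd_op :: "cmat \<Rightarrow> bool" where
  "psd_op M \<longleftrightarrow> adj M = M \<and> (\<forall>V j. 0 \<le> Re (ent (adj V * M * V) j j))"

lemma psdI_gram: "psd_op (adj K * K)"
proof -
  have "0 \<le> Re (ent (adj V * (adj K * K) * V) j j)" for V j
  proof -
    obtain d where d: "fits d (K * V)" using ex_dim by blast
    have "adj V * (adj K * K) * V = adj (K * V) * (K * V)"
      by (simp add: mult.assoc)
    then show ?thesis
      by (simp only: ent_gram_diag[OF d]) (simp add: sum_nonneg)
  qed
  then show ?thesis by (simp add: psd_op_def)
qed

lemma psd_adj: "psd_op M \<Longrightarrow> adj M = M"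
  by (simp add: psd_op_def)

lemma psd_0 [simp, intro]: "psd_op 0"
  by (simp add: psd_op_def)

lemma psd_plus [intro]: "psd_op A \<Longrightarrow> psd_op B \<Longrightarrow> psd_op (A + B)"
  by (auto simp: psd_op_def distrib_left distrib_right)

lemma psd_scaleR [intro]: "psd_op A \<Longrightarrow> 0 \<le> c \<Longrightarrow> psd_op (c *\<^sub>R A)"
  by (auto simp: psd_op_def)

lemma psd_sum: "(\<And>x. x \<in> S \<Longrightarrow> psd_op (f x)) \<Longrightarrow> psd_op (sum f S)"
  by (induction S rule: infinite_finite_induct) auto

lemma psd_sandwich [intro]: "psd_op M \<Longrightarrow> psd_op (adj K * M * K)"
proof -
  assume M: "psd_op M"
  have eq: "adj V * (adj K * M * K) * V = adj (K * V) * M * (K * V)" for V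
    by (simp add: mult.assoc)
  have "adj (adj K * M * K) = adj K * M * K"
    using M by (simp add: psd_op_def mult.assoc)
  then show ?thesis using M unfolding psd_op_def eq by blast
qed

lemma psd_sandwich': "psd_op M \<Longrightarrow> adj K = K \<Longrightarrow> psd_op (K * M * K)"
  using psd_sandwich[of M K] by simp

lemma psd_diag: "psd_op M \<Longrightarrow> 0 \<le> Re (ent M j j)"
proof -
  assume M: "psd_op M"
  obtain d where d: "fits d M" using ex_dim by blast
  have "adj (idm d) * M * idm d = M"
    using d by (simp add: adj_dg)
  then show ?thesis using M by (metis psd_op_def)
qed

lemma psd_diag_Im: "adj M = M \<Longrightarrow> Im (ent M j j) = 0"
  by (metis Reals_cnj_iff complex_is_Real_iff ent_adj)

lemma tr_psd_nonneg: "psd_op M \<Longrightarrow> 0 \<le> Re (tr M)"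
proof -
  assume M: "psd_op M"
  obtain d where d: "fits d M" using ex_dim by blast
  show ?thesis by (simp add: tr_eq[OF d] sum_nonneg psd_diag M)
qed

lemma tr_herm_Im: "adj M = M \<Longrightarrow> Im (tr M) = 0"
  by (metis Reals_cnj_iff complex_is_Real_iff tr_adj)

section \<open>Spectral theorem and functional calculus\<close>

definition unitary :: "nat \<Rightarrow> cmat \<Rightarrow> bool" where
  "unitary d U \<longleftrightarrow> fits d U \<and> adj U * U = idm d \<and> U * adj U = idm d"

lemma unitary_dim: "unitary d U \<Longrightarrow> fits d U"
  by (simp add: unitary_def)

lemma unitary_simps:
  assumes "unitary d U"
  shows "fits d U" "adj U * U = idm d" "U * adj U = idm d"
    "fits d X \<Longrightarrow> adj U * (U * X) = X" "fits d X \<Longrightarrow> U * (adj U * X) = X"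
  using assms by (auto simp: unitary_def simp flip: mult.assoc)

lemma unitary_idm: "unitary d (idm d)"
  by (auto simp: unitary_def adj_dg dg_mult_dg)

lemma unitary_mult: "unitary d U \<Longrightarrow> unitary d V \<Longrightarrow> unitary d (U * V)"
  unfolding unitary_def by (simp add: mult.assoc) (simp add: mult.assoc[symmetric])

lemma dg_const_commute: "fits d A \<Longrightarrow> dg d (\<lambda>_. c) * A = A * dg d (\<lambda>_. c)"
  by (rule cmat_eqI) (auto simp: ent_dg_mult ent_mult_dg fits_def)

text \<open>Everything on spectra rests on this fact: the spectrum of a complex matrix of positive
  size is nonempty.\<close>

lemma ex_eigenvector:
  assumes M: "fits d M" and d: "0 < d"
  obtains v c where "\<exists>i<d. v i \<noteq> 0" "\<And>i. i < d \<Longrightarrow> (\<Sum>k<d. ent M i k * v k) = c * v i"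
proof -
  define A where "A = Matrix.mat d d (\<lambda>(i, j). ent M i j)"
  have A: "A \<in> carrier_mat d d" by (simp add: A_def)
  obtain c where "c \<in> spectrum A"
    using spectrum_non_empty[OF A d] by blast
  then have "eigenvalue A c" by (simp add: spectrum_def)
  then obtain w where w: "w \<in> carrier_vec d" "w \<noteq> 0\<^sub>v d" "A *\<^sub>v w = c \<cdot>\<^sub>v w"
    using A by (auto simp: eigenvalue_def eigenvector_def)
  show thesis
  proof (rule that[of "\<lambda>i. vec_index w i" c])
    show "\<exists>i<d. vec_index w i \<noteq> 0"
    proof (rule ccontr)
      assume "\<not> (\<exists>i<d. vec_index w i \<noteq> 0)"
      then have "w = 0\<^sub>v d" using w(1) by (intro eq_vecI) auto
      then show False using w(2) by simp
    qed
    fix i assume i: "i < d"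
    have "vec_index (A *\<^sub>v w) i = (\<Sum>k<d. ent M i k * vec_index w k)"
      using i w(1) by (simp add: A_def scalar_prod_def atLeast0LessThan)
    then show "(\<Sum>k<d. ent M i k * vec_index w k) = c * vec_index w i"
      using w(1,3) i by simp
  qed
qed

text \<open>The last entry is made real because a hermitian reflection can map the last basis vector
  to v only if their inner product is real.\<close>

lemma ex_unit_eigenvector:
  assumes M: "fits (Suc d) M"
  obtains v c where "(\<Sum>i<Suc d. (cmod (v i))\<^sup>2) = 1" "Im (v d) = 0"
    "\<And>i. i < Suc d \<Longrightarrow> (\<Sum>k<Suc d. ent M i k * v k) = c * v i"
proof -
  obtain u c where u: "\<exists>i<Suc d. u i \<noteq> 0"
    "\<And>i. i < Suc d \<Longrightarrow> (\<Sum>k<Suc d. ent M i k * u k) = c * u i"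
    using ex_eigenvector[OF M] by blast
  define N where "N = (\<Sum>i<Suc d. (cmod (u i))\<^sup>2)"
  obtain i0 where "i0 < Suc d" "u i0 \<noteq> 0" using u(1) by blast
  then have "N > 0" unfolding N_def by (intro sum_pos2[of _ i0]) auto
  \<comment> \<open>The phase rotates \<open>u d\<close> onto the nonnegative real axis; a vanishing
    \<open>u d\<close> is real already.\<close>
  define ph where "ph = (if u d = 0 then 1 else cnj (u d) / cmod (u d))"
  have ph: "cmod ph = 1" by (auto simp: ph_def norm_divide)
  have phu: "Im (ph * u d) = 0"
    by (auto simp: ph_def mult.commute complex_mult_cnj)
  define v where "v = (\<lambda>i. ph / sqrt N * u i)"
  show thesis
  proof (rule that[of v c])
    have "(\<Sum>i<Suc d. (cmod (v i))\<^sup>2) = (\<Sum>i<Suc d. (cmod (u i))\<^sup>2 / N)"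
      using \<open>N > 0\<close> by (intro sum.cong) (auto simp: v_def norm_mult norm_divide ph power_divide)
    also have "\<dots> = 1"
      using \<open>N > 0\<close> by (simp add: N_def flip: sum_divide_distrib)
    finally show "(\<Sum>i<Suc d. (cmod (v i))\<^sup>2) = 1" .
    have "v d = (ph * u d) / complex_of_real (sqrt N)" by (simp add: v_def)
    then show "Im (v d) = 0" using phu by (simp add: Im_divide_of_real)
    fix i assume i: "i < Suc d"
    have "(\<Sum>k<Suc d. ent M i k * v k) = ph / sqrt N * (\<Sum>k<Suc d. ent M i k * u k)"
      by (simp only: v_def sum_distrib_left) (rule sum.cong, auto)
    then show "(\<Sum>k<Suc d. ent M i k * v k) = c * v i"
      using u(2)[OF i] by (simp add: v_def)
  qed
qed

text \<open>The Householder reflection along \<open>v - e\<^sub>d\<close>.\<close>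

lemma ex_reflection:
  assumes v: "(\<Sum>i<Suc d. (cmod (v i))\<^sup>2) = 1" "Im (v d) = 0"
  obtains W where "unitary (Suc d) W" "adj W = W" "\<And>i. i < Suc d \<Longrightarrow> ent W i d = v i"
proof (cases "v d = 1")
  \<comment> \<open>Here v is the last basis vector itself, the vector of the reflection vanishes,
    and the identity takes its place.\<close>
  case True
  have "v i = 0" if "i < d" for i
  proof -
    have "(\<Sum>i<d. (cmod (v i))\<^sup>2) = 0" using v(1) True by simp
    then show ?thesis using that by (simp add: sum_nonneg_eq_0_iff)
  qed
  then show thesis
    using True by (intro that[of "idm (Suc d)"] unitary_idm) (auto simp: adj_dg ent_dg less_Suc_eq)
next
  case False
  let ?n = "Suc d"
  \<comment> \<open>Vectors are stored in column \<open>d\<close>: \<open>E\<close> stands for the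
    basis vector with index \<open>d\<close> and also for the projection onto it, \<open>X\<close>
    for v, and \<open>w\<close> for their difference.\<close>
  define E where "E = dg ?n (\<lambda>i. if i = d then 1 else 0)"
  define X where "X = mk ?n (\<lambda>i j. if j = d then v i else 0)"
  define w where "w = X - E"
  \<comment> \<open>The squared norm of \<open>w\<close>, because v has norm 1 and a real last
    entry.\<close>
  define r where "r = 2 * (1 - Re (v d))"
  have vd: "v d = complex_of_real (Re (v d))" using v(2) by (simp add: complex_eq_iff)
  then have r: "r \<noteq> 0" using False by (auto simp: r_def complex_eq_iff v(2))
  have dims: "fits ?n E" "fits ?n X" "fits ?n w" by (auto simp: E_def X_def w_def)
  have EE: "E * E = E" "adj E = E" by (auto simp: E_def dg_mult_dg adj_dg intro!: dg_cong)
  have wE: "w * E = w"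
    by (rule cmat_eqI) (auto simp: E_def ent_mult_dg w_def X_def ent_mk ent_dg)
  have XX: "adj X * X = E"
  proof (rule cmat_eqI)
    fix i j
    have "ent (adj X * X) i j = (\<Sum>k<?n. cnj (ent X k i) * ent X k j)"
      by (rule ent_gram[OF dims(2)])
    also have "\<dots> = (if i = d \<and> j = d then \<Sum>k<?n. cnj (v k) * v k else 0)"
      by (auto simp: X_def ent_mk intro!: sum.neutral)
    also have "(\<Sum>k<?n. cnj (v k) * v k) = complex_of_real (\<Sum>k<?n. (cmod (v k))\<^sup>2)"
      by (simp add: complex_norm_square mult.commute flip: of_real_power)
    also have "complex_of_real (\<Sum>k<?n. (cmod (v k))\<^sup>2) = 1" by (simp only: v(1) of_real_1)
    finally show "ent (adj X * X) i j = ent E i j"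
      by (auto simp: E_def ent_dg)
  qed
  have XE: "adj X * E = Re (v d) *\<^sub>R E"
    by (rule cmat_eqI) (use v(2) in \<open>auto simp: E_def ent_mult_dg X_def ent_mk ent_dg complex_eq_iff\<close>)
  have EX: "E * X = Re (v d) *\<^sub>R E"
    using arg_cong[OF XE, of adj] EE by simp
  have "r = 1 + 1 - Re (v d) - Re (v d)" by (simp add: r_def)
  then have rE: "r *\<^sub>R E = E + E - Re (v d) *\<^sub>R E - Re (v d) *\<^sub>R E"
    by (simp only: scaleR_left_diff_distrib scaleR_left_distrib scaleR_one)
  have ww: "adj w * w = r *\<^sub>R E"
    unfolding rE by (simp add: w_def EE XX XE EX left_diff_distrib right_diff_distrib)
  define W where "W = idm ?n - (2 / r) *\<^sub>R (w * adj w)"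
  have adjW: "adj W = W" by (simp add: W_def adj_dg)
  have "w * adj w * (w * adj w) = w * (adj w * w) * adj w" by (simp add: mult.assoc)
  also have "\<dots> = r *\<^sub>R (w * adj w)" by (simp add: ww wE)
  finally have www: "w * adj w * (w * adj w) = r *\<^sub>R (w * adj w)" .
  have WW: "W * W = idm ?n"
    using dims r
    by (simp add: W_def left_diff_distrib right_diff_distrib www dg_mult_dg)
      (simp add: algebra_simps flip: scaleR_2)
  have rr: "- (r / 2) = Re (v d) - 1" by (simp add: r_def field_simps)
  have "W * E = E - (2 / r) *\<^sub>R (w * (adj w * E))"
    using dims by (simp add: W_def left_diff_distrib mult.assoc)
  also have "adj w * E = (Re (v d) - 1) *\<^sub>R E"
    by (simp add: w_def left_diff_distrib XE EE scaleR_left_diff_distrib)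
  also have "w * ((Re (v d) - 1) *\<^sub>R E) = (- (r / 2)) *\<^sub>R w"
    by (simp add: rr wE)
  also have "E - (2 / r) *\<^sub>R ((- (r / 2)) *\<^sub>R w) = X"
    using r by (simp add: w_def algebra_simps)
  finally have WE: "W * E = X" .
  show thesis
  proof (rule that[of W])
    show "unitary ?n W" using WW adjW dims by (auto simp: unitary_def W_def)
    show "adj W = W" by (rule adjW)
    fix i assume "i < ?n"
    then show "ent W i d = v i"
      using arg_cong[OF WE, of "\<lambda>A. ent A i d"] by (simp add: E_def ent_mult_dg X_def ent_mk)
  qed
qed

text \<open>Deflation: a reflection moves an eigenvector to the last basis vector, normality clears
  the last row along with the last column, and the induction hypothesis diagonalises the remaining
  block. Normal rather than hermitian operators are treated because a commuting hermitian pair is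
  encoded as one normal operator in \<open>spectral_pair\<close>.\<close>

theorem spectral_normal:
  assumes "fits d M" "M * adj M = adj M * M"
  shows "\<exists>U l. unitary d U \<and> M = U * dg d l * adj U"
  using assms
proof (induction d arbitrary: M)
  case 0
  then have "M = 0" by (intro cmat_eqI) (auto simp: fits_def)
  then show ?case using unitary_idm[of 0]
    by (intro exI[of _ "idm 0"] exI[of _ "\<lambda>_. 0"]) (auto intro!: cmat_eqI simp: ent_dg_mult ent_mult_dg)
next
  case (Suc d)
  let ?n = "Suc d"
  obtain v c where v: "(\<Sum>i<?n. (cmod (v i))\<^sup>2) = 1" "Im (v d) = 0"
    "\<And>i. i < ?n \<Longrightarrow> (\<Sum>k<?n. ent M i k * v k) = c * v i"
    using ex_unit_eigenvector[OF Suc.prems(1)] by blast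
  obtain W where W: "unitary ?n W" "adj W = W" "\<And>i. i < ?n \<Longrightarrow> ent W i d = v i"
    using ex_reflection[OF v(1,2)] by blast
  note dM = Suc.prems(1)
  have WW: "W * W = idm ?n" "fits ?n W" using W(1,2) by (auto simp: unitary_def)
  have WWX: "W * (W * X) = X" if "fits ?n X" for X
    using that by (simp add: WW flip: mult.assoc)
  define E where "E = dg ?n (\<lambda>i. if i = d then 1 else 0)"
  define T where "T = dg ?n (\<lambda>i. if i = d then c else 0)"
  define C where "C = dg ?n (\<lambda>_. c)"
  have dims: "fits ?n E" "fits ?n T" "fits ?n C" by (auto simp: E_def T_def C_def)
  have CE: "C * E = T" "E * C = T" "E * E = E" "adj E = E" "T * E = T" "E * T = T"
    "E * adj T = adj T" "adj T * E = adj T" "T * adj T = adj T * T"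
    by (auto simp: E_def T_def C_def dg_mult_dg adj_dg intro!: dg_cong)
  define N where "N = W * M * W"
  have dN: "fits ?n N" using dM WW by (simp add: N_def)
  have MWE: "M * (W * E) = W * T"
  proof (rule cmat_eqI'[of ?n])
    fix i j assume ij: "i < ?n" "j < ?n"
    have WE: "W * E = mk ?n (\<lambda>i j. if j = d then v i else 0)"
      by (rule cmat_eqI'[of ?n])
        (use WW(2) W(3) in \<open>auto simp: dims ent_mk E_def ent_mult_dg\<close>)
    have "ent (M * (W * E)) i j = (if j = d then \<Sum>k<?n. ent M i k * v k else 0)"
      unfolding WE using ij by (subst ent_mult_l[OF dM]) (auto simp: ent_mk)
    also have "\<dots> = ent (W * T) i j"
      using ij W(3) v(3)[of i] by (simp add: T_def ent_mult_dg)
    finally show "ent (M * (W * E)) i j = ent (W * T) i j" .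
  qed (use dM WW dims in auto)
  have NE: "N * E = T"
    using MWE WW dims by (simp add: N_def mult.assoc WWX)
  have adjN: "adj N = W * adj M * W" by (simp add: N_def W(2) mult.assoc)
  have "N * adj N = W * (M * adj M) * W" "adj N * N = W * (adj M * M) * W"
    using dM WW by (simp_all add: N_def mult.assoc WWX W(2))
  then have normN: "N * adj N = adj N * N" by (simp only: Suc.prems(2))
  \<comment> \<open>A vector annihilated by the normal operator \<open>N - C\<close> is annihilated
    by its adjoint too, since both images have the same norm.\<close>
  have adjNE: "adj N * E = adj T"
  proof -
    let ?R = "N - C"
    have RE: "?R * E = 0" by (simp add: left_diff_distrib NE CE)
    have CN: "C * adj N = adj N * C" "adj C * N = N * adj C" "C * adj C = adj C * C"
      using dN unfolding C_def adj_dg by (simp_all add: dg_const_commute dg_mult_dg mult.commute)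
    have nR: "?R * adj ?R = adj ?R * ?R"
      using CN normN by (simp add: algebra_simps)
    have "adj (adj ?R * E) * (adj ?R * E) = E * (?R * adj ?R) * E"
      by (simp add: CE mult.assoc)
    also have "\<dots> = E * adj ?R * (?R * E)" by (simp only: nR mult.assoc)
    also have "\<dots> = 0" by (simp only: RE mult_zero_right)
    finally have "adj ?R * E = 0" by (simp only: gram_eq_0_iff)
    then have "adj N * E = adj C * E" by (simp add: left_diff_distrib)
    also have "\<dots> = adj (E * C)" by (simp only: adj_mult CE(4))
    finally show ?thesis by (simp only: CE)
  qed
  have EN: "E * N = T" using arg_cong[OF adjNE, of adj] by (simp add: CE)
  have EadjN: "E * adj N = adj T" using arg_cong[OF NE, of adj] by (simp add: CE)
  \<comment> \<open>Removing the eigenvalue leaves zeros in the last row and column, so that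
    \<open>N'\<close> fits the smaller dimension.\<close>
  define N' where "N' = N - T"
  have "N * adj T = N * E * adj T" "T * adj N = T * (E * adj N)" "adj N * T = adj N * E * T"
    "adj T * N = adj T * (E * N)"
    by (simp_all add: mult.assoc CE) (simp_all add: CE flip: mult.assoc)
  then have NT: "N * adj T = T * adj T" "T * adj N = T * adj T" "adj N * T = adj T * T" "adj T * N = adj T * T"
    by (simp_all only: NE EN EadjN adjNE)
  have nN': "N' * adj N' = adj N' * N'"
    by (simp add: N'_def left_diff_distrib right_diff_distrib NT normN CE)
  have dN': "fits d N'"
  proof -
    have a: "N' * E = 0" "E * N' = 0" by (auto simp: N'_def algebra_simps NE EN CE)
    have b: "ent N' i d = 0" "ent N' d i = 0" for i
      using arg_cong[OF a(1), of "\<lambda>A. ent A i d"] arg_cong[OF a(2), of "\<lambda>A. ent A d i"]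
      by (auto simp: E_def ent_mult_dg ent_dg_mult)
    have "fits ?n N'" using dN dims by (simp add: N'_def)
    with b show ?thesis unfolding fits_def by (metis Suc_leI le_neq_implies_less)
  qed
  obtain V l where V: "unitary d V" and l: "N' = V * dg d l * adj V"
    using Suc.IH[OF dN' nN'] by blast
  have VE: "V * E = 0" "E * V = 0" "adj V * E = 0" "E * adj V = 0"
    using unitary_dim[OF V] by (auto intro!: cmat_eqI simp: E_def ent_mult_dg ent_dg_mult fits_def)
  define l' where "l' = l(d := c)"
  have dgl': "dg ?n l' = dg d l + T" by (rule cmat_eqI) (auto simp: l'_def T_def ent_dg)
  have dgE: "dg d l * E = 0" "E * dg d l = 0"
    by (auto simp: E_def intro!: cmat_eqI simp: ent_dg_mult ent_mult_dg ent_dg)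
  have VT: "V * T = 0" "T * adj V = 0"
    using VE by (metis CE(6) mult.assoc mult_zero_left, metis CE(5) mult.assoc mult_zero_right)
  have idE: "E + idm d = idm ?n" by (rule cmat_eqI) (auto simp: E_def ent_dg)
  let ?U = "W * (V + E)"
  have "fits ?n V" using unitary_dim[OF V] by (rule fits_mono) simp
  then have uVE: "unitary ?n (V + E)"
    using unitary_simps[OF V] by (simp add: unitary_def dims algebra_simps CE VE idE)
  have "(V + E) * dg ?n l' * adj (V + E) = N' + T"
    by (simp add: dgl' l algebra_simps dgE VE VT CE)
  then have VN: "(V + E) * dg ?n l' * adj (V + E) = N"
    by (simp only: N'_def diff_add_cancel)
  have "?U * dg ?n l' * adj ?U = W * ((V + E) * dg ?n l' * adj (V + E)) * W"
    by (simp only: adj_mult W(2) mult.assoc)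
  also have "\<dots> = W * N * W" by (simp only: VN)
  also have "\<dots> = M" using dM WW by (simp add: N_def mult.assoc WWX)
  finally show ?case using unitary_mult[OF W(1) uVE] by metis
qed

section \<open>Real spectra and functional calculus\<close>

definition sp :: "nat \<Rightarrow> cmat \<Rightarrow> (nat \<Rightarrow> real) \<Rightarrow> cmat" where
  "sp d U l = U * dg d (\<lambda>i. complex_of_real (l i)) * adj U"

lemma fits_sp [intro]: "unitary d U \<Longrightarrow> fits d (sp d U l)"
  by (auto simp: sp_def unitary_def)

lemma adj_sp [simp]: "adj (sp d U l) = sp d U l"
  by (simp add: sp_def adj_dg mult.assoc)

lemma sp_mult: "unitary d U \<Longrightarrow> sp d U l * sp d U m = sp d U (\<lambda>i. l i * m i)"
  by (simp add: sp_def mult.assoc unitary_simps) (simp add: dg_mult_dg flip: mult.assoc)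

lemma sp_plus: "sp d U l + sp d U m = sp d U (\<lambda>i. l i + m i)"
proof -
  have "dg d (\<lambda>i. complex_of_real (l i)) + dg d (\<lambda>i. complex_of_real (m i))
      = dg d (\<lambda>i. complex_of_real (l i + m i))"
    by (rule cmat_eqI) (simp add: ent_dg)
  then show ?thesis by (metis sp_def distrib_left distrib_right)
qed

lemma sp_scaleR: "c *\<^sub>R sp d U l = sp d U (\<lambda>i. c * l i)"
proof -
  have "c *\<^sub>R dg d (\<lambda>i. complex_of_real (l i)) = dg d (\<lambda>i. complex_of_real (c * l i))"
    by (rule cmat_eqI) (simp add: ent_dg)
  then show ?thesis by (metis sp_def mult_scaleR_left mult_scaleR_right)
qed

lemma sp_minus: "sp d U l - sp d U m = sp d U (\<lambda>i. l i - m i)"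
  using sp_plus[of d U l "\<lambda>i. - m i"] sp_scaleR[of "-1" d U m]
  by (simp only: diff_conv_add_uminus scaleR_minus1_left mult_minus1)

lemma sp_cong: "(\<And>i. i < d \<Longrightarrow> l i = m i) \<Longrightarrow> sp d U l = sp d U m"
  unfolding sp_def by (simp cong: dg_cong)

lemma sp_1: "unitary d U \<Longrightarrow> sp d U (\<lambda>_. 1) = idm d"
  by (simp add: sp_def unitary_simps)

lemma sp_0: "sp d U (\<lambda>_. 0) = 0"
proof -
  have "dg d (\<lambda>_. 0) = 0" by (rule cmat_eqI) (simp add: ent_dg)
  then show ?thesis by (simp add: sp_def)
qed

lemma sp_sum: "(\<Sum>x\<in>S. sp d U (f x)) = sp d U (\<lambda>i. \<Sum>x\<in>S. f x i)"
proof (induction S rule: infinite_finite_induct)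
  case (insert x F)
  then show ?case by (simp add: sp_plus)
qed (simp_all add: sp_0)

lemma tr_sp: "unitary d U \<Longrightarrow> tr (sp d U l) = complex_of_real (\<Sum>i<d. l i)"
  unfolding sp_def by (subst tr_mult_commute) (simp add: unitary_simps tr_dg flip: mult.assoc)

lemma unitary_conj_sp: "unitary d U \<Longrightarrow> adj U * sp d U l * U = dg d (\<lambda>i. complex_of_real (l i))"
  by (simp add: sp_def mult.assoc unitary_simps)

lemma ent_uni_conj_sp: "unitary d U \<Longrightarrow> i < d \<Longrightarrow> ent (adj U * sp d U l * U) i i = complex_of_real (l i)"
  by (simp add: unitary_conj_sp ent_dg)

text \<open>Commuting hermitian \<open>A\<close> and \<open>B\<close> are diagonalised simultaneously because \<open>A + \<i> B\<close> is normal.\<close>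

lemma spectral_pair:
  assumes "fits d A" "adj A = A" "fits d B" "adj B = B" "A * B = B * A"
  obtains U l m where "unitary d U" "A = sp d U l" "B = sp d U m"
proof -
  \<comment> \<open>The imaginary unit, as a matrix: the type carries only real scalar
    multiplication.\<close>
  define J where "J = dg d (\<lambda>_. \<i>)"
  define M where "M = A + J * B"
  have J: "J * J = - idm d" "adj J = - J"
    by (auto simp: J_def dg_mult_dg adj_dg ent_dg intro!: cmat_eqI)
  have JA: "J * A = A * J" "J * B = B * J" using assms by (auto simp: J_def dg_const_commute)
  have adjM: "adj M = A - J * B" using assms JA by (simp add: M_def J)
  have dM: "fits d M" using assms by (auto simp: M_def J_def)
  have "A * (J * B) = J * B * A" using assms JA by (metis mult.assoc)
  then have "M * adj M = adj M * M"
    unfolding adjM unfolding M_def by (simp add: algebra_simps)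
  then obtain U z where U: "unitary d U" and z: "M = U * dg d z * adj U"
    using spectral_normal[OF dM] by blast
  have "adj M = U * dg d (\<lambda>i. cnj (z i)) * adj U"
    by (simp add: z adj_dg mult.assoc)
  then have s: "(1/2) *\<^sub>R (M + adj M) = (1/2) *\<^sub>R (U * (dg d z + dg d (\<lambda>i. cnj (z i))) * adj U)"
    by (simp add: z algebra_simps)
  have JU: "J * U = U * J" using unitary_dim[OF U] by (simp add: J_def dg_const_commute)
  have "J * (adj M - M) = J * U * (dg d (\<lambda>i. cnj (z i)) - dg d z) * adj U"
    by (simp add: z adj_dg mult.assoc left_diff_distrib right_diff_distrib)
  then have t: "(1/2) *\<^sub>R (J * (adj M - M)) = (1/2) *\<^sub>R (U * (J * (dg d (\<lambda>i. cnj (z i)) - dg d z)) * adj U)"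
    by (simp only: JU mult.assoc)
  have "(1/2) *\<^sub>R (M + adj M) = A" unfolding adjM unfolding M_def by (simp flip: scaleR_2)
  moreover have "(1/2) *\<^sub>R (dg d z + dg d (\<lambda>i. cnj (z i))) = dg d (\<lambda>i. complex_of_real (Re (z i)))"
    by (rule cmat_eqI) (auto simp: ent_dg complex_eq_iff)
  ultimately have "A = sp d U (\<lambda>i. Re (z i))"
    using s by (metis sp_def mult_scaleR_left mult_scaleR_right)
  moreover have B: "(1/2) *\<^sub>R (J * (adj M - M)) = B"
  proof -
    have "J * (adj M - M) = - (2 *\<^sub>R (J * (J * B)))"
      unfolding adjM unfolding M_def by (simp add: algebra_simps scaleR_2)
    also have "J * (J * B) = - B" using J assms by (simp flip: mult.assoc)
    finally show ?thesis by simp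
  qed
  have "(1/2) *\<^sub>R (J * (dg d (\<lambda>i. cnj (z i)) - dg d z)) = dg d (\<lambda>i. complex_of_real (Im (z i)))"
    by (rule cmat_eqI) (auto simp: ent_dg complex_eq_iff J_def ent_dg_mult)
  then have "B = sp d U (\<lambda>i. Im (z i))"
    using t B by (metis sp_def mult_scaleR_left mult_scaleR_right)
  ultimately show thesis using that U by blast
qed

lemma spectral_herm:
  assumes "fits d A" "adj A = A"
  obtains U l where "unitary d U" "A = sp d U l"
  using spectral_pair[OF assms assms refl] by blast

lemma psd_sp: "(\<And>i. i < d \<Longrightarrow> 0 \<le> l i) \<Longrightarrow> psd_op (sp d U l)"
proof -
  assume l: "\<And>i. i < d \<Longrightarrow> 0 \<le> l i"
  let ?K = "dg d (\<lambda>i. complex_of_real (sqrt (l i))) * adj U"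
  have "sp d U l = adj ?K * ?K"
    using l by (simp add: sp_def mult.assoc adj_dg)
      (auto simp: dg_mult_dg simp flip: mult.assoc of_real_mult intro!: arg_cong2[where f="(*)"] dg_cong)
  then show ?thesis by (simp only: psdI_gram)
qed

lemma psd_sp_iff: "unitary d U \<Longrightarrow> psd_op (sp d U l) \<longleftrightarrow> (\<forall>i<d. 0 \<le> l i)"
proof
  assume U: "unitary d U" and p: "psd_op (sp d U l)"
  show "\<forall>i<d. 0 \<le> l i"
    using p ent_uni_conj_sp[OF U] unfolding psd_op_def by (metis Re_complex_of_real)
qed (simp add: psd_sp)

lemma spectral_psd:
  assumes "fits d A" "psd_op A"
  obtains U l where "unitary d U" "A = sp d U l" "\<And>i. 0 \<le> l i"
proof -
  obtain U l where U: "unitary d U" "A = sp d U l"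
    using spectral_herm assms psd_adj by metis
  then have "\<forall>i<d. 0 \<le> l i" using assms psd_sp_iff by blast
  then have "sp d U l = sp d U (\<lambda>i. max 0 (l i))" by (intro sp_cong) auto
  with U that[of U "\<lambda>i. max 0 (l i)"] show thesis by simp
qed

text \<open>The change of basis \<open>W\<close> vanishes between indices with different
  eigenvalues, so it also intertwines any function of them. This makes functions of a hermitian
  matrix independent of the chosen decomposition.\<close>

lemma sp_fun_cong:
  assumes U: "unitary d U" and V: "unitary d V" and eq: "sp d U l = sp d V m"
  shows "sp d U (\<lambda>i. f (l i)) = sp d V (\<lambda>i. f (m i))"
proof -
  let ?c = complex_of_real
  define W where "W = adj V * U"
  have inter: "W * dg d (\<lambda>i. ?c (l i)) = dg d (\<lambda>i. ?c (m i)) * W"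
  proof -
    have "W * dg d (\<lambda>i. ?c (l i)) = adj V * (U * dg d (\<lambda>i. ?c (l i)) * adj U) * U"
      using unitary_simps[OF U] by (simp add: W_def mult.assoc)
    also have "\<dots> = adj V * (V * dg d (\<lambda>i. ?c (m i)) * adj V) * U"
      using eq by (simp only: sp_def)
    also have "\<dots> = dg d (\<lambda>i. ?c (m i)) * W"
      using unitary_simps[OF V] unitary_dim[OF U] by (simp add: W_def mult.assoc)
    finally show ?thesis .
  qed
  have "W * dg d (\<lambda>i. ?c (f (l i))) = dg d (\<lambda>i. ?c (f (m i))) * W"
  proof (rule cmat_eqI)
    fix i j
    show "ent (W * dg d (\<lambda>i. ?c (f (l i)))) i j = ent (dg d (\<lambda>i. ?c (f (m i))) * W) i j"
    proof (cases "i < d \<and> j < d")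
      case True
      then have "ent W i j * ?c (l j) = ?c (m i) * ent W i j"
        using arg_cong[OF inter, of "\<lambda>A. ent A i j"] by (simp add: ent_mult_dg ent_dg_mult)
      then have "ent W i j = 0 \<or> l j = m i" by auto
      then show ?thesis using True by (auto simp: ent_mult_dg ent_dg_mult)
    next
      case False
      have "fits d W" using U V by (auto simp: W_def unitary_def)
      with False show ?thesis by (auto simp: ent_mult_dg ent_dg_mult fits_def)
    qed
  qed
  then have "V * (W * dg d (\<lambda>i. ?c (f (l i)))) * adj U = V * (dg d (\<lambda>i. ?c (f (m i))) * W) * adj U"
    by (rule arg_cong)
  then have "(V * adj V) * sp d U (\<lambda>i. f (l i)) = sp d V (\<lambda>i. f (m i)) * (U * adj U)"
    unfolding sp_def W_def by (simp only: mult.assoc)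
  then show ?thesis
    using fits_sp[OF U] fits_sp[OF V] unitary_simps(3)[OF U] unitary_simps(3)[OF V] by simp
qed

text \<open>Only meaningful for hermitian \<open>M\<close> with \<open>fits d M\<close>; as \<open>0 powr p = 0\<close>, the power is taken on the
  support, and \<open>pw d M 0\<close> is the projection onto the support.\<close>

definition pw :: "nat \<Rightarrow> cmat \<Rightarrow> real \<Rightarrow> cmat" where
  "pw d M p = (THE X. \<exists>U l. unitary d U \<and> M = sp d U l \<and> X = sp d U (\<lambda>i. l i powr p))"

lemma pw_sp:
  assumes U: "unitary d U"
  shows "pw d (sp d U l) p = sp d U (\<lambda>i. l i powr p)"
  unfolding pw_def
proof (rule the_equality)
  show "\<exists>V m. unitary d V \<and> sp d U l = sp d V m \<and> sp d U (\<lambda>i. l i powr p) = sp d V (\<lambda>i. m i powr p)"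
    using U by blast
  fix X assume "\<exists>V m. unitary d V \<and> sp d U l = sp d V m \<and> X = sp d V (\<lambda>i. m i powr p)"
  then obtain V m where V: "unitary d V" "sp d U l = sp d V m" "X = sp d V (\<lambda>i. m i powr p)" by blast
  show "X = sp d U (\<lambda>i. l i powr p)"
    unfolding V(3) by (rule sp_fun_cong[OF V(1) U V(2)[symmetric]])
qed

section \<open>Trace inequalities\<close>

text \<open>Jensen's inequality. Total weight below 1 is admissible because the missing weight can
  be placed at 0, where the power vanishes; contractions lead to such weights.\<close>

lemma powr_sum_le_sum_powr:
  fixes w x :: "'a \<Rightarrow> real"
  assumes "1 \<le> p" and w: "\<And>i. i \<in> I \<Longrightarrow> 0 \<le> w i" "sum w I \<le> 1" and x: "\<And>i. i \<in> I \<Longrightarrow> 0 \<le> x i"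
  shows "(\<Sum>i\<in>I. w i * x i) powr p \<le> (\<Sum>i\<in>I. w i * x i powr p)"
proof (cases "p = 1")
  case True
  have "0 \<le> (\<Sum>i\<in>I. w i * x i)" using w x by (intro sum_nonneg mult_nonneg_nonneg) auto
  moreover have "(\<Sum>i\<in>I. w i * x i powr p) = (\<Sum>i\<in>I. w i * x i)"
    using True x by (intro sum.cong) auto
  ultimately show ?thesis using True by simp
next
  case False
  then have p: "1 < p" using assms by simp
  define m where "m = (\<Sum>i\<in>I. w i * x i)"
  define W where "W = sum w I"
  have m: "0 \<le> m" unfolding m_def using w x by (intro sum_nonneg mult_nonneg_nonneg) auto
  show ?thesis
  proof (cases "m = 0")
    case True
    then show ?thesis using w x by (simp add: m_def[symmetric] sum_nonneg)
  next
    case False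
    then have m: "0 < m" using m by simp
    \<comment> \<open>Young's inequality for x_i and m^(p-1), with exponents p and p/(p-1), says
      that the tangent at \<open>m\<close> lies below the graph of the p-th power.\<close>
    have tangent: "m powr p + p * m powr (p - 1) * (x i - m) \<le> x i powr p" if "i \<in> I" for i
    proof -
      have "x i * m powr (p - 1) \<le> x i powr p / p + (m powr (p - 1)) powr (p / (p - 1)) / (p / (p - 1))"
        using p x[OF that] by (intro Youngs_inequality) (auto simp: field_simps)
      also have "(m powr (p - 1)) powr (p / (p - 1)) = m powr p" using p by (simp add: powr_powr)
      finally have "p * (x i * m powr (p - 1)) \<le> p * (x i powr p / p + m powr p / (p / (p - 1)))"
        using p by (intro mult_left_mono) auto
      also have "\<dots> = x i powr p + (p - 1) * m powr p" using p by (simp add: field_simps)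
      finally have "p * (x i * m powr (p - 1)) \<le> x i powr p + (p - 1) * m powr p" .
      moreover have "m powr p = m powr (p - 1) * m" using m by (simp flip: powr_mult_base add: powr_diff)
      ultimately show ?thesis by (simp add: algebra_simps)
    qed
    \<comment> \<open>The weighted tangents add up to \<open>m powr p * (W + p * (1 - W))\<close>,
      and the bracket is at least 1 because p \<ge> 1 and W \<le> 1.\<close>
    have "m powr p \<le> m powr p * (W + p * (1 - W))"
    proof -
      have "1 \<le> W + p * (1 - W)"
        using p w(2) mult_right_mono[of 1 p "1 - W"] by (simp add: W_def)
      then show ?thesis using mult_left_mono[of 1 _ "m powr p"] by simp
    qed
    also have "\<dots> = m powr p * W + p * m powr (p - 1) * (m - m * W)"
    proof -
      have "m powr p = m powr (p - 1) * m" using m by (simp flip: powr_mult_base add: powr_diff)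
      then show ?thesis by (simp add: algebra_simps)
    qed
    also have "\<dots> = (\<Sum>i\<in>I. w i * (m powr p + p * m powr (p - 1) * (x i - m)))"
    proof -
      have lin: "(\<Sum>i\<in>I. w i * (c + e * (x i - m))) = c * W + e * (m - m * W)" for c e
      proof -
        have "(\<Sum>i\<in>I. w i * (c + e * (x i - m))) = (\<Sum>i\<in>I. c * w i + e * (w i * x i) - (e * m) * w i)"
          by (intro sum.cong) (auto simp: algebra_simps)
        also have "\<dots> = c * W + e * m - e * m * W"
          by (simp only: sum.distrib sum_subtractf sum_distrib_left[symmetric] m_def W_def)
        finally show ?thesis by (simp add: algebra_simps)
      qed
      show ?thesis by (simp only: lin)
    qed
    also have "\<dots> \<le> (\<Sum>i\<in>I. w i * x i powr p)"
      using tangent w by (intro sum_mono mult_left_mono) auto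
    finally show ?thesis by (simp add: m_def)
  qed
qed

text \<open>The convex case with exponent 1/p, applied to the numbers x_i^p.\<close>

lemma sum_powr_le_powr_sum:
  fixes w x :: "'a \<Rightarrow> real"
  assumes "0 < p" "p \<le> 1" and w: "\<And>i. i \<in> I \<Longrightarrow> 0 \<le> w i" "sum w I \<le> 1"
    and x: "\<And>i. i \<in> I \<Longrightarrow> 0 \<le> x i"
  shows "(\<Sum>i\<in>I. w i * x i powr p) \<le> (\<Sum>i\<in>I. w i * x i) powr p"
proof -
  have nn: "0 \<le> (\<Sum>i\<in>I. w i * x i powr p)" using w by (intro sum_nonneg) auto
  have "(\<Sum>i\<in>I. w i * x i powr p) powr (1 / p) \<le> (\<Sum>i\<in>I. w i * (x i powr p) powr (1 / p))"
    using assms by (intro powr_sum_le_sum_powr) auto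
  also have "\<dots> = (\<Sum>i\<in>I. w i * x i)"
    using assms by (intro sum.cong) (auto simp: powr_powr)
  finally have "((\<Sum>i\<in>I. w i * x i powr p) powr (1 / p)) powr p \<le> (\<Sum>i\<in>I. w i * x i) powr p"
    using assms by (intro powr_mono2) auto
  then show ?thesis using assms nn by (simp add: powr_powr)
qed

text \<open>After normalising both sums to 1, the weighted inequality between geometric and
  arithmetic mean is applied to each term.\<close>

lemma Holder_powr_sum:
  fixes x y :: "'a \<Rightarrow> real"
  assumes t: "0 < t" "t < 1" and x: "\<And>i. i \<in> I \<Longrightarrow> 0 \<le> x i" and y: "\<And>i. i \<in> I \<Longrightarrow> 0 \<le> y i"
  shows "(\<Sum>i\<in>I. x i powr t * y i powr (1 - t)) \<le> (sum x I) powr t * (sum y I) powr (1 - t)"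
proof (cases "finite I \<and> sum x I \<noteq> 0 \<and> sum y I \<noteq> 0")
  case False
  then have "infinite I \<or> (\<forall>i\<in>I. x i = 0) \<or> (\<forall>i\<in>I. y i = 0)"
    using sum_nonneg_eq_0_iff[of I x] sum_nonneg_eq_0_iff[of I y] x y by blast
  then have "(\<Sum>i\<in>I. x i powr t * y i powr (1 - t)) = 0"
    by (elim disjE) simp_all
  then show ?thesis by simp
next
  case True
  define X Y where "X = sum x I" and "Y = sum y I"
  have XY: "0 < X" "0 < Y"
    using True x y by (auto simp: X_def Y_def less_le intro: sum_nonneg)
  have "x i powr t * y i powr (1 - t) \<le> X powr t * Y powr (1 - t) * (t * (x i / X) + (1 - t) * (y i / Y))"
    if i: "i \<in> I" for i
  proof (cases "x i = 0 \<or> y i = 0")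
    case True
    have "0 \<le> t * (x i / X) + (1 - t) * (y i / Y)"
      using XY t x[OF i] y[OF i] by (intro add_nonneg_nonneg mult_nonneg_nonneg) auto
    then have "0 \<le> X powr t * Y powr (1 - t) * (t * (x i / X) + (1 - t) * (y i / Y))"
      by (intro mult_nonneg_nonneg) auto
    moreover have "x i powr t * y i powr (1 - t) = 0" using True by auto
    ultimately show ?thesis by linarith
  next
    case False
    then have "(x i / X) powr t * (y i / Y) powr (1 - t) \<le> t * (x i / X) + (1 - t) * (y i / Y)"
      using XY t x[OF i] y[OF i] by (intro Youngs_inequality_0) auto
    then have "X powr t * Y powr (1 - t) * ((x i / X) powr t * (y i / Y) powr (1 - t))
       \<le> X powr t * Y powr (1 - t) * (t * (x i / X) + (1 - t) * (y i / Y))"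
      by (intro mult_left_mono) auto
    moreover have "X powr t * Y powr (1 - t) * ((x i / X) powr t * (y i / Y) powr (1 - t))
        = x i powr t * y i powr (1 - t)"
      using XY x[OF i] y[OF i] by (simp add: powr_divide)
    ultimately show ?thesis by simp
  qed
  then have "(\<Sum>i\<in>I. x i powr t * y i powr (1 - t))
      \<le> (\<Sum>i\<in>I. X powr t * Y powr (1 - t) * (t * (x i / X) + (1 - t) * (y i / Y)))"
    by (rule sum_mono)
  also have "\<dots> = X powr t * Y powr (1 - t) * (t * (sum x I / X) + (1 - t) * (sum y I / Y))"
    by (simp add: sum.distrib flip: sum_distrib_left sum_divide_distrib)
  also have "\<dots> = X powr t * Y powr (1 - t)"
    using XY by (simp flip: X_def Y_def)
  finally show ?thesis by (simp add: X_def Y_def)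
qed

section \<open>Overlaps of bases and quadratic forms\<close>

definition wt :: "cmat \<Rightarrow> cmat \<Rightarrow> nat \<Rightarrow> nat \<Rightarrow> real" where
  "wt U X i j = (cmod (ent (adj U * X) i j))\<^sup>2"

definition qf :: "cmat \<Rightarrow> cmat \<Rightarrow> nat \<Rightarrow> real" where
  "qf M X j = Re (ent (adj X * M * X) j j)"

lemma wt_nonneg [simp]: "0 \<le> wt U X i j"
  by (simp add: wt_def)

lemma wt_commute: "wt U V i j = wt V U j i"
proof -
  have "ent (adj V * U) j i = cnj (ent (adj U * V) i j)"
    by (simp flip: ent_adj)
  then show ?thesis by (simp add: wt_def)
qed

text \<open>A quadratic form is a weighted sum of eigenvalues, the weights being squared overlaps.
  Through this formula the operator inequalities below reduce to scalar ones.\<close>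

lemma qf_sp: "unitary d U \<Longrightarrow> qf (sp d U l) X j = (\<Sum>i<d. wt U X i j * l i)"
proof -
  assume U: "unitary d U"
  define W where "W = adj U * X"
  have "adj X * sp d U l * X = adj W * (dg d (\<lambda>i. complex_of_real (l i)) * W)"
    by (simp add: W_def sp_def mult.assoc)
  also have "ent \<dots> j j = (\<Sum>k<d. ent (adj W) j k * ent (dg d (\<lambda>i. complex_of_real (l i)) * W) k j)"
    by (rule ent_mult_aux) (simp add: ent_dg_mult)
  also have "\<dots> = (\<Sum>k<d. complex_of_real (wt U X k j * l k))"
    by (intro sum.cong)
      (auto simp: ent_dg_mult wt_def W_def[symmetric] complex_norm_square simp flip: of_real_power)
  finally show ?thesis by (simp add: qf_def)
qed

lemma qf_nonneg: "psd_op M \<Longrightarrow> 0 \<le> qf M X j"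
  by (simp add: qf_def psd_op_def)

lemma qf_plus: "qf (A + B) X j = qf A X j + qf B X j"
  and qf_minus: "qf (A - B) X j = qf A X j - qf B X j"
  and qf_scaleR: "qf (c *\<^sub>R A) X j = c * qf A X j"
  by (simp_all add: qf_def algebra_simps)

lemma qf_mono: "psd_op (B - A) \<Longrightarrow> qf A X j \<le> qf B X j"
  using qf_nonneg[of "B - A" X j] by (simp add: qf_minus)

lemma qf_mult: "qf M (K * X) j = qf (adj K * M * K) X j"
  by (simp add: qf_def mult.assoc)

lemma wt_col_sum: "unitary d U \<Longrightarrow> fits d X \<Longrightarrow> (\<Sum>i<d. wt U X i j) = Re (ent (adj X * X) j j)"
  using qf_sp[of d U "\<lambda>_. 1" X j] by (simp add: sp_1 qf_def mult.assoc)

text \<open>With \<open>wt_uni_row\<close>: the squared overlaps of two orthonormal bases form a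
  doubly stochastic matrix.\<close>

lemma wt_uni_col: "unitary d U \<Longrightarrow> unitary d V \<Longrightarrow> j < d \<Longrightarrow> (\<Sum>i<d. wt U V i j) = 1"
  by (simp add: wt_col_sum unitary_dim) (simp add: unitary_def ent_dg)

lemma wt_uni_row: "unitary d U \<Longrightarrow> unitary d V \<Longrightarrow> i < d \<Longrightarrow> (\<Sum>j<d. wt U V i j) = 1"
  using wt_uni_col[of d V U i] by (simp add: wt_commute)

lemma tr_qf: "unitary d V \<Longrightarrow> fits d M \<Longrightarrow> Re (tr M) = (\<Sum>j<d. qf M V j)"
proof -
  assume V: "unitary d V" and M: "fits d M"
  have "tr M = tr (M * (V * adj V))" using V M by (simp add: unitary_def)
  also have "\<dots> = tr (adj V * M * V)" by (metis tr_mult_commute mult.assoc)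
  also have "\<dots> = (\<Sum>j<d. ent (adj V * M * V) j j)" using V M by (intro tr_eq) (simp add: unitary_def)
  finally show ?thesis by (simp add: qf_def)
qed

lemma tr_sp_mult: "unitary d U \<Longrightarrow> fits d Y \<Longrightarrow> Re (tr (sp d U x * Y)) = (\<Sum>i<d. x i * qf Y U i)"
proof -
  assume U: "unitary d U" and Y: "fits d Y"
  have "tr (sp d U x * Y) = tr (dg d (\<lambda>i. complex_of_real (x i)) * (adj U * Y * U))"
    unfolding sp_def by (metis tr_mult_commute mult.assoc)
  also have "\<dots> = (\<Sum>i<d. complex_of_real (x i) * ent (adj U * Y * U) i i)"
    using U Y by (subst tr_eq[of d]) (auto simp: unitary_def ent_dg_mult)
  finally show ?thesis by (simp add: qf_def)
qed

section \<open>Traces of powers\<close>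

definition trp :: "nat \<Rightarrow> cmat \<Rightarrow> real \<Rightarrow> real" where
  "trp d M p = Re (tr (pw d M p))"

lemma trp_sp: "unitary d U \<Longrightarrow> trp d (sp d U l) p = (\<Sum>i<d. l i powr p)"
  by (simp add: trp_def pw_sp tr_sp)

lemma trp_nonneg: "fits d M \<Longrightarrow> adj M = M \<Longrightarrow> 0 \<le> trp d M p"
  by (metis spectral_herm trp_sp sum_nonneg powr_ge_zero)

lemma qf_own: "unitary d U \<Longrightarrow> i < d \<Longrightarrow> qf (sp d U l) U i = l i"
  by (simp add: qf_def ent_uni_conj_sp)

lemma fits_pw [intro]: "fits d M \<Longrightarrow> adj M = M \<Longrightarrow> fits d (pw d M p)"
  by (metis spectral_herm pw_sp fits_sp)

lemma psd_pw: "fits d M \<Longrightarrow> adj M = M \<Longrightarrow> psd_op (pw d M p)"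
  by (metis spectral_herm pw_sp psd_sp powr_ge_zero)

lemma adj_pw: "fits d M \<Longrightarrow> adj M = M \<Longrightarrow> adj (pw d M p) = pw d M p"
  by (simp add: psd_adj psd_pw)

lemma pw_mult: "fits d M \<Longrightarrow> adj M = M \<Longrightarrow> pw d M p * pw d M q = pw d M (p + q)"
proof -
  assume "fits d M" "adj M = M"
  then obtain U l where "unitary d U" "M = sp d U l" using spectral_herm by blast
  then show ?thesis by (simp add: pw_sp sp_mult powr_add)
qed

lemma pw_one: "fits d M \<Longrightarrow> psd_op M \<Longrightarrow> pw d M 1 = M"
proof -
  assume "fits d M" "psd_op M"
  then obtain U l where "unitary d U" "M = sp d U l" "\<And>i. 0 \<le> l i" using spectral_psd by blast
  then show ?thesis by (simp add: pw_sp)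
qed

lemma trp_scaleR: "fits d M \<Longrightarrow> psd_op M \<Longrightarrow> 0 \<le> c \<Longrightarrow> trp d (c *\<^sub>R M) p = c powr p * trp d M p"
proof -
  assume "fits d M" "psd_op M" "0 \<le> c"
  then obtain U l where "unitary d U" "M = sp d U l" "\<And>i. 0 \<le> l i" using spectral_psd by blast
  then show ?thesis using \<open>0 \<le> c\<close> by (simp add: sp_scaleR trp_sp powr_mult sum_distrib_left)
qed

text \<open>The diagonal of \<open>M\<close> in the basis \<open>V\<close> arises from its spectrum
  by a doubly stochastic matrix, so Jensen's inequality applies to each entry.\<close>

lemma Peierls_convex:
  assumes "fits d M" "psd_op M" "unitary d V" "1 \<le> p"
  shows "(\<Sum>j<d. qf M V j powr p) \<le> trp d M p"
proof -
  obtain U l where U: "unitary d U" "M = sp d U l" "\<And>i. 0 \<le> l i" using spectral_psd assms by blast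
  have "(\<Sum>j<d. qf M V j powr p) \<le> (\<Sum>j<d. \<Sum>i<d. wt U V i j * l i powr p)"
    unfolding U(2) qf_sp[OF U(1)]
    using assms U by (intro sum_mono powr_sum_le_sum_powr) (auto simp: wt_uni_col)
  also have "\<dots> = (\<Sum>i<d. (\<Sum>j<d. wt U V i j) * l i powr p)"
    by (subst sum.swap) (simp add: sum_distrib_right)
  also have "\<dots> = trp d M p" using assms U by (simp add: wt_uni_row trp_sp)
  finally show ?thesis .
qed

lemma Peierls_concave:
  assumes "fits d M" "psd_op M" "unitary d V" "0 < p" "p \<le> 1"
  shows "trp d M p \<le> (\<Sum>j<d. qf M V j powr p)"
proof -
  obtain U l where U: "unitary d U" "M = sp d U l" "\<And>i. 0 \<le> l i" using spectral_psd assms by blast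
  have "trp d M p = (\<Sum>i<d. (\<Sum>j<d. wt U V i j) * l i powr p)" using assms U by (simp add: wt_uni_row trp_sp)
  also have "\<dots> = (\<Sum>j<d. \<Sum>i<d. wt U V i j * l i powr p)"
    by (simp only: sum_distrib_right) (rule sum.swap)
  also have "\<dots> \<le> (\<Sum>j<d. qf M V j powr p)"
    unfolding U(2) qf_sp[OF U(1)]
    using assms U by (intro sum_mono sum_powr_le_powr_sum) (auto simp: wt_uni_col)
  finally show ?thesis .
qed

lemma psd_trans_le: "psd_op A \<Longrightarrow> psd_op (B - A) \<Longrightarrow> psd_op B"
  using psd_plus[of A "B - A"] by simp

text \<open>The basis is chosen so that Peierls' inequality points the right way: the eigenbasis of
  the smaller matrix for p \<ge> 1, that of the larger one for p < 1. Thus no operator monotonicity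
  enters, and every p > 0 is covered.\<close>

lemma trp_mono:
  assumes "fits d M" "fits d N" "psd_op M" "psd_op (N - M)" "0 < p"
  shows "trp d M p \<le> trp d N p"
proof -
  have N: "psd_op N" using assms psd_trans_le by blast
  show ?thesis
  proof (cases "1 \<le> p")
    case True
    obtain U l where U: "unitary d U" "M = sp d U l" "\<And>i. 0 \<le> l i" using spectral_psd assms by blast
    have "trp d M p = (\<Sum>i<d. qf M U i powr p)" using U by (simp add: trp_sp qf_own)
    also have "\<dots> \<le> (\<Sum>i<d. qf N U i powr p)"
      using assms by (intro sum_mono powr_mono2 qf_mono qf_nonneg) auto
    also have "\<dots> \<le> trp d N p" using Peierls_convex assms N U True by blast
    finally show ?thesis .
  next
    case False
    obtain U l where U: "unitary d U" "N = sp d U l" "\<And>i. 0 \<le> l i" using spectral_psd assms N by blast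
    have "trp d M p \<le> (\<Sum>i<d. qf M U i powr p)" using Peierls_concave assms U False by simp
    also have "\<dots> \<le> (\<Sum>i<d. qf N U i powr p)"
      using assms by (intro sum_mono powr_mono2 qf_mono qf_nonneg) auto
    also have "\<dots> = trp d N p" using U by (simp add: trp_sp qf_own)
    finally show ?thesis .
  qed
qed

text \<open>Both traces equal one double sum: the squared entries of \<open>C\<close> add up to
  \<open>l j\<close> along columns and to \<open>m i\<close> along rows, and the remaining powers
  agree wherever an entry is nonzero.\<close>

lemma trp_gram_commute:
  assumes K: "fits d K"
  shows "trp d (adj K * K) p = trp d (K * adj K) p"
proof -
  obtain U l where U: "unitary d U" "adj K * K = sp d U l" "\<And>i. 0 \<le> l i"
    using spectral_psd[of d "adj K * K"] K psdI_gram by (metis fits_adj fits_mult)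
  obtain V m where V: "unitary d V" "K * adj K = sp d V m" "\<And>i. 0 \<le> m i"
    using spectral_psd[of d "K * adj K"] K psdI_gram[of "adj K"] by (metis adj_adj fits_adj fits_mult)
  \<comment> \<open>\<open>C\<close> intertwines the two spectra: \<open>C i j \<noteq> 0\<close> only if \<open>l j = m i\<close>.\<close>
  define C where "C = adj V * K * U"
  have C: "fits d C" using K U V by (simp add: C_def unitary_dim)
  have CC: "adj C * C = dg d (\<lambda>i. complex_of_real (l i))"
  proof -
    have "adj C * C = adj U * (adj K * K) * U" using K unitary_dim[OF U(1)] by (simp add: C_def mult.assoc unitary_simps[OF V(1)])
    then show ?thesis using U by (simp only: unitary_conj_sp)
  qed
  have CC': "C * adj C = dg d (\<lambda>i. complex_of_real (m i))"
  proof -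
    have "C * adj C = adj V * (K * adj K) * V" using K unitary_dim[OF V(1)] by (simp add: C_def mult.assoc unitary_simps[OF U(1)])
    then show ?thesis using V by (simp only: unitary_conj_sp)
  qed
  have "C * dg d (\<lambda>i. complex_of_real (l i)) = dg d (\<lambda>i. complex_of_real (m i)) * C"
    unfolding CC[symmetric] CC'[symmetric] by (simp add: mult.assoc)
  then have inter: "ent C i j * l j = m i * ent C i j" if "i < d" "j < d" for i j
    using that by (metis ent_dg_mult ent_mult_dg)
  have l: "(\<Sum>i<d. (cmod (ent C i j))\<^sup>2) = l j" if "j < d" for j
    using arg_cong[OF CC, of "\<lambda>A. ent A j j"] that
    by (simp only: ent_gram_diag[OF C] of_real_eq_iff ent_dg if_True simp_thms)
  have "fits d (adj C)" using C by simp
  from ent_gram_diag[OF this] have m: "(\<Sum>j<d. (cmod (ent C i j))\<^sup>2) = m i" if "i < d" for i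
    using arg_cong[OF CC', of "\<lambda>A. ent A i i"] that
    by (simp del: of_real_sum add: ent_dg of_real_eq_iff)
  have eq: "(cmod (ent C i j))\<^sup>2 * l j powr (p - 1) = (cmod (ent C i j))\<^sup>2 * m i powr (p - 1)" if "i < d" "j < d" for i j
    using inter[OF that] by auto
  \<comment> \<open>At 0 both sides vanish by the convention \<open>0 powr p = 0\<close>.\<close>
  have pw: "x powr p = x * x powr (p - 1)" if "0 \<le> x" for x :: real
    using that by (cases "x = 0") (auto simp: powr_diff)
  have "trp d (adj K * K) p = (\<Sum>j<d. l j * l j powr (p - 1))"
    by (simp only: U trp_sp pw)
  also have "\<dots> = (\<Sum>j<d. \<Sum>i<d. (cmod (ent C i j))\<^sup>2 * l j powr (p - 1))"
    by (simp add: l flip: sum_distrib_right)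
  also have "\<dots> = (\<Sum>j<d. \<Sum>i<d. (cmod (ent C i j))\<^sup>2 * m i powr (p - 1))"
    by (simp add: eq)
  also have "\<dots> = (\<Sum>i<d. m i * m i powr (p - 1))"
    by (subst sum.swap) (simp add: m flip: sum_distrib_right)
  also have "\<dots> = trp d (K * adj K) p"
    by (simp only: V trp_sp pw)
  finally show ?thesis .
qed

text \<open>In the eigenbasis of \<open>X\<close> this is the scalar inequality for the spectrum of
  \<open>X\<close> and the diagonal of \<open>Y\<close>; Peierls' inequality passes from that
  diagonal to the spectrum.\<close>

lemma Holder_tr:
  assumes "fits d X" "fits d Y" "psd_op X" "psd_op Y" "0 < t" "t < 1"
  shows "Re (tr (X * Y)) \<le> trp d X (1 / t) powr t * trp d Y (1 / (1 - t)) powr (1 - t)"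
proof -
  obtain U x where U: "unitary d U" "X = sp d U x" "\<And>i. 0 \<le> x i" using spectral_psd assms by blast
  have "Re (tr (X * Y)) = (\<Sum>i<d. x i * qf Y U i)" using U assms by (simp add: tr_sp_mult)
  also have "\<dots> = (\<Sum>i<d. (x i powr (1 / t)) powr t * (qf Y U i powr (1 / (1 - t))) powr (1 - t))"
    using U assms by (intro sum.cong) (auto simp: powr_powr qf_nonneg)
  also have "\<dots> \<le> (\<Sum>i<d. x i powr (1 / t)) powr t * (\<Sum>i<d. qf Y U i powr (1 / (1 - t))) powr (1 - t)"
    using assms by (intro Holder_powr_sum) auto
  also have "\<dots> \<le> trp d X (1 / t) powr t * trp d Y (1 / (1 - t)) powr (1 - t)"
    using U assms by (intro mult_mono powr_mono2 Peierls_convex) (auto simp: trp_sp intro!: sum_nonneg)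
  finally show ?thesis .
qed

text \<open>A form of Jensen's trace inequality: \<open>K\<close> is a contraction, so the columns
  of \<open>K * V\<close> have norm at most 1 and the overlaps with the eigenbasis of \<sigma> are
  weights of total at most 1.\<close>

lemma trp_compress:
  assumes "fits d \<sigma>" "psd_op \<sigma>" "fits d K" "psd_op (idm d - adj K * K)" "0 < s" "s \<le> 1"
  shows "trp d (adj K * pw d \<sigma> s * K) (1 / s) \<le> Re (tr (adj K * \<sigma> * K))"
proof -
  obtain U l where U: "unitary d U" "\<sigma> = sp d U l" "\<And>i. 0 \<le> l i" using spectral_psd assms by blast
  have "psd_op (adj K * pw d \<sigma> s * K)" "fits d (adj K * pw d \<sigma> s * K)"
    using assms psd_adj by (auto intro!: psd_sandwich psd_pw fits_mult fits_pw)
  then obtain V g where V: "unitary d V" "adj K * pw d \<sigma> s * K = sp d V g" "\<And>i. 0 \<le> g i"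
    using spectral_psd by blast
  have KV: "fits d (K * V)" using assms V by (simp add: unitary_dim)
  have le1: "(\<Sum>i<d. wt U (K * V) i j) \<le> 1" if "j < d" for j
  proof -
    have "(\<Sum>i<d. wt U (K * V) i j) = qf (adj K * K) V j"
      using U(1) KV by (simp add: wt_col_sum qf_def mult.assoc)
    also have "\<dots> \<le> qf (idm d) V j" using assms by (intro qf_mono)
    also have "\<dots> = 1" using V that by (simp add: qf_def mult.assoc unitary_simps) (simp add: unitary_def ent_dg)
    finally show ?thesis .
  qed
  have "trp d (adj K * pw d \<sigma> s * K) (1 / s) = (\<Sum>j<d. qf (adj K * pw d \<sigma> s * K) V j powr (1 / s))"
    unfolding V(2) by (simp add: V trp_sp qf_own)
  also have "\<dots> = (\<Sum>j<d. (\<Sum>i<d. wt U (K * V) i j * l i powr s) powr (1 / s))"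
    unfolding qf_mult[symmetric] by (simp add: U pw_sp qf_sp)
  also have "\<dots> \<le> (\<Sum>j<d. \<Sum>i<d. wt U (K * V) i j * (l i powr s) powr (1 / s))"
    using assms U le1 by (intro sum_mono powr_sum_le_sum_powr) auto
  also have "\<dots> = (\<Sum>j<d. qf (adj K * \<sigma> * K) V j)"
    unfolding qf_mult[symmetric] using assms by (simp add: U qf_sp powr_powr)
  also have "\<dots> = Re (tr (adj K * \<sigma> * K))"
    using assms V by (simp add: tr_qf)
  finally show ?thesis .
qed

definition proj :: "nat \<Rightarrow> cmat \<Rightarrow> bool" where
  "proj d P \<longleftrightarrow> fits d P \<and> adj P = P \<and> P * P = P"

lemma proj_psd_compl: "proj d P \<Longrightarrow> psd_op (idm d - adj P * P)"
proof -
  assume P: "proj d P"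
  then have "idm d - adj P * P = adj (idm d - P) * (idm d - P)"
    by (simp add: proj_def adj_dg left_diff_distrib right_diff_distrib dg_mult_dg)
  then show ?thesis by (simp only: psdI_gram)
qed

lemma tr_mult_psd_nonneg: "psd_op W \<Longrightarrow> 0 \<le> Re (tr (W * (adj K * K)))"
proof -
  assume "psd_op W"
  then have "psd_op (adj (adj K) * W * adj K)" by (rule psd_sandwich)
  then have "0 \<le> Re (tr (K * W * adj K))" using tr_psd_nonneg by fastforce
  then show ?thesis by (metis tr_mult_commute mult.assoc)
qed

lemma tr_mult_proj: "proj d P \<Longrightarrow> tr (P * A * P) = tr (P * A)"
  by (metis proj_def tr_mult_commute mult.assoc)

lemma tr_mult_proj_le:
  assumes "fits d W" "psd_op W" "proj d P"
  shows "Re (tr (W * P)) \<le> Re (tr W)"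
proof -
  have "0 \<le> Re (tr (W * (adj (idm d - P) * (idm d - P))))"
    by (rule tr_mult_psd_nonneg) (rule assms)
  also have "adj (idm d - P) * (idm d - P) = idm d - P"
    using assms by (simp add: proj_def adj_dg left_diff_distrib right_diff_distrib dg_mult_dg)
  finally show ?thesis using assms by (simp add: right_diff_distrib)
qed

text \<open>Exchanging the two factors of a Gram matrix brings the projection to the outside, where
  it compresses the power of \<sigma>.\<close>

lemma trp_compress_proj:
  assumes "fits d \<sigma>" "psd_op \<sigma>" "proj d P" "0 < s" "s \<le> 1"
  shows "trp d (pw d \<sigma> (s / 2) * P * pw d \<sigma> (s / 2)) (1 / s) \<le> Re (tr (P * \<sigma>))"
proof -
  let ?K = "P * pw d \<sigma> (s / 2)"
  have h: "adj \<sigma> = \<sigma>" using assms psd_adj by blast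
  note adjpw = adj_pw[OF assms(1) h] and pwm = pw_mult[OF assms(1) h]
  have K: "fits d ?K" using assms h by (auto simp: proj_def)
  have "pw d \<sigma> (s / 2) * P * pw d \<sigma> (s / 2) = adj ?K * ?K"
    using assms adjpw by (simp add: proj_def) (metis mult.assoc)
  then have "trp d (pw d \<sigma> (s / 2) * P * pw d \<sigma> (s / 2)) (1 / s) = trp d (?K * adj ?K) (1 / s)"
    using trp_gram_commute[OF K] by simp
  also have "?K * adj ?K = adj P * pw d \<sigma> s * P"
  proof -
    have "?K * adj ?K = P * (pw d \<sigma> (s / 2) * pw d \<sigma> (s / 2)) * P"
      using assms adjpw by (simp add: proj_def mult.assoc)
    then show ?thesis using assms by (simp add: pwm proj_def)
  qed
  also have "trp d (adj P * pw d \<sigma> s * P) (1 / s) \<le> Re (tr (adj P * \<sigma> * P))"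
    using assms by (intro trp_compress proj_psd_compl) (auto simp: proj_def)
  also have "tr (adj P * \<sigma> * P) = tr (P * \<sigma>)"
    using tr_mult_proj assms by (simp add: proj_def)
  finally show ?thesis .
qed

text \<open>Data processing for a single measurement outcome: with s = 1 - 1/a, the trace of
  \<open>P * \<rho>\<close> is that of \<open>?X * ?Y\<close>, where the powers of \<sigma> cancel
  on the support of \<rho>. Hoelder's inequality with exponents a and a/(a-1) separates the two, and
  \<open>trp_compress_proj\<close> bounds the second.\<close>

lemma tr_proj_le_gt:
  assumes d: "fits d \<rho>" "fits d \<sigma>" and p: "psd_op \<rho>" "psd_op \<sigma>" and a: "1 < a" and P: "proj d P"
    and supp: "\<rho> * pw d \<sigma> 0 = \<rho>"
  shows "Re (tr (P * \<rho>)) \<le> trp d (pw d \<sigma> ((1 - a) / (2 * a)) * \<rho> * pw d \<sigma> ((1 - a) / (2 * a))) a powr (1 / a)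
     * Re (tr (P * \<sigma>)) powr (1 - 1 / a)"
proof -
  define s where "s = 1 - 1 / a"
  have s: "0 < s" "s \<le> 1" using a by (auto simp: s_def)
  have h: "adj \<sigma> = \<sigma>" "adj \<rho> = \<rho>" using p psd_adj by auto
  note pwm = pw_mult[OF d(2) h(1)]
  have e: "(1 - a) / (2 * a) = - (s / 2)" using a by (simp add: s_def field_simps)
  let ?X = "pw d \<sigma> (- (s / 2)) * \<rho> * pw d \<sigma> (- (s / 2))"
  let ?Y = "pw d \<sigma> (s / 2) * P * pw d \<sigma> (s / 2)"
  have X: "fits d ?X" "psd_op ?X"
    using d h p by (auto intro!: psd_sandwich' adj_pw)
  have PP: "psd_op P" using P psdI_gram[of P] by (simp add: proj_def)
  have Y: "fits d ?Y" "psd_op ?Y"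
    using d h P PP by (auto intro!: psd_sandwich' adj_pw simp: proj_def)
  have supp': "pw d \<sigma> 0 * \<rho> = \<rho>"
    using arg_cong[OF supp, of adj] d h by (simp add: adj_pw)
  have r: "\<rho> * (pw d \<sigma> (- (s / 2)) * pw d \<sigma> (s / 2)) = \<rho>"
    "pw d \<sigma> (s / 2) * pw d \<sigma> (- (s / 2)) = pw d \<sigma> 0" by (simp_all add: pwm supp)
  have "tr (?X * ?Y) = tr (pw d \<sigma> (- (s / 2)) * (\<rho> * (pw d \<sigma> (- (s / 2)) * pw d \<sigma> (s / 2))) * P * pw d \<sigma> (s / 2))"
    by (simp only: mult.assoc)
  also have "\<dots> = tr (pw d \<sigma> (- (s / 2)) * (\<rho> * P * pw d \<sigma> (s / 2)))"
    unfolding r by (simp only: mult.assoc)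
  also have "\<dots> = tr (\<rho> * P * (pw d \<sigma> (s / 2) * pw d \<sigma> (- (s / 2))))"
    by (subst tr_mult_commute) (simp only: mult.assoc)
  also have "\<dots> = tr (pw d \<sigma> 0 * (\<rho> * P))"
    unfolding r by (rule tr_mult_commute)
  also have "\<dots> = tr (P * \<rho>)"
    unfolding mult.assoc[symmetric] supp' by (rule tr_mult_commute)
  finally have "Re (tr (P * \<rho>)) = Re (tr (?X * ?Y))" by simp
  also have "\<dots> \<le> trp d ?X (1 / (1 / a)) powr (1 / a) * trp d ?Y (1 / (1 - 1 / a)) powr (1 - 1 / a)"
    using a X Y by (intro Holder_tr) auto
  also have "\<dots> \<le> trp d ?X (1 / (1 / a)) powr (1 / a) * Re (tr (P * \<sigma>)) powr (1 - 1 / a)"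
    using trp_compress_proj[OF d(2) p(2) P s] Y s
    by (intro mult_left_mono powr_mono2) (auto simp: s_def intro!: trp_nonneg psd_adj)
  finally show ?thesis by (simp add: e)
qed

text \<open>For an eigenvector \<open>u\<close> of \<open>X\<close> with eigenvalue \<open>x > 0\<close>, \<open>X \<le> Y\<close> gives
  \<open>x * \<langle>u, z\<rangle>\<^sup>2 \<le> \<langle>z, Y z\<rangle>\<close>; taking \<open>z = Y\<^sup>-\<^sup>1 u\<close> yields \<open>\<langle>u, Y\<^sup>-\<^sup>1 u\<rangle> \<le> 1 / x\<close>.\<close>

lemma qf_inverse_le:
  assumes U: "unitary d U" "\<And>i. 0 \<le> x i" and Y: "fits d Y" "psd_op Y" and le: "psd_op (Y - sp d U x)"
    and i: "i < d" "0 < x i"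
  shows "qf (pw d Y (- 1)) U i \<le> 1 / x i"
proof -
  have h: "adj Y = Y" using Y psd_adj by blast
  let ?Y' = "pw d Y (- 1)"
  let ?c = "qf ?Y' U i"
  have Y': "fits d ?Y'" "psd_op ?Y'" "adj ?Y' = ?Y'" using Y h psd_pw adj_pw by auto
  have c: "0 \<le> ?c" using Y' by (intro qf_nonneg)
  have "x i * ?c\<^sup>2 \<le> x i * wt U (?Y' * U) i i"
  proof -
    have "\<bar>?c\<bar> \<le> cmod (ent (adj U * (?Y' * U)) i i)"
      unfolding qf_def mult.assoc by (rule abs_Re_le_cmod)
    then have "?c\<^sup>2 \<le> wt U (?Y' * U) i i"
      unfolding wt_def by (metis power2_le_iff_abs_le norm_ge_zero power2_abs power_mono abs_ge_zero)
    then show ?thesis using i by (intro mult_left_mono) auto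
  qed
  also have "\<dots> \<le> (\<Sum>k<d. wt U (?Y' * U) k i * x k)"
    using i U member_le_sum[of i "{..<d}" "\<lambda>k. wt U (?Y' * U) k i * x k"] by (simp add: mult.commute)
  also have "\<dots> = qf (sp d U x) (?Y' * U) i" using U by (simp add: qf_sp)
  also have "\<dots> \<le> qf Y (?Y' * U) i" using le by (rule qf_mono)
  also have "\<dots> = qf (?Y' * Y * ?Y') U i" by (simp add: qf_mult Y')
  also have "?Y' * Y * ?Y' = ?Y'"
  proof -
    have "?Y' * Y * ?Y' = pw d Y (- 1) * pw d Y 1 * pw d Y (- 1)" using Y by (simp add: pw_one)
    also have "\<dots> = pw d Y (- 1)" by (simp add: pw_mult Y h)
    finally show ?thesis .
  qed
  finally have "x i * ?c * ?c \<le> 1 * ?c" by (simp add: power2_eq_square)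
  then have "x i * ?c \<le> 1 \<or> ?c = 0" using c by (metis less_le mult_le_cancel_right_pos)
  then show ?thesis using i by (auto simp: field_simps)
qed

text \<open>For a unit eigenvector u of \<open>X\<close> with eigenvalue x > 0, concavity gives <u,
  Y^(a-1) u> \<le> <u, Y^(-1) u>^(1-a), and \<open>qf_inverse_le\<close> bounds this by x^(a-1).
  Both the splitting of sums and the pinching bound for a < 1 come from here.\<close>

lemma tr_mult_pw_le:
  assumes X: "fits d X" "psd_op X" and Y: "fits d Y" and le: "psd_op (Y - X)" and a: "0 < a" "a < 1"
  shows "Re (tr (X * pw d Y (a - 1))) \<le> trp d X a"
proof -
  have pY: "psd_op Y" using X le psd_trans_le by blast
  then have h: "adj Y = Y" by (rule psd_adj)
  obtain U x where U: "unitary d U" "X = sp d U x" "\<And>i. 0 \<le> x i" using spectral_psd X by blast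
  obtain V y where V: "unitary d V" "Y = sp d V y" "\<And>i. 0 \<le> y i" using spectral_psd Y pY by blast
  have key: "x i * qf (pw d Y (a - 1)) U i \<le> x i powr a" if i: "i < d" for i
  proof (cases "x i = 0")
    case False
    then have xi: "0 < x i" using U(3)[of i] by simp
    have pp: "(z powr (- 1)) powr (1 - a) = z powr (a - 1)" for z :: real
      unfolding powr_powr by simp
    have "qf (pw d Y (a - 1)) U i = (\<Sum>k<d. wt V U k i * (y k powr (- 1)) powr (1 - a))"
      unfolding pp using V by (simp add: pw_sp qf_sp)
    also have "\<dots> \<le> (\<Sum>k<d. wt V U k i * y k powr (- 1)) powr (1 - a)"
      using a U V i by (intro sum_powr_le_powr_sum) (auto simp: wt_uni_col)
    also have "\<dots> = qf (pw d Y (- 1)) U i powr (1 - a)" using V by (simp add: pw_sp qf_sp)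
    also have "\<dots> \<le> (1 / x i) powr (1 - a)"
      using a qf_inverse_le[of d U x Y i, OF U(1,3) Y pY] i xi le U(2)
      by (intro powr_mono2 qf_nonneg psd_pw Y h) auto
    also have "\<dots> = x i powr (a - 1)" using xi by (simp add: powr_divide powr_minus_divide[symmetric])
    finally have "x i * qf (pw d Y (a - 1)) U i \<le> x i * x i powr (a - 1)"
      using xi by simp
    then show ?thesis using xi by (simp add: powr_diff)
  qed simp
  have "Re (tr (X * pw d Y (a - 1))) = (\<Sum>i<d. x i * qf (pw d Y (a - 1)) U i)"
    unfolding U(2) using U(1) Y h by (intro tr_sp_mult) auto
  also have "\<dots> \<le> (\<Sum>i<d. x i powr a)" using key by (intro sum_mono) auto
  also have "\<dots> = trp d X a" using U by (simp add: trp_sp)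
  finally show ?thesis .
qed

lemma trp_eq_tr_mult_pw: "fits d Y \<Longrightarrow> psd_op Y \<Longrightarrow> trp d Y a = Re (tr (Y * pw d Y (a - 1)))"
proof -
  assume Y: "fits d Y" "psd_op Y"
  have "Y * pw d Y (a - 1) = pw d Y 1 * pw d Y (a - 1)" using Y by (simp add: pw_one)
  also have "\<dots> = pw d Y a" using Y psd_adj by (simp add: pw_mult)
  finally show ?thesis by (simp add: trp_def)
qed

lemma psd_sum_minus_member: "finite S \<Longrightarrow> k \<in> S \<Longrightarrow> (\<And>i. i \<in> S \<Longrightarrow> psd_op (X i)) \<Longrightarrow> psd_op (sum X S - X k)"
proof -
  assume S: "finite S" "k \<in> S" "\<And>i. i \<in> S \<Longrightarrow> psd_op (X i)"
  then have "sum X S - X k = sum X (S - {k})" by (simp add: sum.remove)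
  moreover have "psd_op (sum X (S - {k}))" using S by (intro psd_sum) auto
  ultimately show ?thesis by (simp only:)
qed

text \<open>With Y the whole sum, the trace of Y^a splits linearly into the traces of X_k Y^(a-1),
  and Y dominates each X_k.\<close>

lemma Rotfeld:
  assumes "finite S" "\<And>k. k \<in> S \<Longrightarrow> fits d (X k)" "\<And>k. k \<in> S \<Longrightarrow> psd_op (X k)" "0 < a" "a < 1"
  shows "trp d (\<Sum>k\<in>S. X k) a \<le> (\<Sum>k\<in>S. trp d (X k) a)"
proof -
  let ?Y = "\<Sum>k\<in>S. X k"
  have Y: "fits d ?Y" "psd_op ?Y" using assms by (auto intro!: fits_sum psd_sum)
  have "trp d ?Y a = (\<Sum>k\<in>S. Re (tr (X k * pw d ?Y (a - 1))))"
    unfolding trp_eq_tr_mult_pw[OF Y] by (simp add: sum_distrib_right tr_sum)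
  also have "\<dots> \<le> (\<Sum>k\<in>S. trp d (X k) a)"
    using assms Y by (intro sum_mono tr_mult_pw_le psd_sum_minus_member) auto
  finally show ?thesis .
qed

text \<open>Hoelder's inequality for Schatten quasi-norms, with 1/(2a) = 1/2 + (1-a)/(2a), for the
  product of the square root of \<open>W\<close> and \<open>K\<close>. The bound 1/2 \<le> a enters
  as a/(1-a) \<ge> 1, the convex range of Peierls' inequality for \<open>adj K * K\<close>.\<close>

lemma trp_sandwich_le:
  assumes W: "fits d W" "psd_op W" and K: "fits d K" and a: "1 / 2 \<le> a" "a < 1"
  shows "trp d (adj K * W * K) a \<le> Re (tr W) powr a * trp d (adj K * K) (a / (1 - a)) powr (1 - a)"
proof -
  define t where "t = a / (1 - a)"
  have t: "1 \<le> t" "0 < t" "t * (1 - a) = a" using a by (auto simp: t_def field_simps)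
  let ?Y = "adj K * K" and ?X = "adj K * W * K"
  have Y: "fits d ?Y" "psd_op ?Y" "adj ?Y = ?Y" using K by (auto simp: psdI_gram)
  have X: "fits d ?X" "psd_op ?X" using K W by auto
  obtain U x where U: "unitary d U" "?X = sp d U x" "\<And>i. 0 \<le> x i" using spectral_psd X by blast
  obtain V y where V: "unitary d V" "?Y = sp d V y" "\<And>i. 0 \<le> y i" using spectral_psd Y by blast
  \<comment> \<open>\<open>K Z K\<^sup>*\<close> is a projection, hence \<open>\<Sum>\<^sub>i x\<^sub>i c\<^sub>i \<le> tr W\<close>, and \<open>c\<^sub>i e\<^sub>i \<ge> 1\<close> by Cauchy-Schwarz.\<close>
  define Z where "Z = pw d ?Y (- 1)"
  have Z: "fits d Z" "psd_op Z" "adj Z = Z" using Y unfolding Z_def by (auto intro!: fits_pw psd_pw adj_pw)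
  have ZYZ: "Z * ?Y * Z = Z"
  proof -
    have "Z * ?Y * Z = pw d ?Y (- 1) * pw d ?Y 1 * pw d ?Y (- 1)" using Y by (simp add: Z_def pw_one)
    also have "\<dots> = pw d ?Y (- 1)" by (simp add: pw_mult Y del: adj_mult)
    finally show ?thesis by (simp only: Z_def)
  qed
  define c e where "c i = qf Z U i" and "e i = qf ?Y U i" for i
  have c: "0 \<le> c i" and e: "0 \<le> e i" for i using Z Y by (auto simp: c_def e_def qf_nonneg)
  have "(\<Sum>i<d. x i * c i) = Re (tr (?X * Z))"
    unfolding U(2) c_def using U Z by (simp add: tr_sp_mult)
  also have "tr (?X * Z) = tr (W * (K * Z * adj K))"
    by (metis tr_mult_commute mult.assoc)
  also have "Re \<dots> \<le> Re (tr W)"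
  proof (rule tr_mult_proj_le[OF W])
    have "K * Z * adj K * (K * Z * adj K) = K * (Z * ?Y * Z) * adj K" by (simp add: mult.assoc)
    then have "K * Z * adj K * (K * Z * adj K) = K * Z * adj K" by (simp only: ZYZ)
    moreover have "adj (K * Z * adj K) = K * Z * adj K" using Z by (simp add: mult.assoc)
    ultimately show "proj d (K * Z * adj K)" using K Z unfolding proj_def by auto
  qed
  finally have xc: "(\<Sum>i<d. x i * c i) \<le> Re (tr W)" .
  \<comment> \<open>An eigenvector of \<open>?X\<close> with nonzero eigenvalue lies in the range of
    \<open>adj K\<close>, hence is orthogonal to the kernel of \<open>?Y\<close>. This justifies
    Cauchy-Schwarz with an inverse that lives only on the support.\<close>
  have w0: "wt V U k i = 0" if "k < d" "i < d" "y k = 0" "0 < x i" for k i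
  proof -
    have "ent (adj (K * V) * (K * V)) k k = 0"
    proof -
      have "adj (K * V) * (K * V) = adj V * sp d V y * V" by (simp add: mult.assoc flip: V(2))
      then show ?thesis using V that by (simp only: ent_uni_conj_sp) simp
    qed
    moreover have KV: "fits d (K * V)" using K V by (simp add: unitary_dim)
    ultimately have "(\<Sum>m<d. (cmod (ent (K * V) m k))\<^sup>2) = 0"
      unfolding ent_gram_diag[OF KV] by (simp only: of_real_eq_0_iff)
    then have KV0: "ent (K * V) m k = 0" if "m < d" for m
      using that by (simp add: sum_nonneg_eq_0_iff)
    have "adj V * U * dg d (\<lambda>i. complex_of_real (x i)) = adj V * (sp d U x * U)"
      using U(1) by (simp add: sp_def mult.assoc unitary_simps)
    also have "\<dots> = adj (K * V) * (W * K * U)" by (simp add: mult.assoc flip: U(2))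
    finally have "ent (adj V * U) k i * complex_of_real (x i) = ent (adj (K * V) * (W * K * U)) k i"
      using that by (metis ent_mult_dg)
    also have "\<dots> = 0" using KV0 by (simp only: ent_gram[OF KV]) simp
    finally show ?thesis using that by (simp add: wt_def)
  qed
  have ce: "1 \<le> c i * e i" if i: "i < d" "0 < x i" for i
  proof -
    let ?w = "\<lambda>k. wt V U k i"
    have "1 = (\<Sum>k<d. ?w k)" using U V i by (simp add: wt_uni_col)
    also have "\<dots> = (\<Sum>k<d. (sqrt (?w k) * sqrt (y k powr (- 1))) * (sqrt (?w k) * sqrt (y k)))"
    proof (rule sum.cong)
      fix k assume k: "k \<in> {..<d}"
      show "?w k = (sqrt (?w k) * sqrt (y k powr (- 1))) * (sqrt (?w k) * sqrt (y k))"
      proof (cases "y k = 0")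
        case True
        then show ?thesis using w0[of k i] k i by simp
      next
        case False
        then have "0 < y k" using V(3)[of k] by simp
        then have "sqrt (y k powr (- 1)) * sqrt (y k) = 1"
          by (simp add: powr_minus_divide real_sqrt_divide)
        then have "?w k = (sqrt (?w k) * sqrt (?w k)) * (sqrt (y k powr (- 1)) * sqrt (y k))" by simp
        then show ?thesis by (simp only: mult_ac)
      qed
    qed simp
    finally have "1\<^sup>2 = (\<Sum>k<d. (sqrt (?w k) * sqrt (y k powr (- 1))) * (sqrt (?w k) * sqrt (y k)))\<^sup>2" by simp
    also have "\<dots> \<le> (\<Sum>k<d. (sqrt (?w k) * sqrt (y k powr (- 1)))\<^sup>2) * (\<Sum>k<d. (sqrt (?w k) * sqrt (y k))\<^sup>2)"
      by (rule Cauchy_Schwarz_ineq_sum)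
    also have "\<dots> = c i * e i"
      unfolding c_def e_def Z_def V(2) using V by (simp add: pw_sp qf_sp power_mult_distrib)
    finally show ?thesis by simp
  qed
  have "trp d ?X a = (\<Sum>i<d. x i powr a)" unfolding U(2) using U by (simp add: trp_sp)
  also have "\<dots> \<le> (\<Sum>i<d. (x i * c i) powr a * (e i powr t) powr (1 - a))"
  proof (rule sum_mono)
    fix i assume "i \<in> {..<d}"
    show "x i powr a \<le> (x i * c i) powr a * (e i powr t) powr (1 - a)"
    proof (cases "x i = 0")
      case False
      then have xi: "0 < x i" using U(3)[of i] by simp
      have "x i powr a * 1 \<le> x i powr a * (c i * e i) powr a"
        using ce[of i] xi \<open>i \<in> _\<close> a ge_one_powr_ge_zero[of "c i * e i" a] by (intro mult_left_mono) auto
      also have "\<dots> = (x i * c i) powr a * (e i powr t) powr (1 - a)"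
        using t c e xi by (simp add: powr_mult powr_powr)
      finally show ?thesis by simp
    qed simp
  qed
  also have "\<dots> \<le> (\<Sum>i<d. x i * c i) powr a * (\<Sum>i<d. e i powr t) powr (1 - a)"
    using a U c by (intro Holder_powr_sum) auto
  also have "\<dots> \<le> Re (tr W) powr a * trp d ?Y t powr (1 - a)"
    using a U c e xc Peierls_convex[OF Y(1,2) U(1) t(1)]
    by (intro mult_mono powr_mono2) (auto simp: e_def intro!: sum_nonneg)
  finally show ?thesis by (simp only: t_def)
qed

section \<open>Projective measurements and pinching\<close>

definition resol :: "nat \<Rightarrow> 'k set \<Rightarrow> ('k \<Rightarrow> cmat) \<Rightarrow> bool" where
  "resol d S P \<longleftrightarrow> finite S \<and> (\<forall>k\<in>S. proj d (P k)) \<and> (\<forall>k\<in>S. \<forall>l\<in>S. k \<noteq> l \<longrightarrow> P k * P l = 0)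
     \<and> sum P S = idm d"

definition pinch :: "'k set \<Rightarrow> ('k \<Rightarrow> cmat) \<Rightarrow> cmat \<Rightarrow> cmat" where
  "pinch S P M = (\<Sum>k\<in>S. P k * M * P k)"

text \<open>The Cauchy-Schwarz inequality for operators: twice the difference is the sum of the Gram
  matrices of all \<open>A k - A l\<close>.\<close>

lemma psd_card_sum_gram:
  assumes "finite S"
  shows "psd_op (real (card S) *\<^sub>R (\<Sum>k\<in>S. adj (A k) * A k) - adj (sum A S) * sum A S)" (is "psd_op ?N")
proof -
  have two: "B + B - C - C = 2 *\<^sub>R (B - C)" for B C :: cmat
    by (simp add: scaleR_2)
  have "(\<Sum>k\<in>S. \<Sum>l\<in>S. adj (A k - A l) * (A k - A l)) =
      (\<Sum>k\<in>S. \<Sum>l\<in>S. adj (A k) * A k + adj (A l) * A l - adj (A k) * A l - adj (A l) * A k)"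
    by (simp add: algebra_simps)
  also have "\<dots> = (\<Sum>k\<in>S. \<Sum>l\<in>S. adj (A k) * A k) + (\<Sum>k\<in>S. \<Sum>l\<in>S. adj (A l) * A l)
      - (\<Sum>k\<in>S. \<Sum>l\<in>S. adj (A k) * A l) - (\<Sum>k\<in>S. \<Sum>l\<in>S. adj (A l) * A k)"
    by (simp only: sum.distrib sum_subtractf)
  also have "(\<Sum>k\<in>S. \<Sum>l\<in>S. adj (A l) * A k) = (\<Sum>k\<in>S. \<Sum>l\<in>S. adj (A k) * A l)"
    by (rule sum.swap)
  also have "(\<Sum>k\<in>S. \<Sum>l\<in>S. adj (A k) * A l) = adj (sum A S) * sum A S"
    by (simp add: adj_sum sum_product)
  also have "(\<Sum>k\<in>S. \<Sum>l\<in>S. adj (A k) * A k) = real (card S) *\<^sub>R (\<Sum>k\<in>S. adj (A k) * A k)"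
    by (simp add: sum_constant_scaleR scaleR_sum_right)
  also have "(\<Sum>k\<in>S. \<Sum>l\<in>S. adj (A l) * A l) = real (card S) *\<^sub>R (\<Sum>k\<in>S. adj (A k) * A k)"
    by (simp add: sum_constant_scaleR)
  finally have "(\<Sum>k\<in>S. \<Sum>l\<in>S. adj (A k - A l) * (A k - A l)) = 2 *\<^sub>R ?N"
    by (simp only: two)
  then have "?N = (1 / 2) *\<^sub>R (\<Sum>k\<in>S. \<Sum>l\<in>S. adj (A k - A l) * (A k - A l))" by simp
  also have "psd_op \<dots>" by (intro psd_scaleR psd_sum psdI_gram) simp
  finally show ?thesis .
qed

lemma resol_dim: "resol d S P \<Longrightarrow> k \<in> S \<Longrightarrow> fits d (P k)"
  and resol_proj: "resol d S P \<Longrightarrow> k \<in> S \<Longrightarrow> proj d (P k)"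
  and resol_adj: "resol d S P \<Longrightarrow> k \<in> S \<Longrightarrow> adj (P k) = P k"
  and resol_idem: "resol d S P \<Longrightarrow> k \<in> S \<Longrightarrow> P k * P k = P k"
  and resol_orth: "resol d S P \<Longrightarrow> k \<in> S \<Longrightarrow> l \<in> S \<Longrightarrow> k \<noteq> l \<Longrightarrow> P k * P l = 0"
  and resol_sum: "resol d S P \<Longrightarrow> sum P S = idm d"
  and resol_finite: "resol d S P \<Longrightarrow> finite S"
  by (auto simp: resol_def proj_def)

lemma ex_gram: "fits d M \<Longrightarrow> psd_op M \<Longrightarrow> \<exists>K. fits d K \<and> adj K = K \<and> M = adj K * K"
proof -
  assume M: "fits d M" "psd_op M"
  then have h: "adj M = M" using psd_adj by blast
  let ?K = "pw d M (1 / 2)"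
  have "adj ?K * ?K = pw d M 1" using M h by (simp add: adj_pw pw_mult)
  then show ?thesis using M h adj_pw fits_pw pw_one by metis
qed

lemma fits_pinch: "resol d S P \<Longrightarrow> fits d M \<Longrightarrow> fits d (pinch S P M)"
  unfolding pinch_def by (intro fits_sum fits_mult) (auto dest: resol_dim)

lemma psd_pinch: "resol d S P \<Longrightarrow> psd_op M \<Longrightarrow> psd_op (pinch S P M)"
  unfolding pinch_def by (intro psd_sum psd_sandwich') (auto dest: resol_adj)

lemma adj_pinch: "resol d S P \<Longrightarrow> adj M = M \<Longrightarrow> adj (pinch S P M) = pinch S P M"
  unfolding pinch_def adj_sum by (intro sum.cong) (auto simp: resol_adj mult.assoc)

text \<open>For M = \<open>adj K * K\<close> the operators \<open>K * P k\<close> add up to K, and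
  their Gram matrices add up to the pinching of M.\<close>

lemma pinching_inequality:
  assumes R: "resol d S P" and M: "fits d M" "psd_op M"
  shows "psd_op (real (card S) *\<^sub>R pinch S P M - M)"
proof -
  obtain K where K: "fits d K" "M = adj K * K" using ex_gram M by blast
  have "(\<Sum>k\<in>S. K * P k) = K" using K resol_sum[OF R] by (simp flip: sum_distrib_left)
  moreover have "(\<Sum>k\<in>S. adj (K * P k) * (K * P k)) = pinch S P M"
    unfolding pinch_def K(2) by (intro sum.cong) (auto simp: resol_adj[OF R] mult.assoc)
  ultimately show ?thesis
    using psd_card_sum_gram[OF resol_finite[OF R], of "\<lambda>k. K * P k"] K by simp
qed

lemma sp_commute_fun:
  assumes U: "unitary d U" and A: "fits d A" and eq: "A * sp d U l = sp d U l * A"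
  shows "A * sp d U (\<lambda>i. f (l i)) = sp d U (\<lambda>i. f (l i)) * A"
proof -
  let ?c = complex_of_real
  define W where "W = adj U * A * U"
  have W: "fits d W" using U A by (simp add: W_def unitary_dim)
  have mult: "W * dg d (\<lambda>i. ?c (g i)) = adj U * (A * sp d U g) * U"
    "dg d (\<lambda>i. ?c (g i)) * W = adj U * (sp d U g * A) * U" for g
    using unitary_simps[OF U] A by (simp_all add: W_def sp_def mult.assoc)
  have inter: "W * dg d (\<lambda>i. ?c (l i)) = dg d (\<lambda>i. ?c (l i)) * W"
    unfolding mult eq ..
  have "W * dg d (\<lambda>i. ?c (f (l i))) = dg d (\<lambda>i. ?c (f (l i))) * W"
  proof (rule cmat_eqI'[of d])
    fix i j assume "i < d" "j < d"
    moreover from this have "ent W i j * ?c (l j) = ?c (l i) * ent W i j"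
      using arg_cong[OF inter, of "\<lambda>A. ent A i j"] by (simp add: ent_mult_dg ent_dg_mult)
    then have "ent W i j = 0 \<or> l j = l i" by auto
    ultimately show "ent (W * dg d (\<lambda>i. ?c (f (l i)))) i j = ent (dg d (\<lambda>i. ?c (f (l i))) * W) i j"
      by (auto simp: ent_mult_dg ent_dg_mult)
  qed (use W in auto)
  then have "adj U * (A * sp d U (\<lambda>i. f (l i))) * U = adj U * (sp d U (\<lambda>i. f (l i)) * A) * U"
    by (simp only: mult)
  then have "U * (adj U * (A * sp d U (\<lambda>i. f (l i))) * U) * adj U = U * (adj U * (sp d U (\<lambda>i. f (l i)) * A) * U) * adj U"
    by (simp only:)
  then show ?thesis using unitary_simps[OF U] A fits_sp[OF U] by (simp add: mult.assoc)
qed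

lemma pw_commute:
  assumes "fits d M" "adj M = M" "fits d A" "A * M = M * A"
  shows "A * pw d M p = pw d M p * A"
proof -
  obtain U l where U: "unitary d U" "M = sp d U l" using spectral_herm assms by metis
  then show ?thesis using sp_commute_fun[of d U A l "\<lambda>x. x powr p"] assms by (simp add: pw_sp)
qed

lemma pinch_commute:
  assumes R: "resol d S P" and k: "k \<in> S"
  shows "P k * pinch S P M = P k * M * P k" "pinch S P M * P k = P k * M * P k"
proof -
  have "P k * pinch S P M = (\<Sum>j\<in>S. if j = k then P k * M * P k else 0)"
    unfolding pinch_def sum_distrib_left
    using resol_orth[OF R k] resol_idem[OF R k] by (intro sum.cong) (auto simp flip: mult.assoc)
  then show "P k * pinch S P M = P k * M * P k" using k resol_finite[OF R] by simp
  have "pinch S P M * P k = (\<Sum>j\<in>S. if j = k then P k * M * P k else 0)"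
    unfolding pinch_def sum_distrib_right
    using resol_orth[OF R _ k] resol_idem[OF R k] by (intro sum.cong) (auto simp: mult.assoc)
  then show "pinch S P M * P k = P k * M * P k" using k resol_finite[OF R] by simp
qed

text \<open>Pinching is self-adjoint for the trace pairing and fixes operators that commute with all
  the projections.\<close>

lemma tr_pinch_mult:
  assumes R: "resol d S P" and Z: "fits d Z" "\<And>k. k \<in> S \<Longrightarrow> P k * Z = Z * P k"
  shows "tr (pinch S P M * Z) = tr (M * Z)"
proof -
  have "tr (pinch S P M * Z) = (\<Sum>k\<in>S. tr (P k * M * P k * Z))"
    by (simp add: pinch_def sum_distrib_right tr_sum)
  also have "\<dots> = (\<Sum>k\<in>S. tr (M * Z * P k))"
  proof (rule sum.cong)
    fix k assume k: "k \<in> S"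
    have "tr (P k * M * P k * Z) = tr (M * (P k * Z) * P k)" by (metis tr_mult_commute mult.assoc)
    also have "\<dots> = tr (M * Z * (P k * P k))" unfolding Z(2)[OF k] by (simp only: mult.assoc)
    finally show "tr (P k * M * P k * Z) = tr (M * Z * P k)" by (simp only: resol_idem[OF R k])
  qed simp
  also have "\<dots> = tr (M * Z)"
    using Z by (simp flip: tr_sum sum_distrib_left add: resol_sum[OF R] mult.assoc)
  finally show ?thesis .
qed

text \<open>By the pinching inequality, \<open>tr_mult_pw_le\<close> may compare X with |S| times
  its pinching Y. The power Y^(a-1) commutes with the projections, so in the trace against it X can
  be replaced by Y.\<close>

lemma trp_pinch_lt:
  assumes R: "resol d S P" and X: "fits d X" "psd_op X" and a: "0 < a" "a < 1"
  shows "trp d (pinch S P X) a \<le> real (card S) powr (1 - a) * trp d X a"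
proof -
  let ?Y = "pinch S P X" and ?v = "real (card S)"
  have Y: "fits d ?Y" "psd_op ?Y" "adj ?Y = ?Y"
    using fits_pinch[OF R] psd_pinch[OF R] adj_pinch[OF R] X psd_adj by auto
  show ?thesis
  proof (cases "S = {}")
    \<comment> \<open>An empty family sums up to the identity only in dimension 0; the rescaling in
      the other case divides by the size of \<open>S\<close>.\<close>
    case True
    then have "dg d (\<lambda>_. 1 :: complex) = 0" using resol_sum[OF R] by simp
    then have "X = 0" using X by (metis idm_mult mult_zero_left)
    then have "?Y = 0" by (simp add: pinch_def)
    moreover have "trp d 0 a = 0" using trp_sp[OF unitary_idm, of d "\<lambda>_. 0" a] by (simp add: sp_0)
    ultimately show ?thesis using \<open>X = 0\<close> by simp
  next
    case False
    then have v: "0 < ?v" using resol_finite[OF R] by (simp add: card_gt_0_iff)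
    have pw: "pw d (?v *\<^sub>R ?Y) (a - 1) = ?v powr (a - 1) *\<^sub>R pw d ?Y (a - 1)"
    proof -
      obtain V y where V: "unitary d V" "?Y = sp d V y" "\<And>i. 0 \<le> y i" using spectral_psd Y by blast
      then show ?thesis using v by (simp add: sp_scaleR pw_sp powr_mult)
    qed
    have comm: "P k * pw d ?Y (a - 1) = pw d ?Y (a - 1) * P k" if "k \<in> S" for k
      using that Y pinch_commute[OF R that] by (intro pw_commute) (auto simp: resol_dim[OF R])
    have "?v powr (a - 1) * trp d ?Y a = Re (tr (X * pw d (?v *\<^sub>R ?Y) (a - 1)))"
      using tr_pinch_mult[OF R fits_pw[OF Y(1,3)] comm, of X]
      by (simp add: pw trp_eq_tr_mult_pw[OF Y(1,2)])
    also have "\<dots> \<le> trp d X a"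
      using X Y a by (intro tr_mult_pw_le pinching_inequality[OF R]) auto
    finally have "?v powr (1 - a) * (?v powr (a - 1) * trp d ?Y a) \<le> ?v powr (1 - a) * trp d X a"
      by (rule mult_left_mono) simp
    then show ?thesis using v by (simp flip: mult.assoc powr_add)
  qed
qed

lemma trp_pinch_gt:
  assumes R: "resol d S P" and X: "fits d X" "psd_op X" and a: "0 < a"
  shows "trp d X a \<le> real (card S) powr a * trp d (pinch S P X) a"
proof -
  have "trp d X a \<le> trp d (real (card S) *\<^sub>R pinch S P X) a"
    using X a by (intro trp_mono pinching_inequality[OF R] fits_scaleR fits_pinch[OF R])
  also have "\<dots> = real (card S) powr a * trp d (pinch S P X) a"
    using X by (intro trp_scaleR fits_pinch[OF R] psd_pinch[OF R]) auto
  finally show ?thesis .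
qed

text \<open>Data processing under a measurement, up to the price of pinching. The pinching
  inequality replaces \<rho> by its blocks, \<open>Rotfeld\<close> separates them, and each block is
  bounded by \<open>trp_sandwich_le\<close> and \<open>trp_compress_proj\<close>.\<close>

lemma trp_le_measured_lt:
  assumes d: "fits d \<rho>" "fits d \<sigma>" and p: "psd_op \<rho>" "psd_op \<sigma>" and a: "1 / 2 \<le> a" "a < 1" and R: "resol d S P"
  shows "trp d (pw d \<sigma> ((1 - a) / (2 * a)) * \<rho> * pw d \<sigma> ((1 - a) / (2 * a))) a
    \<le> real (card S) powr a * (\<Sum>k\<in>S. Re (tr (P k * \<rho>)) powr a * Re (tr (P k * \<sigma>)) powr (1 - a))"
proof -
  define s where "s = (1 - a) / a"
  have s: "0 < s" "s \<le> 1" "1 / s = a / (1 - a)" using a by (auto simp: s_def field_simps)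
  have e: "(1 - a) / (2 * a) = s / 2" using a by (simp add: s_def field_simps)
  have h: "adj \<sigma> = \<sigma>" "adj \<rho> = \<rho>" using p psd_adj by auto
  let ?T = "pw d \<sigma> (s / 2)" and ?v = "real (card S)"
  have T: "fits d ?T" "adj ?T = ?T" using d h by (auto intro!: fits_pw adj_pw)
  have dPk: "fits d (P k)" if "k \<in> S" for k using resol_dim[OF R that] .
  let ?X = "\<lambda>k. ?T * (P k * \<rho> * P k) * ?T"
  have X: "fits d (?X k)" "psd_op (?X k)" if "k \<in> S" for k
    using T d p that dPk resol_adj[OF R that] by (auto intro!: psd_sandwich')
  have sumX: "?T * pinch S P \<rho> * ?T = (\<Sum>k\<in>S. ?X k)"
    by (simp add: pinch_def sum_distrib_left sum_distrib_right)
  have "trp d (?T * \<rho> * ?T) a \<le> trp d (?v *\<^sub>R (\<Sum>k\<in>S. ?X k)) a"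
  proof (rule trp_mono)
    have eq: "?v *\<^sub>R (\<Sum>k\<in>S. ?X k) - ?T * \<rho> * ?T = ?T * (?v *\<^sub>R pinch S P \<rho> - \<rho>) * ?T"
      by (simp add: sumX[symmetric] right_diff_distrib left_diff_distrib)
    show "psd_op (?v *\<^sub>R (\<Sum>k\<in>S. ?X k) - ?T * \<rho> * ?T)"
      unfolding eq by (rule psd_sandwich'[OF pinching_inequality[OF R d(1) p(1)] T(2)])
  qed (use T d p a X in \<open>auto intro!: psd_sandwich' fits_sum\<close>)
  also have "\<dots> = ?v powr a * trp d (\<Sum>k\<in>S. ?X k) a"
    using X by (intro trp_scaleR fits_sum psd_sum) auto
  also have "\<dots> \<le> ?v powr a * (\<Sum>k\<in>S. trp d (?X k) a)"
    using X a resol_finite[OF R] by (intro mult_left_mono Rotfeld) auto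
  also have "\<dots> \<le> ?v powr a * (\<Sum>k\<in>S. Re (tr (P k * \<rho>)) powr a * Re (tr (P k * \<sigma>)) powr (1 - a))"
  proof (intro mult_left_mono sum_mono)
    fix k assume k: "k \<in> S"
    let ?K = "P k * ?T" and ?W = "P k * \<rho> * P k"
    have P: "proj d (P k)" "fits d (P k)" "adj (P k) = P k" "P k * P k = P k"
      using resol_proj[OF R k] by (auto simp: proj_def)
    have W: "fits d ?W" "psd_op ?W" using d P p by (auto intro!: psd_sandwich')
    have "?X k = adj ?K * ?W * ?K"
      using P T by (simp add: mult.assoc) (simp add: P flip: mult.assoc)
    then have "trp d (?X k) a = trp d (adj ?K * ?W * ?K) a" by (simp only:)
    also have "\<dots> \<le> Re (tr ?W) powr a * trp d (adj ?K * ?K) (a / (1 - a)) powr (1 - a)"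
      using W P T a by (intro trp_sandwich_le) auto
    also have "adj ?K * ?K = ?T * P k * ?T"
      using P T by (simp add: mult.assoc) (simp add: P flip: mult.assoc)
    also have "Re (tr ?W) powr a * trp d (?T * P k * ?T) (a / (1 - a)) powr (1 - a)
       \<le> Re (tr ?W) powr a * Re (tr (P k * \<sigma>)) powr (1 - a)"
    proof (intro mult_left_mono powr_mono2)
      show "trp d (?T * P k * ?T) (a / (1 - a)) \<le> Re (tr (P k * \<sigma>))"
        using trp_compress_proj[OF d(2) p(2) P(1) s(1,2)] by (simp only: s)
      show "0 \<le> trp d (?T * P k * ?T) (a / (1 - a))"
        using T P by (intro trp_nonneg) (auto simp: mult.assoc)
    qed (use a in auto)
    also have "tr ?W = tr (P k * \<rho>)" using P by (intro tr_mult_proj)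
    finally show "trp d (?X k) a \<le> Re (tr (P k * \<rho>)) powr a * Re (tr (P k * \<sigma>)) powr (1 - a)" .
  qed simp
  finally show ?thesis by (simp only: e)
qed

section \<open>The Loewner-Heinz inequality\<close>

text \<open>The proof of the Loewner-Heinz inequality represents \<open>x powr s\<close> as a constant multiple of the
  integral of \<open>t powr (s - 1) * (x / (x + t))\<close> over \<open>t > 0\<close>.\<close>

lemma powr_integral_scale:
  fixes s x :: real
  assumes "0 \<le> x"
  shows "(\<integral>\<^sup>+t. ennreal (indicator {0<..} t * (t powr (s - 1) * (x / (x + t)))) \<partial>lborel)
    = ennreal (x powr s) * (\<integral>\<^sup>+t. ennreal (indicator {0<..} t * (t powr (s - 1) * (1 / (1 + t)))) \<partial>lborel)"
proof (cases "x = 0")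
  case False
  then have x: "0 < x" using assms by simp
  have "(\<integral>\<^sup>+t. ennreal (indicator {0<..} t * (t powr (s - 1) * (x / (x + t)))) \<partial>lborel)
     = ennreal \<bar>x\<bar> * (\<integral>\<^sup>+t. ennreal (indicator {0<..} (0 + x * t) * ((0 + x * t) powr (s - 1) * (x / (x + (0 + x * t))))) \<partial>lborel)"
    using x by (intro nn_integral_real_affine) auto
  also have "\<dots> = (\<integral>\<^sup>+t. ennreal \<bar>x\<bar> * ennreal (indicator {0<..} (0 + x * t) * ((0 + x * t) powr (s - 1) * (x / (x + (0 + x * t))))) \<partial>lborel)"
    by (intro nn_integral_cmult[symmetric]) auto
  also have "\<dots> = (\<integral>\<^sup>+t. ennreal (x powr s) * ennreal (indicator {0<..} t * (t powr (s - 1) * (1 / (1 + t)))) \<partial>lborel)"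
  proof (rule nn_integral_cong)
    fix t :: real
    show "ennreal \<bar>x\<bar> * ennreal (indicator {0<..} (0 + x * t) * ((0 + x * t) powr (s - 1) * (x / (x + (0 + x * t)))))
      = ennreal (x powr s) * ennreal (indicator {0<..} t * (t powr (s - 1) * (1 / (1 + t))))"
    proof (cases "0 < t")
      case True
      have "x / (x + x * t) = 1 / (1 + t)"
      proof -
        have "x + x * t = x * (1 + t)" by (simp add: algebra_simps)
        then show ?thesis using x by simp
      qed
      moreover have "x powr s = x * x powr (s - 1)" using x by (simp add: powr_diff)
      ultimately show ?thesis using True x
        by (simp add: powr_mult mult_ac flip: ennreal_mult)
    next
      case False
      then have "\<not> 0 < x * t" using x by (simp add: zero_less_mult_iff)
      with False show ?thesis by simp
    qed
  qed
  also have "\<dots> = ennreal (x powr s) * (\<integral>\<^sup>+t. ennreal (indicator {0<..} t * (t powr (s - 1) * (1 / (1 + t)))) \<partial>lborel)"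
    by (intro nn_integral_cmult) auto
  finally show ?thesis .
qed simp

text \<open>The integrand is at most t^(s-1) on (0,1], integrable since s > 0, and at most t^(s-2)
  beyond, integrable since s < 1. Both facts together allow the constant to be cancelled.\<close>

lemma powr_integral_pos_finite:
  fixes s :: real
  assumes s: "0 < s" "s < 1"
  defines "F \<equiv> (\<integral>\<^sup>+t. ennreal (indicator {0<..} t * (t powr (s - 1) * (1 / (1 + t)))) \<partial>lborel)"
  shows "F \<noteq> 0" "F < \<infinity>"
proof -
  have "F \<le> (\<integral>\<^sup>+t. ennreal (indicator {0..1} t * t powr (s - 1)) + ennreal (indicator {1..} t * t powr (s - 2)) \<partial>lborel)"
    unfolding F_def
  proof (rule nn_integral_mono)
    fix t :: real
    show "ennreal (indicator {0<..} t * (t powr (s - 1) * (1 / (1 + t))))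
      \<le> ennreal (indicator {0..1} t * t powr (s - 1)) + ennreal (indicator {1..} t * t powr (s - 2))"
    proof -
      have "indicator {0<..} t * (t powr (s - 1) * (1 / (1 + t)))
        \<le> indicator {0..1} t * t powr (s - 1) + indicator {1..} t * t powr (s - 2)"
      proof (cases "0 < t")
        case t: True
        show ?thesis
        proof (cases "t \<le> 1")
          case True
          have "t powr (s - 1) * (1 / (1 + t)) \<le> t powr (s - 1) * 1"
            using t by (intro mult_left_mono) auto
          moreover have "0 \<le> indicator {1..} t * t powr (s - 2)" by simp
          ultimately show ?thesis using t True by (simp add: add_increasing2)
        next
          case False
          have "t powr (s - 1) * (1 / (1 + t)) \<le> t powr (s - 1) * (1 / t)"
            using t by (intro mult_left_mono divide_left_mono) auto
          also have "\<dots> = t powr (s - 2)"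
            using t powr_diff[of t "s - 1" 1] by simp
          finally show ?thesis using t False by simp
        qed
      qed simp
      then show ?thesis by (simp flip: ennreal_plus add: ennreal_leI)
    qed
  qed
  also have "\<dots> = (\<integral>\<^sup>+t. ennreal (indicator {0..1} t * t powr (s - 1)) \<partial>lborel) + (\<integral>\<^sup>+t. ennreal (indicator {1..} t * t powr (s - 2)) \<partial>lborel)"
    by (intro nn_integral_add) auto
  also have "(\<integral>\<^sup>+t. ennreal (indicator {0..1} t * t powr (s - 1)) \<partial>lborel) = ennreal (1 powr (s - 1 + 1) / (s - 1 + 1))"
    using s by (intro nn_integral_has_integral_lebesgue has_integral_powr_from_0) auto
  also have "(\<integral>\<^sup>+t. ennreal (indicator {1..} t * t powr (s - 2)) \<partial>lborel) = ennreal (- (1 powr (s - 2 + 1)) / (s - 2 + 1))"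
    using s by (intro nn_integral_has_integral_lebesgue has_integral_powr_to_inf) auto
  finally show "F < \<infinity>" by (rule order_le_less_trans) (simp flip: ennreal_plus)
  show "F \<noteq> 0"
  proof
    assume "F = 0"
    then have "AE t in lborel. ennreal (indicator {0<..} t * (t powr (s - 1) * (1 / (1 + t)))) = 0"
      unfolding F_def by (subst (asm) nn_integral_0_iff_AE) auto
    then have "AE t in lborel. t \<notin> {0<..<1::real}"
    proof eventually_elim
      case (elim t)
      have False if "0 < t" "t < 1"
      proof -
        have "0 < t powr (s - 1) / (1 + t)" using that by (intro divide_pos_pos) auto
        moreover have "t powr (s - 1) / (1 + t) \<le> 0" using elim that by (simp add: ennreal_eq_0_iff)
        ultimately show False by linarith
      qed
      then show ?case by auto
    qed
    moreover have "(AE t in lborel. t \<notin> {0<..<1::real}) \<longleftrightarrow> emeasure lborel {0<..<1::real} = 0"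
      by (rule AE_iff_measurable) auto
    ultimately have "emeasure lborel {0<..<1::real} = 0" by (simp only:)
    moreover have "emeasure lborel {0<..<1::real} = ennreal (1 - 0)"
      by (rule emeasure_lborel_Ioo) simp
    ultimately have "ennreal (1 - 0) = 0" by (simp only:)
    then show False by simp
  qed
qed

text \<open>The hypothesis is the inequality of the transforms x/(x+t), tested on one vector and
  written in the eigenbases of the two operators. Multiplied by t^(s-1) and integrated over t, it
  becomes the conclusion times a common factor \<open>F\<close>.\<close>

lemma Loewner_Heinz_scalar:
  fixes w v x y :: "nat \<Rightarrow> real"
  assumes s: "0 < s" "s < 1"
    and nn: "\<And>i. 0 \<le> w i" "\<And>i. 0 \<le> v i" "\<And>i. 0 \<le> x i" "\<And>i. 0 \<le> y i"
    and le: "\<And>t. 0 < t \<Longrightarrow> (\<Sum>i<d. w i * (x i / (x i + t))) \<le> (\<Sum>i<d. v i * (y i / (y i + t)))"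
  shows "(\<Sum>i<d. w i * x i powr s) \<le> (\<Sum>i<d. v i * y i powr s)"
proof -
  define F where "F = (\<integral>\<^sup>+t. ennreal (indicator {0<..} t * (t powr (s - 1) * (1 / (1 + t)))) \<partial>lborel)"
  have F: "F \<noteq> 0" "F < \<infinity>" using powr_integral_pos_finite[OF s] by (auto simp: F_def)
  have int: "(\<integral>\<^sup>+t. ennreal (indicator {0<..} t * (t powr (s - 1) * (\<Sum>i<d. u i * (z i / (z i + t))))) \<partial>lborel)
      = ennreal (\<Sum>i<d. u i * z i powr s) * F"
    if u: "\<And>i. 0 \<le> u i" and z: "\<And>i. 0 \<le> z i" for u z :: "nat \<Rightarrow> real"
  proof -
    have "ennreal (indicator {0<..} t * (t powr (s - 1) * (\<Sum>i<d. u i * (z i / (z i + t)))))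
       = (\<Sum>i<d. ennreal (u i) * ennreal (indicator {0<..} t * (t powr (s - 1) * (z i / (z i + t)))))" for t
    proof (cases "0 < t")
      case True
      have "ennreal (t powr (s - 1) * (\<Sum>i<d. u i * (z i / (z i + t)))) = ennreal (\<Sum>i<d. u i * (t powr (s - 1) * (z i / (z i + t))))"
        by (simp add: sum_distrib_left mult_ac)
      also have "\<dots> = (\<Sum>i<d. ennreal (u i * (t powr (s - 1) * (z i / (z i + t)))))"
        using True u z by (intro sum_ennreal[symmetric]) (auto intro!: mult_nonneg_nonneg divide_nonneg_nonneg add_nonneg_nonneg)
      also have "\<dots> = (\<Sum>i<d. ennreal (u i) * ennreal (t powr (s - 1) * (z i / (z i + t))))"
        using u by (intro sum.cong refl ennreal_mult') 
      finally show ?thesis using True by simp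
    qed simp
    then have "(\<integral>\<^sup>+t. ennreal (indicator {0<..} t * (t powr (s - 1) * (\<Sum>i<d. u i * (z i / (z i + t))))) \<partial>lborel)
       = (\<Sum>i<d. \<integral>\<^sup>+t. ennreal (u i) * ennreal (indicator {0<..} t * (t powr (s - 1) * (z i / (z i + t)))) \<partial>lborel)"
      by (simp only:) (intro nn_integral_sum, auto)
    also have "\<dots> = (\<Sum>i<d. ennreal (u i) * (\<integral>\<^sup>+t. ennreal (indicator {0<..} t * (t powr (s - 1) * (z i / (z i + t)))) \<partial>lborel))"
      by (intro sum.cong refl nn_integral_cmult) auto
    also have "\<dots> = (\<Sum>i<d. ennreal (u i * z i powr s)) * F"
      by (simp only: powr_integral_scale[OF z] F_def[symmetric] sum_distrib_right)
        (intro sum.cong refl, simp add: ennreal_mult' u mult.assoc)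
    also have "(\<Sum>i<d. ennreal (u i * z i powr s)) = ennreal (\<Sum>i<d. u i * z i powr s)"
      using u by (intro sum_ennreal) auto
    finally show ?thesis .
  qed
  have "ennreal (\<Sum>i<d. w i * x i powr s) * F \<le> ennreal (\<Sum>i<d. v i * y i powr s) * F"
    unfolding int[of w x, OF nn(1,3), symmetric] int[of v y, OF nn(2,4), symmetric]
  proof (intro nn_integral_mono ennreal_leI)
    fix t :: real
    show "indicator {0<..} t * (t powr (s - 1) * (\<Sum>i<d. w i * (x i / (x i + t))))
       \<le> indicator {0<..} t * (t powr (s - 1) * (\<Sum>i<d. v i * (y i / (y i + t))))"
    proof (cases "0 < t")
      case True
      show ?thesis by (intro mult_left_mono le True) (auto simp: indicator_def)
    qed simp
  qed
  then have "ennreal (\<Sum>i<d. w i * x i powr s) \<le> ennreal (\<Sum>i<d. v i * y i powr s)"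
    using F by (simp add: mult_right_ennreal_cancel ennreal_mult_le_mult_iff mult.commute)
  then show ?thesis using nn by (simp add: sum_nonneg ennreal_le_iff)
qed

text \<open>A completed square: C' - D' = (C' - D') C (C' - D') + D' (D - C) D', where C' and D'
  invert C and D relative to the unit E.\<close>

lemma psd_inverse_antimono:
  assumes "psd_op C" "adj C' = C'" "adj D' = D'" "psd_op (D - C)"
    and "C * C' = E" "C' * C = E" "D * D' = E" "D' * D = E" "E * C' = C'" "C' * E = C'" "E * D' = D'" "D' * E = D'"
  shows "psd_op (C' - D')"
proof -
  have e1: "(C' - D') * C * (C' - D') = C' * C * C' - C' * C * D' - D' * (C * C') + D' * C * D'"
    by (simp add: algebra_simps)
  have e2: "D' * (D - C) * D' = D' * D * D' - D' * C * D'"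
    by (simp add: algebra_simps)
  have "C' - D' = (C' - D') * C * (C' - D') + D' * (D - C) * D'"
    unfolding e1 e2 assms by simp
  also have "psd_op \<dots>"
    using assms by (intro psd_plus psd_sandwich') auto
  finally show ?thesis .
qed

theorem Loewner_Heinz:
  assumes d: "fits d A" "fits d B" and A: "psd_op A" and le: "psd_op (B - A)" and s: "0 < s" "s \<le> 1"
  shows "psd_op (pw d B s - pw d A s)"
proof (cases "s = 1")
  case True
  then show ?thesis using assms psd_trans_le[OF A le] by (simp add: pw_one)
next
  case False
  then have s: "0 < s" "s < 1" using s by auto
  have B: "psd_op B" using psd_trans_le[OF A le] .
  obtain U x where U: "unitary d U" "A = sp d U x" "\<And>i. 0 \<le> x i" using spectral_psd d A by blast
  obtain V y where V: "unitary d V" "B = sp d V y" "\<And>i. 0 \<le> y i" using spectral_psd d B by blast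
  have res: "psd_op (sp d U (\<lambda>i. 1 / (x i + t)) - sp d V (\<lambda>i. 1 / (y i + t)))" if t: "0 < t" for t
  proof -
    have t': "z + t \<noteq> 0" if "0 \<le> z" for z using t that by linarith
    have C: "sp d U (\<lambda>i. x i + t) = A + t *\<^sub>R idm d"
      using sp_plus[of d U x "\<lambda>_. t"] sp_scaleR[of t d U "\<lambda>_. 1"] by (simp add: U sp_1)
    have D: "sp d V (\<lambda>i. y i + t) = B + t *\<^sub>R idm d"
      using sp_plus[of d V y "\<lambda>_. t"] sp_scaleR[of t d V "\<lambda>_. 1"] by (simp add: V sp_1)
    show ?thesis
    proof (rule psd_inverse_antimono[where E = "idm d" and C = "sp d U (\<lambda>i. x i + t)" and D = "sp d V (\<lambda>i. y i + t)"])
      show "psd_op (sp d U (\<lambda>i. x i + t))" using U t by (intro psd_sp) (auto intro: add_nonneg_nonneg)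
      show "psd_op (sp d V (\<lambda>i. y i + t) - sp d U (\<lambda>i. x i + t))" unfolding C D using le by simp
    qed (use U V t' fits_sp[OF U(1)] fits_sp[OF V(1)] in \<open>simp_all add: sp_mult sp_1\<close>)
  qed
  show ?thesis
    unfolding psd_op_def
  proof (intro conjI allI)
    have h: "adj A = A" "adj B = B" using A B psd_adj by auto
    show "adj (pw d B s - pw d A s) = pw d B s - pw d A s" using d h by (simp add: adj_pw)
    fix X j
    have "(\<Sum>i<d. wt U X i j * x i powr s) \<le> (\<Sum>i<d. wt V X i j * y i powr s)"
    proof (rule Loewner_Heinz_scalar[OF s])
      fix t :: real assume t: "0 < t"
      \<comment> \<open>Since z/(z+t) = 1 - t/(z+t), the transforms increase as the resolvents
        decrease.\<close>
      have eq: "(\<Sum>i<d. w i * (z i / (z i + t))) = (\<Sum>i<d. w i * 1) - t * (\<Sum>i<d. w i * (1 / (z i + t)))"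
        if "\<And>i. 0 \<le> z i" for w z :: "nat \<Rightarrow> real"
      proof -
        have "z i / (z i + t) = 1 - t * (1 / (z i + t))" for i
          using t that[of i] by (simp add: field_simps)
        then show ?thesis by (simp add: right_diff_distrib sum_subtractf sum_distrib_left mult_ac)
      qed
      have one: "(\<Sum>i<d. wt U X i j * 1) = (\<Sum>i<d. wt V X i j * 1)"
        using qf_sp[OF U(1), of "\<lambda>_. 1" X j] qf_sp[OF V(1), of "\<lambda>_. 1" X j] U V by (simp add: sp_1)
      have "t * (\<Sum>i<d. wt V X i j * (1 / (y i + t))) \<le> t * (\<Sum>i<d. wt U X i j * (1 / (x i + t)))"
        using qf_mono[OF res[OF t], of X j] t by (simp add: qf_sp U V)
      then show "(\<Sum>i<d. wt U X i j * (x i / (x i + t))) \<le> (\<Sum>i<d. wt V X i j * (y i / (y i + t)))"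
        unfolding eq[of x, OF U(3)] eq[of y, OF V(3)] one by simp
    qed (use U V in auto)
    then have "0 \<le> qf (pw d B s - pw d A s) X j"
      using U V by (simp add: qf_minus pw_sp qf_sp)
    then show "0 \<le> Re (ent (adj X * (pw d B s - pw d A s) * X) j j)" by (simp add: qf_def)
  qed
qed

section \<open>The trace inside the sandwiched divergence and its dependence on the second
  state\<close>

definition Qren :: "nat \<Rightarrow> real \<Rightarrow> cmat \<Rightarrow> cmat \<Rightarrow> real" where
  "Qren d a \<rho> \<sigma> = trp d (pw d \<sigma> ((1 - a) / (2 * a)) * \<rho> * pw d \<sigma> ((1 - a) / (2 * a))) a"

lemma Qren_nonneg:
  assumes "fits d \<rho>" "psd_op \<rho>" "fits d \<sigma>" "psd_op \<sigma>"
  shows "0 \<le> Qren d a \<rho> \<sigma>"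
proof -
  have "adj \<sigma> = \<sigma>" using assms psd_adj by blast
  then have T: "fits d (pw d \<sigma> p)" "adj (pw d \<sigma> p) = pw d \<sigma> p" for p
    using assms fits_pw adj_pw by auto
  show ?thesis
    unfolding Qren_def
    by (rule trp_nonneg[OF _ psd_adj[OF psd_sandwich'[OF assms(2) T(2)]]]) (use assms T in auto)
qed

text \<open>Exchanging the factors of a Gram matrix leaves a single power of \<sigma> in the middle,
  so that an operator inequality between powers carries over to \<open>Qren\<close>.\<close>

lemma Qren_eq_sandwich_left:
  assumes "fits d \<rho>" "adj \<sigma> = \<sigma>" "fits d \<sigma>" "fits d K" "adj K = K" "\<rho> = K * K"
  shows "Qren d a \<rho> \<sigma> = trp d (K * pw d \<sigma> ((1 - a) / a) * K) a"
proof -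
  let ?T = "pw d \<sigma> ((1 - a) / (2 * a))"
  have T: "fits d ?T" "adj ?T = ?T" using assms fits_pw adj_pw by auto
  have TT: "?T * ?T = pw d \<sigma> ((1 - a) / a)" using assms by (simp add: pw_mult)
  have "Qren d a \<rho> \<sigma> = trp d (adj (K * ?T) * (K * ?T)) a"
    unfolding Qren_def using T assms(5) unfolding assms(6) by (simp add: mult.assoc)
  also have "\<dots> = trp d ((K * ?T) * adj (K * ?T)) a"
    using T assms by (intro trp_gram_commute) auto
  also have "(K * ?T) * adj (K * ?T) = K * (?T * ?T) * K"
    using T assms(5) by (simp add: mult.assoc)
  finally show ?thesis by (simp only: TT)
qed

text \<open>The exponent (1-a)/a lies in (0,1] exactly because 1/2 \<le> a < 1, the range of the
  Loewner-Heinz inequality.\<close>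

lemma Qren_mono_lt:
  assumes d: "fits d \<rho>" "fits d \<sigma>" "fits d \<omega>" and p: "psd_op \<rho>" "psd_op \<omega>" and le: "psd_op (\<sigma> - \<omega>)"
    and a: "1 / 2 \<le> a" "a < 1"
  shows "Qren d a \<rho> \<omega> \<le> Qren d a \<rho> \<sigma>"
proof -
  obtain K where K: "fits d K" "adj K = K" "\<rho> = K * K" using ex_gram[OF d(1) p(1)] by metis
  have s: "psd_op \<sigma>" using psd_trans_le[OF p(2) le] .
  have h: "adj \<sigma> = \<sigma>" "adj \<omega> = \<omega>" using s p psd_adj by auto
  have a': "0 < (1 - a) / a" "(1 - a) / a \<le> 1" using a by (auto simp: field_simps)
  have "trp d (K * pw d \<omega> ((1 - a) / a) * K) a \<le> trp d (K * pw d \<sigma> ((1 - a) / a) * K) a"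
  proof (rule trp_mono)
    have eq: "K * pw d \<sigma> ((1 - a) / a) * K - K * pw d \<omega> ((1 - a) / a) * K
        = K * (pw d \<sigma> ((1 - a) / a) - pw d \<omega> ((1 - a) / a)) * K"
      by (simp add: algebra_simps)
    show "psd_op (K * pw d \<sigma> ((1 - a) / a) * K - K * pw d \<omega> ((1 - a) / a) * K)"
      unfolding eq by (intro psd_sandwich' Loewner_Heinz d p le a' K)
  qed (use d h a K in \<open>auto intro!: psd_sandwich' psd_pw\<close>)
  then show ?thesis
    using Qren_eq_sandwich_left[OF d(1) h(1) d(2) K] Qren_eq_sandwich_left[OF d(1) h(2) d(3) K] by simp
qed

text \<open>The exponent (1-a)/a is now -r with 0 < r < 1. The inverses of the r-th powers live on
  supports that may differ, so the completed square of \<open>psd_inverse_antimono\<close> is formed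
  only between two copies of \<open>K\<close>, which the support of \<omega> absorbs.\<close>

lemma Qren_antimono_gt:
  assumes d: "fits d \<rho>" "fits d \<sigma>" "fits d \<omega>" and p: "psd_op \<rho>" "psd_op \<omega>" and le: "psd_op (\<sigma> - \<omega>)"
    and a: "1 < a" and supp: "\<rho> * pw d \<omega> 0 = \<rho>"
  shows "Qren d a \<rho> \<sigma> \<le> Qren d a \<rho> \<omega>"
proof -
  obtain K where K: "fits d K" "adj K = K" "\<rho> = K * K" using ex_gram[OF d(1) p(1)] by metis
  have s: "psd_op \<sigma>" using psd_trans_le[OF p(2) le] .
  have h: "adj \<sigma> = \<sigma>" "adj \<omega> = \<omega>" using s p psd_adj by auto
  define r where "r = (a - 1) / a"
  have r: "0 < r" "r \<le> 1" "(1 - a) / a = - r" using a by (auto simp: r_def field_simps)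
  let ?P = "pw d \<omega> 0"
  have P: "fits d ?P" "adj ?P = ?P" using d h fits_pw adj_pw by auto
  \<comment> \<open>The support condition on \<rho> passes to its square root because the Gram
    matrix of \<open>K - K * ?P\<close> vanishes.\<close>
  have KP: "K * ?P = K"
  proof -
    have "adj (K - K * ?P) * (K - K * ?P) = (K * K - K * K * ?P) - (?P * (K * K) - ?P * (K * K * ?P))"
      using K P by (simp add: algebra_simps)
    also have "\<dots> = 0" by (simp only: K(3)[symmetric] supp) simp
    finally show ?thesis unfolding gram_eq_0_iff by simp
  qed
  have PK: "?P * K = K" using arg_cong[OF KP, of adj] K P by simp
  define C D C' D' where "C = pw d \<omega> r" and "D = pw d \<sigma> r" and "C' = pw d \<omega> (- r)" and "D' = pw d \<sigma> (- r)"
  have CD: "psd_op (D - C)" unfolding C_def D_def by (intro Loewner_Heinz d p le r)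
  have C: "psd_op C" unfolding C_def using d h by (intro psd_pw)
  have adjs: "adj C' = C'" "adj D' = D'" unfolding C'_def D'_def using d h adj_pw by auto
  have CC: "C * C' = ?P" "C' * C = ?P" "C' * ?P = C'" unfolding C_def C'_def using pw_mult[OF d(3) h(2)] by simp_all
  have DD: "D' * D * D' = D'" unfolding D_def D'_def using pw_mult[OF d(2) h(1)] by simp
  have "psd_op (K * (C' - D') * K)"
  proof -
    have "K * (C' - D') * C * (C' - D') * K
        = K * C' * ?P * K - (K * ?P) * D' * K - K * D' * (?P * K) + K * D' * C * D' * K"
    proof -
      have "K * (C' - D') * C * (C' - D') * K
        = K * C' * (C * C') * K - K * (C' * C) * D' * K - K * D' * (C * C') * K + K * D' * C * D' * K"
        by (simp add: algebra_simps)
      then show ?thesis unfolding CC by (simp only: mult.assoc)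
    qed
    moreover have "K * D' * (D - C) * D' * K = K * (D' * D * D') * K - K * D' * C * D' * K"
      by (simp add: algebra_simps)
    moreover have "K * C' * ?P * K = K * C' * K" using PK by (simp add: mult.assoc)
    ultimately have "K * (C' - D') * K = K * (C' - D') * C * (C' - D') * K + K * D' * (D - C) * D' * K"
      unfolding KP PK DD by (simp add: algebra_simps)
    also have "\<dots> = adj ((C' - D') * K) * C * ((C' - D') * K) + adj (D' * K) * (D - C) * (D' * K)"
      using adjs K by (simp add: mult.assoc)
    also have "psd_op \<dots>" using C CD by blast
    finally show ?thesis .
  qed
  moreover have "K * (C' - D') * K = K * C' * K - K * D' * K" by (simp add: algebra_simps)
  ultimately have "trp d (K * D' * K) a \<le> trp d (K * C' * K) a"
    using d h a K unfolding C'_def D'_def by (intro trp_mono) (auto intro!: psd_sandwich' psd_pw)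
  then show ?thesis
    using Qren_eq_sandwich_left[OF d(1) h(1) d(2) K] Qren_eq_sandwich_left[OF d(1) h(2) d(3) K]
    by (simp add: r(3) C'_def D'_def)
qed

section \<open>Partial traces and absolute continuity\<close>

lemma sum_lessThan_mult:
  fixes f :: "nat \<Rightarrow> 'a::comm_monoid_add"
  shows "(\<Sum>m<d * b. f m) = (\<Sum>i<d. \<Sum>j<b. f (i * b + j))"
proof (induction d)
  case (Suc d)
  have "(\<Sum>m<n + b. f m) = (\<Sum>m<n. f m) + (\<Sum>j<b. f (n + j))" for n
    by (induction b) (auto simp: add.assoc)
  from this[of "d * b"] Suc show ?case by (simp add: add.commute)
qed simp

text \<open>The tensor product with the identity of size \<open>b\<close>, in the index convention
  of \<open>partial_trace\<close>. For \<open>b = 0\<close>, division by zero would repeat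
  \<open>f 0 0\<close> along an infinite diagonal, hence the guard.\<close>

lift_definition ampl :: "nat \<Rightarrow> cmat \<Rightarrow> cmat" is
  "\<lambda>b f k l. if 0 < b \<and> k mod b = l mod b then f (k div b) (l div b) else 0"
proof -
  fix b and f :: "nat \<Rightarrow> nat \<Rightarrow> complex"
  assume "\<exists>d. \<forall>i j. d \<le> i \<or> d \<le> j \<longrightarrow> f i j = 0"
  then obtain d where d: "\<forall>i j. d \<le> i \<or> d \<le> j \<longrightarrow> f i j = 0" by blast
  have "d \<le> k div b" if "d * b \<le> k" "0 < b" for k
    using that by (simp add: less_eq_div_iff_mult_less_eq)
  then show "\<exists>d. \<forall>k l. d \<le> k \<or> d \<le> l \<longrightarrow> (if 0 < b \<and> k mod b = l mod b then f (k div b) (l div b) else 0) = 0"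
    using d by (intro exI[of _ "d * b"]) auto
qed

lift_definition ptr :: "nat \<Rightarrow> cmat \<Rightarrow> cmat" is
  "\<lambda>b f i i'. \<Sum>j<b. f (i * b + j) (i' * b + j)"
proof -
  fix b and f :: "nat \<Rightarrow> nat \<Rightarrow> complex"
  assume "\<exists>d. \<forall>i j. d \<le> i \<or> d \<le> j \<longrightarrow> f i j = 0"
  then obtain d where d: "\<forall>i j. d \<le> i \<or> d \<le> j \<longrightarrow> f i j = 0" by blast
  have "d \<le> k * b + j" if "d \<le> k" "j < b" for k j
  proof -
    have "k \<le> k * b" using that by (cases b) auto
    then show ?thesis using that by linarith
  qed
  then show "\<exists>d. \<forall>i i'. d \<le> i \<or> d \<le> i' \<longrightarrow> (\<Sum>j<b. f (i * b + j) (i' * b + j)) = 0"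
    using d by (intro exI[of _ d] allI impI sum.neutral) auto
qed

lemma ent_ampl: "ent (ampl b A) k l = (if 0 < b \<and> k mod b = l mod b then ent A (k div b) (l div b) else 0)"
  by transfer simp

lemma ent_ptr: "ent (ptr b M) i i' = (\<Sum>j<b. ent M (i * b + j) (i' * b + j))"
  by transfer simp

lemma fits_ampl [intro]: "fits d A \<Longrightarrow> fits (d * b) (ampl b A)"
  unfolding fits_def by (auto simp: ent_ampl less_eq_div_iff_mult_less_eq)

lemma fits_ptr [intro]: "fits (d * b) M \<Longrightarrow> fits d (ptr b M)"
  unfolding fits_def by (auto simp: ent_ptr intro!: sum.neutral) (meson mult_le_mono1 trans_le_add1)+

lemma ampl_adj: "adj (ampl b A) = ampl b (adj A)"
  by (rule cmat_eqI) (auto simp: ent_ampl)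

lemma ampl_plus: "ampl b (A + B) = ampl b A + ampl b B"
  and ampl_minus: "ampl b (A - B) = ampl b A - ampl b B"
  and ampl_scaleR: "ampl b (c *\<^sub>R A) = c *\<^sub>R ampl b A"
  and ampl_0: "ampl b 0 = 0"
  by (rule cmat_eqI; simp add: ent_ampl)+

lemma ampl_sum: "ampl b (sum f S) = (\<Sum>x\<in>S. ampl b (f x))"
  by (induction S rule: infinite_finite_induct) (auto simp: ampl_plus ampl_0)

lemma ptr_plus: "ptr b (A + B) = ptr b A + ptr b B"
  and ptr_minus: "ptr b (A - B) = ptr b A - ptr b B"
  and ptr_scaleR: "ptr b (c *\<^sub>R A) = c *\<^sub>R ptr b A"
  and ptr_adj: "adj (ptr b A) = ptr b (adj A)"
  by (rule cmat_eqI; simp add: ent_ptr sum.distrib sum_subtractf sum_distrib_left cnj_sum)+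

lemma ptr_0: "ptr b 0 = 0"
  by (rule cmat_eqI) (simp add: ent_ptr)

lemma ptr_sum: "ptr b (sum f S) = (\<Sum>x\<in>S. ptr b (f x))"
  by (induction S rule: infinite_finite_induct) (auto simp: ptr_plus ptr_0)

lemma ent_ampl_mult:
  assumes b: "0 < b" and A: "fits d A"
  shows "ent (ampl b A * M) k l = (\<Sum>i<d. ent A (k div b) i * ent M (i * b + k mod b) l)"
proof -
  have "ent (ampl b A * M) k l = (\<Sum>i<d. \<Sum>j<b. ent (ampl b A) k (i * b + j) * ent M (i * b + j) l)"
    by (simp add: ent_mult_l[OF fits_ampl[OF A]] sum_lessThan_mult)
  also have "\<dots> = (\<Sum>i<d. \<Sum>j<b. if j = k mod b then ent A (k div b) i * ent M (i * b + j) l else 0)"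
    using b by (intro sum.cong) (auto simp: ent_ampl)
  also have "\<dots> = (\<Sum>i<d. ent A (k div b) i * ent M (i * b + k mod b) l)"
    using b by simp
  finally show ?thesis .
qed

lemma ampl_mult: "0 < b \<Longrightarrow> ampl b (A * B) = ampl b A * ampl b B"
proof -
  assume b: "0 < b"
  obtain d where d: "fits d A" "fits d B" using ex_dim2 by blast
  show ?thesis
    by (rule cmat_eqI) (use b in \<open>auto simp: ent_ampl_mult[OF b d(1)] ent_ampl ent_mult_l[OF d(1)]\<close>)
qed

lemma ptr_ampl_mult: "0 < b \<Longrightarrow> ptr b (ampl b A * M) = A * ptr b M"
proof -
  assume b: "0 < b"
  obtain d where d: "fits d A" using ex_dim by blast
  show ?thesis
  proof (rule cmat_eqI)
    fix i i'
    have "ent (ptr b (ampl b A * M)) i i' = (\<Sum>j<b. \<Sum>k<d. ent A i k * ent M (k * b + j) (i' * b + j))"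
      using b by (simp add: ent_ptr ent_ampl_mult[OF b d])
    also have "\<dots> = (\<Sum>k<d. \<Sum>j<b. ent A i k * ent M (k * b + j) (i' * b + j))"
      by (rule sum.swap)
    also have "\<dots> = ent (A * ptr b M) i i'"
      by (simp add: ent_mult_l[OF d] ent_ptr sum_distrib_left)
    finally show "ent (ptr b (ampl b A * M)) i i' = ent (A * ptr b M) i i'" .
  qed
qed

lemma ptr_mult_ampl: "0 < b \<Longrightarrow> ptr b (M * ampl b A) = ptr b M * A"
  using arg_cong[OF ptr_ampl_mult[of b "adj A" "adj M"], of adj] by (simp add: ptr_adj ampl_adj)

lemma tr_ptr: "tr (ptr b M) = tr M" if "fits (d * b) M"
  by (simp add: tr_eq[OF that] tr_eq[OF fits_ptr[OF that]] sum_lessThan_mult ent_ptr)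

lemma tr_ampl_mult: "0 < b \<Longrightarrow> fits d A \<Longrightarrow> fits (d * b) M \<Longrightarrow> tr (ampl b A * M) = tr (A * ptr b M)"
  by (metis ptr_ampl_mult tr_ptr fits_ampl fits_mult)

lemma ptr_ampl: "0 < b \<Longrightarrow> ptr b (ampl b A) = real b *\<^sub>R A"
  by (rule cmat_eqI) (simp add: ent_ptr ent_ampl)

lemma ampl_dg: "ampl b (dg d l) = dg (d * b) (\<lambda>k. l (k div b))" if "0 < b"
proof (rule cmat_eqI)
  fix k j
  have "k div b = j div b \<and> k mod b = j mod b \<longleftrightarrow> k = j" by (metis div_mult_mod_eq)
  moreover have "k div b < d \<longleftrightarrow> k < d * b" using that by (simp add: div_less_iff_less_mult)
  ultimately show "ent (ampl b (dg d l)) k j = ent (dg (d * b) (\<lambda>k. l (k div b))) k j"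
    using that by (auto simp: ent_ampl ent_dg)
qed

lemma unitary_ampl: "0 < b \<Longrightarrow> unitary d U \<Longrightarrow> unitary (d * b) (ampl b U)"
  unfolding unitary_def by (auto simp: ampl_adj simp flip: ampl_mult) (auto simp: ampl_dg)

lemma ampl_sp: "0 < b \<Longrightarrow> ampl b (sp d U l) = sp (d * b) (ampl b U) (\<lambda>k. l (k div b))"
  by (simp add: sp_def ampl_mult ampl_dg ampl_adj)

lemma psd_ampl: "0 < b \<Longrightarrow> fits d A \<Longrightarrow> psd_op A \<Longrightarrow> psd_op (ampl b A)"
  by (metis ex_gram ampl_adj ampl_mult psdI_gram)

lemma psd_ptr: "0 < b \<Longrightarrow> psd_op M \<Longrightarrow> psd_op (ptr b M)"
proof -
  assume b: "0 < b" and M: "psd_op M"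
  have "0 \<le> Re (ent (adj V * ptr b M * V) j j)" for V j
  proof -
    have "adj V * ptr b M * V = ptr b (adj (ampl b V) * M * ampl b V)"
      using b by (simp add: ptr_mult_ampl ptr_ampl_mult ampl_adj)
    moreover have "psd_op (adj (ampl b V) * M * ampl b V)" using M by blast
    ultimately show ?thesis by (simp add: ent_ptr Re_sum sum_nonneg psd_diag)
  qed
  then show ?thesis using M unfolding psd_op_def by (simp add: ptr_adj)
qed

lemma resol_ampl: "0 < b \<Longrightarrow> resol d S P \<Longrightarrow> resol (d * b) S (\<lambda>k. ampl b (P k))"
  unfolding resol_def proj_def
  by (auto simp: ampl_adj simp flip: ampl_mult ampl_sum) (simp add: ampl_0, simp add: ampl_dg)

lemma ptr_pinch_ampl: "0 < b \<Longrightarrow> ptr b (pinch S (\<lambda>k. ampl b (P k)) M) = pinch S P (ptr b M)"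
  by (simp add: pinch_def ptr_sum ptr_mult_ampl ptr_ampl_mult)

text \<open>The basis is grouped by labels \<kappa>: below, eigenvalues of \<sigma> or bins. Labels
  in \<open>S\<close> that do not occur give zero projections, which \<open>resol\<close>
  admits.\<close>

lemma resol_sp:
  assumes U: "unitary d U" and S: "finite S" "\<And>i. i < d \<Longrightarrow> \<kappa> i \<in> S"
  shows "resol d S (\<lambda>k. sp d U (\<lambda>i. if \<kappa> i = k then 1 else 0))"
proof -
  have z: "sp d U (\<lambda>i. (if \<kappa> i = k then 1 else 0) * (if \<kappa> i = l then 1 else 0)) = 0" if "k \<noteq> l" for k l
    using sp_cong[of d "\<lambda>i. (if \<kappa> i = k then 1 else 0) * (if \<kappa> i = l then 1 else 0)" "\<lambda>_. 0" U] that
    by (auto simp: sp_0)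
  have "(\<Sum>k\<in>S. sp d U (\<lambda>i. if \<kappa> i = k then 1 else 0)) = sp d U (\<lambda>i. \<Sum>k\<in>S. if \<kappa> i = k then 1 else 0)"
    by (rule sp_sum)
  also have "\<dots> = sp d U (\<lambda>_. 1)"
    using S by (intro sp_cong) (simp add: sum.delta')
  finally have "(\<Sum>k\<in>S. sp d U (\<lambda>i. if \<kappa> i = k then 1 else 0)) = idm d" using U by (simp add: sp_1)
  then show ?thesis
    using U S z by (auto simp: resol_def proj_def sp_mult intro!: sp_cong)
qed

lemma sp_inj: "unitary d U \<Longrightarrow> sp d U l = sp d U m \<Longrightarrow> i < d \<Longrightarrow> l i = m i"
  by (metis ent_uni_conj_sp of_real_eq_iff)

text \<open>The indicator function of the first list of eigenvalues turns the matrix into the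
  identity, hence takes the value 1 on the second list.\<close>

lemma sp_values:
  assumes "unitary d U" "unitary d V" "sp d U l = sp d V m" "i < d"
  shows "m i \<in> l ` {..<d}"
proof -
  let ?f = "\<lambda>x. if x \<in> l ` {..<d} then 1 else 0 :: real"
  have "sp d V (\<lambda>i. ?f (m i)) = sp d U (\<lambda>i. ?f (l i))"
    by (rule sp_fun_cong[OF assms(1,2,3), symmetric])
  also have "\<dots> = sp d U (\<lambda>_. 1)" by (rule sp_cong) simp
  also have "\<dots> = sp d V (\<lambda>_. 1)" using assms by (simp add: sp_1)
  finally have "?f (m i) = 1" using sp_inj[OF assms(2)] assms(4) by blast
  then show ?thesis by (auto split: if_splits)
qed

lemma qf_mult_dg:
  assumes "i < d"
  shows "qf M (V * dg d (\<lambda>i. complex_of_real (c i))) i = (c i)\<^sup>2 * qf M V i"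
proof -
  have "adj (V * dg d (\<lambda>i. complex_of_real (c i))) * M * (V * dg d (\<lambda>i. complex_of_real (c i)))
     = dg d (\<lambda>i. complex_of_real (c i)) * (adj V * M * V) * dg d (\<lambda>i. complex_of_real (c i))"
    by (simp add: mult.assoc adj_dg)
  then show ?thesis
    using assms by (simp add: qf_def ent_mult_dg ent_dg_mult power2_eq_square)
qed

lemma qf_sandwich_sp:
  assumes "unitary d V" "i < d"
  shows "qf (sp d V c * M * sp d V c) V i = (c i)\<^sup>2 * qf M V i"
proof -
  have "sp d V c * V = V * dg d (\<lambda>i. complex_of_real (c i))"
    using assms by (simp add: sp_def mult.assoc unitary_simps)
  then show ?thesis
    using qf_mult[of M "sp d V c" V i] qf_mult_dg[OF assms(2), of M V c] by simp
qed

text \<open>For hermitian matrices this is the inclusion of the supports.\<close>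

definition abs_cont :: "cmat \<Rightarrow> cmat \<Rightarrow> bool" where
  "abs_cont \<rho> \<sigma> \<longleftrightarrow> (\<forall>V. \<sigma> * V = 0 \<longrightarrow> \<rho> * V = 0)"

lemma psd_sandwich_eq_0: "fits d M \<Longrightarrow> psd_op M \<Longrightarrow> adj V * M * V = 0 \<Longrightarrow> M * V = 0"
proof -
  assume "fits d M" "psd_op M" and 0: "adj V * M * V = 0"
  then obtain K where K: "M = adj K * K" using ex_gram by blast
  then have "adj (K * V) * (K * V) = 0" using 0 by (simp add: mult.assoc)
  then have "K * V = 0" by (simp only: gram_eq_0_iff)
  then show ?thesis by (simp add: K mult.assoc)
qed

lemma psd_antisym: "fits d M \<Longrightarrow> psd_op M \<Longrightarrow> psd_op (- M) \<Longrightarrow> M = 0"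
proof -
  assume M: "fits d M" "psd_op M" "psd_op (- M)"
  then obtain U l where U: "unitary d U" "M = sp d U l" "\<And>i. 0 \<le> l i" using spectral_psd by blast
  have "- M = sp d U (\<lambda>i. - l i)" using sp_scaleR[of "-1" d U l] U by simp
  then have "\<forall>i<d. 0 \<le> - l i" using M psd_sp_iff[OF U(1)] by metis
  then have "sp d U l = sp d U (\<lambda>_. 0)" using U(3) by (intro sp_cong) (auto intro: antisym)
  then show ?thesis using U by (simp add: sp_0)
qed

lemma abs_cont_le:
  assumes "psd_op \<rho>" "psd_op (c *\<^sub>R \<sigma> - \<rho>)" "fits d \<rho>"
  shows "abs_cont \<rho> \<sigma>"
  unfolding abs_cont_def
proof (intro allI impI)
  fix V assume 0: "\<sigma> * V = 0"
  have "adj V * (c *\<^sub>R \<sigma> - \<rho>) * V = - (adj V * \<rho> * V)"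
    using 0 by (simp add: algebra_simps)
  then have "psd_op (- (adj V * \<rho> * V))" using assms(2) psd_sandwich by metis
  moreover have "psd_op (adj V * \<rho> * V)" using assms(1) by blast
  ultimately have "adj V * \<rho> * V = 0" using psd_antisym ex_dim by blast
  then show "\<rho> * V = 0" using psd_sandwich_eq_0 assms by blast
qed

lemma abs_cont_supp:
  assumes "fits d \<sigma>" "psd_op \<sigma>" "fits d \<rho>"
  shows "abs_cont \<rho> \<sigma> \<longleftrightarrow> \<rho> * pw d \<sigma> 0 = \<rho>"
proof -
  have h: "adj \<sigma> = \<sigma>" using assms psd_adj by blast
  have 1: "pw d \<sigma> 0 = pw d \<sigma> (- 1) * \<sigma>" "\<sigma> = \<sigma> * pw d \<sigma> 0"
  proof -
    have "pw d \<sigma> (- 1) * pw d \<sigma> 1 = pw d \<sigma> 0" "pw d \<sigma> 1 * pw d \<sigma> 0 = pw d \<sigma> 1"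
      using assms h by (simp_all add: pw_mult)
    then show "pw d \<sigma> 0 = pw d \<sigma> (- 1) * \<sigma>" "\<sigma> = \<sigma> * pw d \<sigma> 0" using assms by (simp_all add: pw_one)
  qed
  show ?thesis
  proof
    assume a: "abs_cont \<rho> \<sigma>"
    have "\<sigma> * (idm d - pw d \<sigma> 0) = 0" using assms 1(2) by (simp add: right_diff_distrib)
    then have "\<rho> * (idm d - pw d \<sigma> 0) = 0" using a by (simp add: abs_cont_def)
    then show "\<rho> * pw d \<sigma> 0 = \<rho>" using assms by (simp add: right_diff_distrib)
  next
    assume a: "\<rho> * pw d \<sigma> 0 = \<rho>"
    show "abs_cont \<rho> \<sigma>"
      unfolding abs_cont_def
    proof (intro allI impI)
      fix V assume 0: "\<sigma> * V = 0"
      have "\<rho> * V = \<rho> * pw d \<sigma> (- 1) * (\<sigma> * V)"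
        by (subst a[symmetric]) (simp only: 1(1) mult.assoc)
      then show "\<rho> * V = 0" using 0 by simp
    qed
  qed
qed

lemma abs_cont_trans: "abs_cont \<rho> \<sigma> \<Longrightarrow> abs_cont \<sigma> \<tau> \<Longrightarrow> abs_cont \<rho> \<tau>"
  by (auto simp: abs_cont_def)

text \<open>If the marginal of \<sigma> annihilates V, then \<sigma>, compressed by the
  amplification of V, is positive of trace 0. So \<sigma> and therefore \<rho> annihilate that
  amplification.\<close>

lemma abs_cont_ptr:
  assumes b: "0 < b" and d: "fits (d * b) \<rho>" "fits (d * b) \<sigma>" and p: "psd_op \<rho>" "psd_op \<sigma>" and ac: "abs_cont \<rho> \<sigma>"
  shows "abs_cont (ptr b \<rho>) (ptr b \<sigma>)"
  unfolding abs_cont_def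
proof (intro allI impI)
  fix V assume 0: "ptr b \<sigma> * V = 0"
  let ?W = "ampl b V"
  obtain e where e: "fits e V" using ex_dim by blast
  define D where "D = max d e"
  have W: "fits (D * b) ?W" "fits (D * b) \<sigma>"
    using fits_ampl[OF fits_mono[OF e, of D]] fits_mono[OF d(2), of "D * b"] by (auto simp: D_def)
  have "tr (adj ?W * \<sigma> * ?W) = tr (ptr b (adj ?W * \<sigma> * ?W))"
    using W by (intro tr_ptr[symmetric, of D]) auto
  also have "ptr b (adj ?W * \<sigma> * ?W) = adj V * (ptr b \<sigma> * V)"
    using b by (simp add: ptr_mult_ampl ptr_ampl_mult ampl_adj mult.assoc)
  finally have "tr (adj ?W * \<sigma> * ?W) = 0" by (simp add: 0)
  moreover have "fits (D * b) (adj ?W * \<sigma> * ?W)" "psd_op (adj ?W * \<sigma> * ?W)" using W p by auto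
  ultimately have "adj ?W * \<sigma> * ?W = 0"
  proof -
    assume t: "tr (adj ?W * \<sigma> * ?W) = 0" and M: "fits (D * b) (adj ?W * \<sigma> * ?W)" "psd_op (adj ?W * \<sigma> * ?W)"
    obtain U l where U: "unitary (D * b) U" "adj ?W * \<sigma> * ?W = sp (D * b) U l" "\<And>i. 0 \<le> l i"
      using spectral_psd[OF M] by blast
    have "(\<Sum>i<D * b. l i) = 0" using t U by (simp add: tr_sp del: of_real_sum)
    then have "sp (D * b) U l = sp (D * b) U (\<lambda>_. 0)" using U(3) by (intro sp_cong) (simp add: sum_nonneg_eq_0_iff)
    then show ?thesis using U by (simp add: sp_0)
  qed
  then have "\<sigma> * ?W = 0" using psd_sandwich_eq_0 d p by blast
  then have "\<rho> * ?W = 0" using ac by (simp add: abs_cont_def)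
  then have "ptr b (\<rho> * ?W) = 0" by (simp add: ptr_0)
  then show "ptr b \<rho> * V = 0" using b by (simp add: ptr_mult_ampl)
qed

text \<open>With P the support projection of \<sigma>: \<rho> is at most its trace times P, and P is
  at most a multiple of \<sigma>, the smallest positive eigenvalue being bounded away from
  0.\<close>

lemma abs_cont_bound:
  assumes d: "fits d \<rho>" "fits d \<sigma>" and p: "psd_op \<rho>" "psd_op \<sigma>" and ac: "abs_cont \<rho> \<sigma>"
  shows "\<exists>C::nat. psd_op (2 ^ C *\<^sub>R \<sigma> - \<rho>)"
proof -
  obtain R r where R: "unitary d R" "\<rho> = sp d R r" "\<And>i. 0 \<le> r i" using spectral_psd d p by blast
  obtain U l where U: "unitary d U" "\<sigma> = sp d U l" "\<And>i. 0 \<le> l i" using spectral_psd d p by blast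
  have h: "adj \<sigma> = \<sigma>" "adj \<rho> = \<rho>" using p psd_adj by auto
  define t where "t = sum r {..<d}"
  \<comment> \<open>The 1 keeps the set nonempty in dimension 0; a zero eigenvalue contributes only
    \<open>t / 0 = 0\<close>.\<close>
  define m where "m = Max (insert 1 ((\<lambda>i. t / l i) ` {..<d}))"
  obtain C :: nat where C: "m < 2 ^ C" using real_arch_pow[of 2 m] by auto
  have lm: "t * l i powr 0 \<le> 2 ^ C * l i" if "i < d" for i
  proof (cases "l i = 0")
    case False
    then have "0 < l i" using U(3)[of i] by simp
    moreover have "t / l i \<le> m" using that unfolding m_def by (intro Max_ge) auto
    ultimately have "t / l i \<le> 2 ^ C" using C by linarith
    then show ?thesis using \<open>0 < l i\<close> by (simp add: pos_divide_le_eq)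
  qed simp
  let ?P = "pw d \<sigma> 0"
  have P: "?P = sp d U (\<lambda>i. l i powr 0)" "adj ?P = ?P" using U d h by (auto simp: pw_sp adj_pw)
  have supp: "\<rho> * ?P = \<rho>" using ac abs_cont_supp[OF d(2) p(2) d(1)] by simp
  have supp': "?P * \<rho> = \<rho>" using arg_cong[OF supp, of adj] P h by simp
  have PP: "?P * ?P = ?P" using pw_mult[OF d(2) h(1), of 0 0] by simp
  have "psd_op (t *\<^sub>R idm d - \<rho>)"
  proof -
    have "t *\<^sub>R idm d - \<rho> = sp d R (\<lambda>i. t - r i)"
      using sp_minus[of d R "\<lambda>_. t" r] sp_scaleR[of t d R "\<lambda>_. 1"] R by (simp add: sp_1)
    moreover have "r i \<le> t" if "i < d" for i
      unfolding t_def using that R(3) by (intro member_le_sum) auto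
    ultimately show ?thesis by (simp add: psd_sp)
  qed
  then have "psd_op (?P * (t *\<^sub>R idm d - \<rho>) * ?P)" using P by (intro psd_sandwich')
  also have "?P * (t *\<^sub>R idm d - \<rho>) * ?P = t *\<^sub>R ?P - \<rho>"
    using d h by (simp add: left_diff_distrib right_diff_distrib PP supp supp' fits_pw)
  finally have "psd_op (t *\<^sub>R ?P - \<rho>)" .
  moreover have "psd_op (2 ^ C *\<^sub>R \<sigma> - t *\<^sub>R ?P)"
  proof -
    have "2 ^ C *\<^sub>R \<sigma> - t *\<^sub>R ?P = sp d U (\<lambda>i. 2 ^ C * l i - t * l i powr 0)"
      unfolding P(1) by (simp only: U(2) sp_scaleR sp_minus)
    then show ?thesis using lm by (simp add: psd_sp)
  qed
  ultimately have "psd_op (2 ^ C *\<^sub>R \<sigma> - t *\<^sub>R ?P + (t *\<^sub>R ?P - \<rho>))" by blast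
  then show ?thesis by auto
qed

section \<open>Dyadic bins of the likelihood ratio\<close>

text \<open>The bin of the ratio \<open>r / s\<close>: the least \<open>k\<close> with \<open>r \<le> 2 ^ (k - L) * s\<close>, and \<open>2 * L + 1\<close> if
  there is no such \<open>k \<le> 2 * L\<close>.\<close>

definition bin_scale :: "nat \<Rightarrow> nat \<Rightarrow> real" where
  "bin_scale L k = 2 powr (real L - real k)"

definition bin :: "nat \<Rightarrow> real \<Rightarrow> real \<Rightarrow> nat" where
  "bin L r s = (LEAST k. k = 2 * L + 1 \<or> bin_scale L k * r \<le> s)"

lemma bin_scale_pos [simp]: "0 < bin_scale L k"
  by (simp add: bin_scale_def)

lemma bin_scale_nonneg [simp]: "0 \<le> bin_scale L k" "bin_scale L k \<noteq> 0"
  using bin_scale_pos[of L k] by linarith+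

lemma bin_le: "bin L r s \<le> 2 * L + 1"
  unfolding bin_def by (rule Least_le) simp

text \<open>With \<open>bin_lower\<close>, every bin except the first and the last confines s
  between c r and 2 c r, where c is its scale. Bin 0 lacks the bound by 2 c r, bin
  \<open>2 * L + 1\<close> the bound by c r.\<close>

lemma bin_upper: "bin L r s \<le> 2 * L \<Longrightarrow> bin_scale L (bin L r s) * r \<le> s"
  unfolding bin_def
  using LeastI[of "\<lambda>k. k = 2 * L + 1 \<or> bin_scale L k * r \<le> s" "2 * L + 1"] by auto

lemma bin_lower: "0 < bin L r s \<Longrightarrow> s \<le> 2 * bin_scale L (bin L r s) * r"
proof -
  assume k: "0 < bin L r s"
  then have "\<not> (bin L r s - 1 = 2 * L + 1 \<or> bin_scale L (bin L r s - 1) * r \<le> s)"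
    using not_less_Least[of "bin L r s - 1" "\<lambda>k. k = 2 * L + 1 \<or> bin_scale L k * r \<le> s"]
    by (simp add: bin_def)
  moreover have "bin_scale L (bin L r s - 1) = 2 * bin_scale L (bin L r s)"
  proof -
    have "bin_scale L (bin L r s - 1) = 2 powr (1 + (real L - real (bin L r s)))"
      using k by (simp add: bin_scale_def of_nat_diff algebra_simps)
    also have "\<dots> = 2 powr 1 * 2 powr (real L - real (bin L r s))" by (rule powr_add)
    finally show ?thesis by (simp add: bin_scale_def)
  qed
  ultimately show ?thesis by simp
qed

lemma bin_le_2L: "r \<le> 2 ^ L * s \<Longrightarrow> bin L r s \<le> 2 * L"
proof -
  assume "r \<le> 2 ^ L * s"
  then have "bin_scale L (2 * L) * r \<le> s"
    by (simp add: bin_scale_def powr_minus powr_realpow field_simps)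
  then show ?thesis unfolding bin_def by (intro Least_le) simp
qed

lemma bin_scale_0: "bin_scale L 0 = 2 powr real L"
  by (simp add: bin_scale_def)

lemma bin_scale_top: "2 * bin_scale L (2 * L + 1) = 2 powr (- real L)"
proof -
  have "2 * bin_scale L (2 * L + 1) = 2 powr 1 * 2 powr (real L - real (2 * L + 1))" by (simp add: bin_scale_def)
  also have "\<dots> = 2 powr (1 + (real L - real (2 * L + 1)))" by (rule powr_add[symmetric])
  finally show ?thesis by simp
qed

text \<open>A reverse Hoelder inequality: within an inner bin r and s are proportional up to a
  factor 2, so merging the bin loses at most 2^(1-a). In the outer bins one total is at most 2^(-L)
  times the other, which gives the error terms.\<close>

lemma bin_mass_lt:
  assumes a: "0 < a" "a < 1" and I: "finite I" and r: "\<And>i. i \<in> I \<Longrightarrow> 0 \<le> r i" and s: "\<And>i. i \<in> I \<Longrightarrow> 0 \<le> s i"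
    and k: "\<And>i. i \<in> I \<Longrightarrow> bin L (r i) (s i) = k"
  shows "sum r I powr a * sum s I powr (1 - a) \<le> 2 powr (1 - a) * (\<Sum>i\<in>I. r i powr a * s i powr (1 - a))
     + 2 powr (- real L * a) * sum s I + 2 powr (- real L * (1 - a)) * sum r I"
proof -
  have p: "0 \<le> sum r I" and q: "0 \<le> sum s I" using r s by (auto intro: sum_nonneg)
  have M: "0 \<le> (\<Sum>i\<in>I. r i powr a * s i powr (1 - a))" by (intro sum_nonneg) auto
  have spl: "x = x powr a * x powr (1 - a)" if "0 \<le> x" for x :: real
    using that by (cases "x = 0") (simp_all flip: powr_add)
  have lower: "sum s I \<le> 2 * bin_scale L k * sum r I" if "0 < k"
    unfolding sum_distrib_left
  proof (rule sum_mono)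
    fix i assume "i \<in> I"
    then show "s i \<le> 2 * bin_scale L k * r i" using bin_lower[of L "r i" "s i"] k that by simp
  qed
  have upper: "bin_scale L k * r i \<le> s i" if "k \<le> 2 * L" "i \<in> I" for i
    using bin_upper[of L "r i" "s i"] k that by auto
  consider "I = {}" | "I \<noteq> {}" "k = 0" | "I \<noteq> {}" "0 < k" "k \<le> 2 * L" | "I \<noteq> {}" "k = 2 * L + 1"
    using bin_le[of L] k by (metis all_not_in_conv gr0I le_SucE Suc_eq_plus1)
  then show ?thesis
  proof cases
    case 1
    then show ?thesis by simp
  next
    case 2
    have "2 powr real L * sum r I \<le> sum s I"
      unfolding sum_distrib_left using upper 2 by (intro sum_mono) (simp add: bin_scale_0)
    then have "sum r I \<le> 2 powr (- real L) * sum s I" by (simp add: powr_minus field_simps)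
    then have "sum r I powr a * sum s I powr (1 - a) \<le> (2 powr (- real L) * sum s I) powr a * sum s I powr (1 - a)"
      using p a by (intro mult_right_mono powr_mono2) auto
    also have "\<dots> = 2 powr (- real L * a) * (sum s I powr a * sum s I powr (1 - a))"
      using q by (simp add: powr_mult powr_powr)
    also have "\<dots> = 2 powr (- real L * a) * sum s I" using spl[OF q] by simp
    finally show ?thesis using M p by (simp add: add_increasing add_increasing2)
  next
    case 3
    let ?c = "bin_scale L k"
    have "sum r I powr a * sum s I powr (1 - a) \<le> sum r I powr a * (2 * ?c * sum r I) powr (1 - a)"
      using lower 3 q a by (intro mult_left_mono powr_mono2) auto
    also have "\<dots> = (2 * ?c) powr (1 - a) * (sum r I powr a * sum r I powr (1 - a))"
      using p by (simp add: powr_mult)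
    also have "\<dots> = (\<Sum>i\<in>I. 2 powr (1 - a) * (?c powr (1 - a) * r i))"
      using spl[OF p] by (simp add: powr_mult sum_distrib_left mult.assoc)
    also have "\<dots> \<le> (\<Sum>i\<in>I. 2 powr (1 - a) * (r i powr a * s i powr (1 - a)))"
    proof (intro sum_mono mult_left_mono)
      fix i assume i: "i \<in> I"
      have "?c powr (1 - a) * r i = r i powr a * (?c * r i) powr (1 - a)"
        using spl[OF r[OF i]] r[OF i] by (simp add: powr_mult mult_ac)
      also have "\<dots> \<le> r i powr a * s i powr (1 - a)"
        using upper[OF 3(3) i] r[OF i] a by (intro mult_left_mono powr_mono2) auto
      finally show "?c powr (1 - a) * r i \<le> r i powr a * s i powr (1 - a)" .
    qed simp
    also have "\<dots> = 2 powr (1 - a) * (\<Sum>i\<in>I. r i powr a * s i powr (1 - a))"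
      by (simp add: sum_distrib_left)
    finally show ?thesis using p q by (simp add: add_increasing2)
  next
    case 4
    then have "sum s I \<le> 2 powr (- real L) * sum r I" using lower bin_scale_top by simp
    then have "sum r I powr a * sum s I powr (1 - a) \<le> sum r I powr a * (2 powr (- real L) * sum r I) powr (1 - a)"
      using q a by (intro mult_left_mono powr_mono2) auto
    also have "\<dots> = 2 powr (- real L * (1 - a)) * (sum r I powr a * sum r I powr (1 - a))"
      using p by (simp add: powr_mult powr_powr)
    also have "\<dots> = 2 powr (- real L * (1 - a)) * sum r I" using spl[OF p] by simp
    finally show ?thesis using M q by (simp add: add_increasing add_increasing2)
  qed
qed

lemma powr_ratio_le_gt:
  fixes a r s c :: real
  assumes a: "1 < a" and r: "0 \<le> r" and s: "0 \<le> s" and c: "0 < c" and le: "c * r \<le> s"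
  shows "r powr a * s powr (1 - a) \<le> c powr (1 - a) * r"
proof (cases "r = 0")
  case False
  then have r: "0 < r" using r by simp
  then have "0 < c * r" using c by simp
  then have "s powr (1 - a) \<le> (c * r) powr (1 - a)"
    using le a by (intro powr_mono2') auto
  then have "r powr a * s powr (1 - a) \<le> r powr a * (c * r) powr (1 - a)" by (intro mult_left_mono) auto
  also have "\<dots> = c powr (1 - a) * (r powr a * r powr (1 - a))" using r c by (simp add: powr_mult)
  also have "r powr a * r powr (1 - a) = r" using r by (simp flip: powr_add)
  finally show ?thesis .
qed simp

text \<open>Write p and q for the totals of r and s. In a bin of scale c > 0 with q \<le> 2 c p, the
  hypothesis on \<open>Q\<close> becomes p^a \<le> Q (2 c p)^(a-1), that is c^(1-a) p \<le> 2^(a-1)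
  Q. In bin 0 this bound on q is missing, but there c = 2^L makes c^(1-a) p itself small.\<close>

lemma bin_mass_gt:
  assumes a: "1 < a" and I: "finite I" and r: "\<And>i. i \<in> I \<Longrightarrow> 0 \<le> r i" and s: "\<And>i. i \<in> I \<Longrightarrow> 0 \<le> s i"
    and k: "\<And>i. i \<in> I \<Longrightarrow> bin L (r i) (s i) = k" "k \<le> 2 * L"
    and Q: "0 \<le> Q" "sum r I \<le> Q powr (1 / a) * sum s I powr (1 - 1 / a)"
  shows "(\<Sum>i\<in>I. r i powr a * s i powr (1 - a)) \<le> 2 powr (a - 1) * Q + 2 powr (- real L * (a - 1)) * sum r I"
proof -
  let ?c = "bin_scale L k"
  have p: "0 \<le> sum r I" and q: "0 \<le> sum s I" using r s by (auto intro: sum_nonneg)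
  have "(\<Sum>i\<in>I. r i powr a * s i powr (1 - a)) \<le> (\<Sum>i\<in>I. ?c powr (1 - a) * r i)"
  proof (intro sum_mono powr_ratio_le_gt a)
    fix i assume i: "i \<in> I"
    show "?c * r i \<le> s i" using k i bin_upper[of L "r i" "s i"] by auto
  qed (use r s in auto)
  also have "\<dots> = ?c powr (1 - a) * sum r I" by (simp add: sum_distrib_left)
  finally have le: "(\<Sum>i\<in>I. r i powr a * s i powr (1 - a)) \<le> ?c powr (1 - a) * sum r I" .
  show ?thesis
  proof (cases "k = 0")
    case True
    then have "?c powr (1 - a) = 2 powr (- real L * (a - 1))"
      by (simp add: bin_scale_0 powr_powr) (simp add: algebra_simps)
    then show ?thesis using le Q by (simp add: add_increasing)
  next
    case False
    then have lower: "sum s I \<le> 2 * ?c * sum r I"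
      unfolding sum_distrib_left
    proof (intro sum_mono)
      fix i assume "i \<in> I"
      then show "s i \<le> 2 * ?c * r i" using bin_lower[of L "r i" "s i"] k False by simp
    qed
    have "?c powr (1 - a) * sum r I \<le> 2 powr (a - 1) * Q"
    proof (cases "sum r I = 0")
      case False
      then have p: "0 < sum r I" using p by simp
      have ea: "(1 - 1 / a) * a = a - 1" using a by (simp add: field_simps)
      have "sum r I powr a \<le> (Q powr (1 / a) * sum s I powr (1 - 1 / a)) powr a"
        using p Q a by (intro powr_mono2) auto
      also have "\<dots> = Q * sum s I powr (a - 1)"
        using Q q a ea by (simp add: powr_mult powr_powr)
      also have "\<dots> \<le> Q * (2 * ?c * sum r I) powr (a - 1)"
        using Q q a lower by (intro mult_left_mono powr_mono2) auto
      also have "\<dots> = Q * 2 powr (a - 1) * ?c powr (a - 1) * sum r I powr (a - 1)"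
        using p by (simp add: powr_mult)
      finally have "sum r I powr (1 - a) * (?c powr (1 - a) * sum r I powr a) \<le>
         sum r I powr (1 - a) * (?c powr (1 - a) * (Q * 2 powr (a - 1) * ?c powr (a - 1) * sum r I powr (a - 1)))"
        by (intro mult_left_mono) auto
      also have "sum r I powr (1 - a) * (?c powr (1 - a) * (Q * 2 powr (a - 1) * ?c powr (a - 1) * sum r I powr (a - 1)))
          = 2 powr (a - 1) * Q * (?c powr (1 - a) * ?c powr (a - 1)) * (sum r I powr (1 - a) * sum r I powr (a - 1))"
        by (simp only: mult_ac)
      also have "?c powr (1 - a) * ?c powr (a - 1) = 1" using bin_scale_pos[of L k] by (simp flip: powr_add)
      also have "sum r I powr (1 - a) * sum r I powr (a - 1) = 1" using p by (simp flip: powr_add)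
      finally have "sum r I powr (1 - a) * (?c powr (1 - a) * sum r I powr a) \<le> 2 powr (a - 1) * Q" by simp
      moreover have "sum r I powr (1 - a) * (?c powr (1 - a) * sum r I powr a)
          = ?c powr (1 - a) * (sum r I powr (1 - a) * sum r I powr a)" by (simp only: mult_ac)
      moreover have "sum r I powr (1 - a) * sum r I powr a = sum r I" using p by (simp flip: powr_add)
      ultimately show ?thesis by (simp only:)
    qed (use Q in simp)
    then show ?thesis using le p by (simp add: add_increasing2)
  qed
qed

text \<open>The scale c is s/r up to a factor 2, so c^(1-a) r stands for r^a s^(1-a). Only in bin 0
  is c capped below s/r, at 2^L, at the price of the last term.\<close>

lemma bin_scale_gt:
  assumes a: "1 < a" and r: "0 \<le> r" and s: "0 \<le> s" and k: "bin L r s \<le> 2 * L"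
  shows "bin_scale L (bin L r s) powr (1 - a) * r \<le> 2 powr (a - 1) * (r powr a * s powr (1 - a)) + 2 powr (- real L * (a - 1)) * r"
proof (cases "bin L r s = 0")
  case True
  then have "bin_scale L (bin L r s) powr (1 - a) = 2 powr (- real L * (a - 1))"
    by (simp add: bin_scale_0 powr_powr) (simp add: algebra_simps)
  then show ?thesis by (simp add: add_increasing)
next
  case False
  let ?c = "bin_scale L (bin L r s)"
  have lo: "s \<le> 2 * ?c * r" using bin_lower False by simp
  have up: "?c * r \<le> s" using bin_upper k by simp
  have "?c powr (1 - a) * r \<le> 2 powr (a - 1) * (r powr a * s powr (1 - a))"
  proof (cases "r = 0")
    case False
    then have r: "0 < r" using r by simp
    have s: "0 < s" using up r bin_scale_pos[of L "bin L r s"] by (meson less_le_trans mult_pos_pos)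
    have "(2 * ?c * r) powr (1 - a) \<le> s powr (1 - a)" using lo s a by (intro powr_mono2') auto
    then have "2 powr (a - 1) * (r powr a * (2 * ?c * r) powr (1 - a)) \<le> 2 powr (a - 1) * (r powr a * s powr (1 - a))"
      by (intro mult_left_mono) auto
    moreover have "2 powr (a - 1) * (r powr a * (2 * ?c * r) powr (1 - a))
      = (2 powr (a - 1) * 2 powr (1 - a)) * ?c powr (1 - a) * (r powr a * r powr (1 - a))"
      using r by (simp add: powr_mult mult_ac)
    moreover have "2 powr (a - 1) * 2 powr (1 - a) = (1::real)" "r powr a * r powr (1 - a) = r"
      using r by (simp_all flip: powr_add)
    ultimately show ?thesis by simp
  qed simp
  then show ?thesis using r by (simp add: add_increasing2)
qed

text \<open>The overflow bin is given scale 0, whose power vanishes; the last term pays for it, as s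
  \<le> 2^(-L) r there. The term with s pays for bin 0, where r \<le> 2^(-L) s.\<close>

lemma bin_scale_lt:
  assumes a: "0 < a" "a < 1" and r: "0 \<le> r" and s: "0 \<le> s"
  shows "r powr a * s powr (1 - a) \<le>
     2 powr (1 - a) * ((if bin L r s \<le> 2 * L then bin_scale L (bin L r s) else 0) powr (1 - a) * r)
     + 2 powr (- real L * a) * s + 2 powr (- real L * (1 - a)) * r"
proof -
  let ?k = "bin L r s"
  let ?c = "bin_scale L ?k"
  have spl: "x = x powr a * x powr (1 - a)" if "0 \<le> x" for x :: real
    using that by (cases "x = 0") (simp_all flip: powr_add)
  consider "?k = 0" | "0 < ?k" "?k \<le> 2 * L" | "?k = 2 * L + 1"
    using bin_le[of L r s] by linarith
  then show ?thesis
  proof cases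
    case 1
    then have "2 powr real L * r \<le> s" using bin_upper[of L r s] by (simp add: bin_scale_0)
    then have "r \<le> 2 powr (- real L) * s" by (simp add: powr_minus field_simps)
    then have "r powr a * s powr (1 - a) \<le> (2 powr (- real L) * s) powr a * s powr (1 - a)"
      using r a by (intro mult_right_mono powr_mono2) auto
    also have "\<dots> = 2 powr (- real L * a) * (s powr a * s powr (1 - a))"
      using s by (simp add: powr_mult powr_powr)
    also have "\<dots> = 2 powr (- real L * a) * s" using spl[OF s] by simp
    finally show ?thesis using r by (simp add: add_increasing add_increasing2)
  next
    case 2
    have "r powr a * s powr (1 - a) \<le> r powr a * (2 * ?c * r) powr (1 - a)"
      using bin_lower[of L r s] 2 s a by (intro mult_left_mono powr_mono2) auto
    also have "\<dots> = 2 powr (1 - a) * (?c powr (1 - a) * (r powr a * r powr (1 - a)))"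
      using r by (simp add: powr_mult mult_ac)
    also have "\<dots> = 2 powr (1 - a) * (?c powr (1 - a) * r)" using spl[OF r] by simp
    finally show ?thesis using 2 r s by (simp add: add_increasing2)
  next
    case 3
    then have "s \<le> 2 powr (- real L) * r" using bin_lower[of L r s] bin_scale_top[of L] by simp
    then have "r powr a * s powr (1 - a) \<le> r powr a * (2 powr (- real L) * r) powr (1 - a)"
      using s a by (intro mult_left_mono powr_mono2) auto
    also have "\<dots> = 2 powr (- real L * (1 - a)) * (r powr a * r powr (1 - a))"
      using r by (simp add: powr_mult powr_powr)
    also have "\<dots> = 2 powr (- real L * (1 - a)) * r" using spl[OF r] by simp
    finally show ?thesis using 3 s by (simp add: add_increasing)
  qed
qed

section \<open>One-shot bounds\<close>

text \<open>Pinched by the eigenspaces of \<sigma>, the operator \<rho> commutes with \<sigma>. The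
  eigenvalues of \<sigma> are tied to the given list \<open>l\<close>, so that a count for a tensor
  product basis carries over to the new basis.\<close>

lemma joint_eigenbasis:
  assumes d: "fits d \<rho>" "fits d \<sigma>" and p: "psd_op \<rho>" "psd_op \<sigma>" and U: "unitary d U" "\<sigma> = sp d U l"
  obtains V r s where "unitary d V" "\<sigma> = sp d V s" "\<And>i. 0 \<le> s i" "\<And>i. 0 \<le> r i" "s ` {..<d} = l ` {..<d}"
    "pinch (s ` {..<d}) (\<lambda>x. sp d V (\<lambda>i. if s i = x then 1 else 0)) \<rho> = sp d V r"
proof -
  define \<Lambda> where "\<Lambda> = l ` {..<d}"
  define E where "E x = sp d U (\<lambda>i. if l i = x then 1 else 0)" for x
  have R: "resol d \<Lambda> E" unfolding E_def by (rule resol_sp[OF U(1)]) (auto simp: \<Lambda>_def)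
  define Y where "Y = pinch \<Lambda> E \<rho>"
  have Y: "fits d Y" "psd_op Y" "adj Y = Y"
    using fits_pinch[OF R] psd_pinch[OF R] d p psd_adj by (auto simp: Y_def)
  have \<sigma>: "\<sigma> = (\<Sum>x\<in>\<Lambda>. x *\<^sub>R E x)"
    unfolding U(2) E_def sp_scaleR sp_sum by (rule sp_cong) (simp add: \<Lambda>_def if_distrib sum.delta' cong: if_cong)
  have "Y * \<sigma> = \<sigma> * Y"
    unfolding \<sigma> sum_distrib_left sum_distrib_right Y_def
    using pinch_commute[OF R] by (intro sum.cong) auto
  then obtain V r0 s0 where V: "unitary d V" "Y = sp d V r0" "\<sigma> = sp d V s0"
    using spectral_pair[OF Y(1,3) d(2) psd_adj[OF p(2)]] by metis
  \<comment> \<open>Zero beyond the dimension, so that nonnegativity holds for all indices.\<close>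
  define r s where "r i = (if i < d then r0 i else 0)" and "s i = (if i < d then s0 i else 0)" for i
  have V': "Y = sp d V r" "\<sigma> = sp d V s"
    using V by (auto simp: r_def s_def intro!: sp_cong)
  have nn: "0 \<le> s i" "0 \<le> r i" for i
    using psd_sp_iff[OF V(1), of s0] psd_sp_iff[OF V(1), of r0] Y p V by (auto simp: r_def s_def)
  have sl: "s ` {..<d} = \<Lambda>"
  proof -
    have eq: "sp d U l = sp d V s" by (simp only: U(2)[symmetric] V'(2)[symmetric])
    have "s i \<in> l ` {..<d}" "l i \<in> s ` {..<d}" if "i < d" for i
      using sp_values[OF U(1) V(1) eq that] sp_values[OF V(1) U(1) eq[symmetric] that] by auto
    then show ?thesis unfolding \<Lambda>_def by blast
  qed
  have "sp d V (\<lambda>i. if s i = x then 1 else 0) = E x" for x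
    unfolding E_def by (rule sp_fun_cong[OF V(1) U(1)]) (simp only: U(2)[symmetric] V'(2)[symmetric])
  then have "pinch (s ` {..<d}) (\<lambda>x. sp d V (\<lambda>i. if s i = x then 1 else 0)) \<rho> = sp d V r"
    by (simp only: sl Y_def[symmetric] V'(1)[symmetric])
  then show thesis using that[of V s r] V(1) V' nn sl by (simp add: \<Lambda>_def)
qed

section \<open>The classical spectra of a pinched pair\<close>

locale pinched =
  fixes d :: nat and \<rho> \<sigma> V :: cmat and r s :: "nat \<Rightarrow> real"
  assumes fits_\<rho>: "fits d \<rho>" and psd_\<rho>: "psd_op \<rho>"
    and V: "unitary d V" and \<sigma>_eq: "\<sigma> = sp d V s" and s_nonneg: "\<And>i. 0 \<le> s i" and r_nonneg: "\<And>i. 0 \<le> r i"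
    and pinch_eq: "pinch (s ` {..<d}) (\<lambda>x. sp d V (\<lambda>i. if s i = x then 1 else 0)) \<rho> = sp d V r"
begin

abbreviation "Ev \<equiv> \<lambda>x. sp d V (\<lambda>i. if s i = x then 1 else 0)"
abbreviation "\<Lambda> \<equiv> s ` {..<d}"

lemma fits_\<sigma>: "fits d \<sigma>" and psd_\<sigma>: "psd_op \<sigma>"
  using V s_nonneg by (auto simp: \<sigma>_eq psd_sp)

lemma resol_Ev: "resol d \<Lambda> Ev"
  by (rule resol_sp[OF V]) auto

lemma qf_pinch_Ev: "i < d \<Longrightarrow> qf (pinch \<Lambda> Ev M) V i = qf M V i"
proof -
  assume i: "i < d"
  have qs: "qf (sum f A) V i = (\<Sum>x\<in>A. qf (f x) V i)" for f and A :: "real set"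
    by (induction A rule: infinite_finite_induct) (auto simp: qf_plus, auto simp: qf_def)
  have "qf (pinch \<Lambda> Ev M) V i = (\<Sum>x\<in>\<Lambda>. (if s i = x then 1 else 0)\<^sup>2 * qf M V i)"
    by (simp only: pinch_def qs qf_sandwich_sp[OF V i])
  also have "\<dots> = (\<Sum>x\<in>\<Lambda>. if x = s i then qf M V i else 0)" by (intro sum.cong) auto
  also have "\<dots> = qf M V i" using i by simp
  finally show ?thesis .
qed

lemma qf_\<rho>: "i < d \<Longrightarrow> qf \<rho> V i = r i"
  using qf_pinch_Ev[of i \<rho>] by (simp add: pinch_eq qf_own[OF V])

lemma qf_\<sigma>: "i < d \<Longrightarrow> qf \<sigma> V i = s i"
  by (simp add: \<sigma>_eq qf_own[OF V])

lemma tr_r: "Re (tr \<rho>) = (\<Sum>i<d. r i)" and tr_s: "Re (tr \<sigma>) = (\<Sum>i<d. s i)"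
  using tr_qf[OF V fits_\<rho>] tr_qf[OF V fits_\<sigma>] by (auto simp: qf_\<rho> qf_\<sigma>)

text \<open>Labels that refine the eigenspaces of \<sigma> pinch \<rho> just as they pinch its
  coarser pinching, which is already diagonal in \<open>V\<close>.\<close>

lemma pinch_refine:
  assumes S: "finite S" "\<And>i. i < d \<Longrightarrow> \<kappa> i \<in> S" and ref: "\<And>i j. \<kappa> i = \<kappa> j \<Longrightarrow> s i = s j"
  shows "pinch S (\<lambda>k. sp d V (\<lambda>i. if \<kappa> i = k then 1 else 0)) \<rho> = sp d V r"
proof -
  let ?P = "\<lambda>k. sp d V (\<lambda>i. if \<kappa> i = k then 1 else 0)"
  have eq: "?P k * \<rho> * ?P k = sp d V (\<lambda>i. if \<kappa> i = k then r i else 0)" for k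
  proof (cases "\<exists>i<d. \<kappa> i = k")
    case False
    then have "?P k = sp d V (\<lambda>_. 0)" "sp d V (\<lambda>i. if \<kappa> i = k then r i else 0) = sp d V (\<lambda>_. 0)"
      by (auto intro!: sp_cong)
    then show ?thesis by (simp only: sp_0 mult_zero_left)
  next
    case True
    then obtain j where j: "j < d" "\<kappa> j = k" by blast
    let ?x = "s j"
    have sj: "s i = ?x" if "\<kappa> i = k" for i using ref[of i j] j that by simp
    have PE: "?P k * Ev ?x = ?P k" "Ev ?x * ?P k = ?P k"
      unfolding sp_mult[OF V] by (rule sp_cong, simp add: sj)+
    have EE: "Ev ?x * sp d V r = Ev ?x * \<rho> * Ev ?x"
      using pinch_commute(1)[OF resol_Ev, of ?x \<rho>] j pinch_eq by simp
    have "?P k * \<rho> * ?P k = (?P k * Ev ?x) * \<rho> * (Ev ?x * ?P k)" by (simp only: PE)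
    also have "\<dots> = ?P k * (Ev ?x * \<rho> * Ev ?x) * ?P k" by (simp only: mult.assoc)
    also have "\<dots> = ?P k * (Ev ?x * sp d V r) * ?P k" by (simp only: EE)
    also have "\<dots> = (?P k * Ev ?x) * sp d V r * ?P k" by (simp only: mult.assoc)
    also have "\<dots> = sp d V (\<lambda>i. if \<kappa> i = k then r i else 0)"
      unfolding PE sp_mult[OF V] by (intro sp_cong) auto
    finally show ?thesis .
  qed
  show ?thesis
    unfolding pinch_def eq sp_sum using S by (intro sp_cong) (simp add: sum.delta')
qed

text \<open>The sum inside the Renyi divergence of the classical pair \<open>r\<close>,
  \<open>s\<close>.\<close>

definition Mren :: "real \<Rightarrow> real" where
  "Mren a = (\<Sum>i<d. r i powr a * s i powr (1 - a))"

text \<open>Powers of \<sigma> commute with its eigenprojections, so the pinched sandwich has the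
  eigenvalues s^((1-a)/a) r, and these are also the diagonal of the unpinched one. Pinching bounds
  and Peierls' inequalities thus both speak about \<open>Mren\<close>.\<close>

lemma Qren_pinch:
  assumes a: "0 < a"
  defines "X \<equiv> pw d \<sigma> ((1 - a) / (2 * a)) * \<rho> * pw d \<sigma> ((1 - a) / (2 * a))"
  shows "pinch \<Lambda> Ev X = sp d V (\<lambda>i. s i powr ((1 - a) / a) * r i)"
    and "trp d (pinch \<Lambda> Ev X) a = Mren a"
    and "Mren a = (\<Sum>i<d. qf X V i powr a)"
    and "fits d X" "psd_op X"
proof -
  let ?t = "(1 - a) / (2 * a)"
  have T: "pw d \<sigma> ?t = sp d V (\<lambda>i. s i powr ?t)" unfolding \<sigma>_eq by (rule pw_sp[OF V])
  have comm: "Ev x * pw d \<sigma> ?t = pw d \<sigma> ?t * Ev x" for x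
    unfolding T sp_mult[OF V] by (simp add: mult.commute)
  have tt: "s i powr ?t * s i powr ?t = s i powr ((1 - a) / a)" for i
    using a by (simp flip: powr_add)
  have "pinch \<Lambda> Ev X = pw d \<sigma> ?t * pinch \<Lambda> Ev \<rho> * pw d \<sigma> ?t"
  proof -
    have "Ev x * X * Ev x = pw d \<sigma> ?t * (Ev x * \<rho> * Ev x) * pw d \<sigma> ?t" for x
    proof -
      have "Ev x * X * Ev x = (Ev x * pw d \<sigma> ?t) * \<rho> * (pw d \<sigma> ?t * Ev x)"
        unfolding X_def by (simp only: mult.assoc)
      also have "\<dots> = (pw d \<sigma> ?t * Ev x) * \<rho> * (Ev x * pw d \<sigma> ?t)" by (simp only: comm)
      finally show ?thesis by (simp only: mult.assoc)
    qed
    then show ?thesis by (simp only: pinch_def sum_distrib_left sum_distrib_right)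
  qed
  also have "\<dots> = sp d V (\<lambda>i. s i powr ((1 - a) / a) * r i)"
    unfolding pinch_eq T sp_mult[OF V] by (intro sp_cong) (simp only: tt[symmetric] mult_ac)
  finally show 1: "pinch \<Lambda> Ev X = sp d V (\<lambda>i. s i powr ((1 - a) / a) * r i)" .
  have pa: "(s i powr ((1 - a) / a) * r i) powr a = r i powr a * s i powr (1 - a)" for i
    using a s_nonneg r_nonneg by (simp add: powr_mult powr_powr mult.commute)
  show "trp d (pinch \<Lambda> Ev X) a = Mren a" unfolding 1 by (simp add: trp_sp[OF V] pa Mren_def)
  have "qf X V i = s i powr ((1 - a) / a) * r i" if "i < d" for i
    using qf_pinch_Ev[OF that, of X] that by (simp add: 1 qf_own[OF V])
  then show "Mren a = (\<Sum>i<d. qf X V i powr a)" by (simp add: Mren_def pa)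
  have h: "adj \<sigma> = \<sigma>" using psd_\<sigma> psd_adj by blast
  show "fits d X" "psd_op X" unfolding X_def
    using fits_\<rho> fits_\<sigma> psd_\<rho> h by (auto intro!: psd_sandwich' adj_pw)
qed

text \<open>The first of four bounds by which \<open>Qren\<close> and \<open>Mren\<close> agree up
  to a power of the number of eigenvalues of \<sigma>: one direction is Peierls' inequality, the
  other pays for the pinching.\<close>

lemma Mren_le_gt: "1 < a \<Longrightarrow> Mren a \<le> Qren d a \<rho> \<sigma>"
proof -
  assume a: "1 < a"
  then have a0: "0 < a" "1 \<le> a" by auto
  show ?thesis unfolding Qren_def Qren_pinch(3)[OF a0(1)]
    by (rule Peierls_convex[OF Qren_pinch(4,5)[OF a0(1)] V a0(2)])
qed

lemma Qren_le_gt: "1 < a \<Longrightarrow> Qren d a \<rho> \<sigma> \<le> real (card \<Lambda>) powr a * Mren a"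
proof -
  assume "1 < a"
  then have a: "0 < a" by simp
  show ?thesis unfolding Qren_def Qren_pinch(2)[OF a, symmetric]
    by (rule trp_pinch_gt[OF resol_Ev Qren_pinch(4,5)[OF a] a])
qed

lemma Qren_le_lt: "0 < a \<Longrightarrow> a < 1 \<Longrightarrow> Qren d a \<rho> \<sigma> \<le> Mren a"
proof -
  assume a: "0 < a" "a < 1"
  show ?thesis unfolding Qren_def Qren_pinch(3)[OF a(1)]
    by (rule Peierls_concave[OF Qren_pinch(4,5)[OF a(1)] V a(1) less_imp_le[OF a(2)]])
qed

lemma Mren_le_lt: "0 < a \<Longrightarrow> a < 1 \<Longrightarrow> Mren a \<le> real (card \<Lambda>) powr (1 - a) * Qren d a \<rho> \<sigma>"
proof -
  assume a: "0 < a" "a < 1"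
  show ?thesis unfolding Qren_def Qren_pinch(2)[OF a(1), symmetric]
    by (rule trp_pinch_lt[OF resol_Ev Qren_pinch(4,5)[OF a(1)] a])
qed

end

section \<open>Measuring the bins and building the extension\<close>

locale bipartite = pinched dA "ptr dB \<rho>AB" \<sigma> V r s
  for dA dB :: nat and \<rho>AB \<sigma> V :: cmat and r s :: "nat \<Rightarrow> real" +
  fixes L :: nat
  assumes dB: "0 < dB" and fits_\<rho>AB: "fits (dA * dB) \<rho>AB" and psd_\<rho>AB: "psd_op \<rho>AB"
    and tr_\<rho>AB: "Re (tr \<rho>AB) = 1" and tr_\<sigma>: "Re (tr \<sigma>) = 1"
begin

abbreviation "D \<equiv> dA * dB"

text \<open>Bins are pairs of an eigenvalue of \<open>\<sigma>\<close> and a dyadic bin of \<open>r / s\<close>. Refining the eigenspaces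
  of \<open>\<sigma>\<close> makes the pinching of \<open>\<rho>\<^sub>A\<close> by the bins diagonal in \<open>V\<close>.\<close>

definition kap :: "nat \<Rightarrow> real \<times> nat" where
  "kap i = (s i, bin L (r i) (s i))"

definition Sk :: "(real \<times> nat) set" where
  "Sk = \<Lambda> \<times> {..2 * L + 1}"

definition Pk :: "real \<times> nat \<Rightarrow> cmat" where
  "Pk k = sp dA V (\<lambda>i. if kap i = k then 1 else 0)"

definition PB :: "real \<times> nat \<Rightarrow> cmat" where
  "PB k = ampl dB (Pk k)"

abbreviation "Nk \<equiv> real (card Sk)"

lemma card_Sk: "card Sk = card \<Lambda> * (2 * L + 2)"
  by (simp add: Sk_def card_cartesian_product)

lemma finite_Sk: "finite Sk" and kap_in: "i < dA \<Longrightarrow> kap i \<in> Sk"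
  using bin_le by (auto simp: Sk_def kap_def)

lemma resol_Pk: "resol dA Sk Pk"
  unfolding Pk_def by (rule resol_sp[OF V finite_Sk kap_in])

lemma resol_PB: "resol D Sk PB"
  unfolding PB_def by (rule resol_ampl[OF dB resol_Pk])

lemma sum_r: "(\<Sum>i<dA. r i) = 1" and sum_s: "(\<Sum>i<dA. s i) = 1"
  using tr_r tr_s tr_\<sigma> tr_\<rho>AB tr_ptr[OF fits_\<rho>AB] by auto

abbreviation "Ik k \<equiv> {i \<in> {..<dA}. kap i = k}"

lemma sum_group: "(\<Sum>k\<in>Sk. \<Sum>i\<in>Ik k. f i) = (\<Sum>i<dA. f i)"
  by (rule sum.group[OF _ finite_Sk]) (use kap_in in auto)

lemma tr_PB_\<rho>: "Re (tr (PB k * \<rho>AB)) = sum r (Ik k)"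
proof -
  have "tr (PB k * \<rho>AB) = tr (Pk k * ptr dB \<rho>AB)"
    unfolding PB_def Pk_def using V fits_\<rho>AB by (intro tr_ampl_mult dB) auto
  also have "Re \<dots> = (\<Sum>i<dA. (if kap i = k then 1 else 0) * qf (ptr dB \<rho>AB) V i)"
    unfolding Pk_def using fits_\<rho> by (rule tr_sp_mult[OF V])
  also have "\<dots> = sum r (Ik k)" by (intro sum.mono_neutral_cong_right) (auto simp: qf_\<rho>)
  finally show ?thesis .
qed

text \<open>The measurement acts on A alone, so all extensions have the same outcome distribution.
  This makes the lower bounds uniform over extensions.\<close>

lemma tr_PB_ext:
  assumes "fits D \<tau>" "ptr dB \<tau> = \<sigma>"
  shows "Re (tr (PB k * \<tau>)) = sum s (Ik k)"
proof -
  have "tr (PB k * \<tau>) = tr (Pk k * \<sigma>)"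
    unfolding PB_def Pk_def assms(2)[symmetric] using V assms(1) by (intro tr_ampl_mult dB) auto
  also have "Re \<dots> = (\<Sum>i<dA. (if kap i = k then 1 else 0) * qf \<sigma> V i)"
    unfolding Pk_def using fits_\<sigma> by (rule tr_sp_mult[OF V])
  also have "\<dots> = sum s (Ik k)" by (intro sum.mono_neutral_cong_right) (auto simp: qf_\<sigma>)
  finally show ?thesis .
qed

lemma lower_lt:
  assumes \<tau>: "fits D \<tau>" "psd_op \<tau>" "ptr dB \<tau> = \<sigma>" and a: "1 / 2 \<le> a" "a < 1"
  shows "Qren D a \<rho>AB \<tau> \<le> Nk powr a * (2 powr (1 - a) * Mren a + 2 powr (- real L * a) + 2 powr (- real L * (1 - a)))"
proof -
  have "Qren D a \<rho>AB \<tau> \<le> Nk powr a * (\<Sum>k\<in>Sk. Re (tr (PB k * \<rho>AB)) powr a * Re (tr (PB k * \<tau>)) powr (1 - a))"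
    unfolding Qren_def by (rule trp_le_measured_lt[OF fits_\<rho>AB \<tau>(1) psd_\<rho>AB \<tau>(2) a resol_PB])
  also have "\<dots> \<le> Nk powr a * (\<Sum>k\<in>Sk. 2 powr (1 - a) * (\<Sum>i\<in>Ik k. r i powr a * s i powr (1 - a))
     + 2 powr (- real L * a) * sum s (Ik k) + 2 powr (- real L * (1 - a)) * sum r (Ik k))"
    unfolding tr_PB_\<rho> tr_PB_ext[OF \<tau>(1,3)]
  proof (intro mult_left_mono sum_mono bin_mass_lt)
    fix k i assume "i \<in> Ik k"
    then show "bin L (r i) (s i) = snd k" by (auto simp: kap_def)
  qed (use a r_nonneg s_nonneg in auto)
  also have "\<dots> = Nk powr a * (2 powr (1 - a) * Mren a + 2 powr (- real L * a) + 2 powr (- real L * (1 - a)))"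
    by (simp only: sum.distrib sum_distrib_left[symmetric] sum_group Mren_def sum_r sum_s mult_1_right)
  finally show ?thesis .
qed

lemma lower_gt:
  assumes \<tau>: "fits D \<tau>" "psd_op \<tau>" "ptr dB \<tau> = \<sigma>" and a: "1 < a" and ac: "abs_cont \<rho>AB \<tau>"
    and rs: "\<And>i. i < dA \<Longrightarrow> r i \<le> 2 ^ L * s i"
  shows "Mren a \<le> Nk * 2 powr (a - 1) * Qren D a \<rho>AB \<tau> + 2 powr (- real L * (a - 1))"
proof -
  let ?Q = "Qren D a \<rho>AB \<tau>"
  have supp: "\<rho>AB * pw D \<tau> 0 = \<rho>AB" using abs_cont_supp[OF \<tau>(1,2) fits_\<rho>AB] ac by simp
  have Q: "0 \<le> ?Q" by (rule Qren_nonneg[OF fits_\<rho>AB psd_\<rho>AB \<tau>(1,2)])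
  have "Mren a = (\<Sum>k\<in>Sk. \<Sum>i\<in>Ik k. r i powr a * s i powr (1 - a))"
    by (simp only: sum_group Mren_def)
  also have "\<dots> \<le> (\<Sum>k\<in>Sk. 2 powr (a - 1) * ?Q + 2 powr (- real L * (a - 1)) * sum r (Ik k))"
  proof (rule sum_mono)
    fix k assume k: "k \<in> Sk"
    show "(\<Sum>i\<in>Ik k. r i powr a * s i powr (1 - a)) \<le> 2 powr (a - 1) * ?Q + 2 powr (- real L * (a - 1)) * sum r (Ik k)"
    proof (cases "Ik k = {}")
      \<comment> \<open>An empty bin may carry the overflow label; \<open>bin_mass_gt\<close> covers
        only labels up to \<open>2 * L\<close>, which \<open>rs\<close> guarantees for occupied
        bins.\<close>
      case True
      show ?thesis unfolding True using Q by simp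
    next
      case False
      then obtain i where i: "i < dA" "kap i = k" by blast
      show ?thesis
      proof (rule bin_mass_gt[where k = "snd k"])
        show "sum r (Ik k) \<le> ?Q powr (1 / a) * sum s (Ik k) powr (1 - 1 / a)"
          using tr_proj_le_gt[OF fits_\<rho>AB \<tau>(1) psd_\<rho>AB \<tau>(2) a resol_proj[OF resol_PB k] supp]
          by (simp only: tr_PB_\<rho> tr_PB_ext[OF \<tau>(1,3)] Qren_def)
        show "snd k \<le> 2 * L" using i rs bin_le_2L by (auto simp: kap_def)
      qed (use a r_nonneg s_nonneg Q in \<open>auto simp: kap_def\<close>)
    qed
  qed
  also have "\<dots> = Nk * 2 powr (a - 1) * ?Q + 2 powr (- real L * (a - 1))"
    by (simp only: sum.distrib sum_distrib_left[symmetric] sum_group sum_r sum_constant) simp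
  finally show ?thesis .
qed

text \<open>In the overflow bin even the smallest dyadic scale of the range violates the bound of
  \<open>ck_le\<close>, so the scale is 0.\<close>

definition ck :: "nat \<Rightarrow> real" where
  "ck i = (if bin L (r i) (s i) \<le> 2 * L then bin_scale L (bin L (r i) (s i)) else 0)"

lemma ck_nonneg: "0 \<le> ck i" and ck_le: "ck i * r i \<le> s i"
  using bin_upper s_nonneg by (auto simp: ck_def)

text \<open>In the notation of the overview, \<open>NA\<close> is the sum of the c_k times the
  projections on A, \<open>rh\<close> the sum of the R_k, and \<open>om\<close> is \<omega>.\<close>

definition NA :: cmat where "NA = sp dA V ck"

definition rh :: cmat where "rh = pinch Sk PB \<rho>AB"

definition om :: cmat where "om = ampl dB NA * rh"

definition ext :: cmat where
  "ext = om + (1 / real dB) *\<^sub>R ampl dB (\<sigma> - NA * sp dA V r)"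

lemma NA_sum: "ampl dB NA = (\<Sum>k\<in>Sk. (if snd k \<le> 2 * L then bin_scale L (snd k) else 0) *\<^sub>R PB k)"
proof -
  have "NA = (\<Sum>k\<in>Sk. (if snd k \<le> 2 * L then bin_scale L (snd k) else 0) *\<^sub>R Pk k)"
    unfolding NA_def Pk_def sp_scaleR sp_sum
  proof (rule sp_cong)
    fix i assume i: "i < dA"
    have "(\<Sum>k\<in>Sk. (if snd k \<le> 2 * L then bin_scale L (snd k) else 0) * (if kap i = k then 1 else 0))
      = (\<Sum>k\<in>Sk. if k = kap i then ck i else 0)"
      by (intro sum.cong) (auto simp: ck_def kap_def)
    then show "ck i = (\<Sum>k\<in>Sk. (if snd k \<le> 2 * L then bin_scale L (snd k) else 0) * (if kap i = k then 1 else 0))"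
      using kap_in[OF i] finite_Sk by simp
  qed
  then show ?thesis by (simp only: ampl_sum ampl_scaleR PB_def)
qed

lemma rh_props: "fits D rh" "psd_op rh" "adj rh = rh" "ptr dB rh = sp dA V r"
proof -
  show "fits D rh" "psd_op rh" "adj rh = rh" unfolding rh_def
    using fits_pinch[OF resol_PB fits_\<rho>AB] psd_pinch[OF resol_PB psd_\<rho>AB] psd_adj by auto
  have "ptr dB rh = pinch Sk Pk (ptr dB \<rho>AB)" unfolding rh_def PB_def by (rule ptr_pinch_ampl[OF dB])
  also have "\<dots> = sp dA V r"
    unfolding Pk_def by (rule pinch_refine[OF finite_Sk kap_in]) (auto simp: kap_def)
  finally show "ptr dB rh = sp dA V r" .
qed

text \<open>\<open>NA\<close> is a scalar on each bin, and a state pinched by the bins commutes with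
  their projections.\<close>

lemma comm_NA: "ampl dB NA * rh = rh * ampl dB NA"
  unfolding NA_sum sum_distrib_left sum_distrib_right rh_def
  using pinch_commute[OF resol_PB] by (intro sum.cong) auto

lemma comm_PB: "k \<in> Sk \<Longrightarrow> PB k * om = om * PB k"
proof -
  assume k: "k \<in> Sk"
  have "Pk k * NA = NA * Pk k" unfolding Pk_def NA_def sp_mult[OF V] by (simp add: mult.commute)
  then have 1: "PB k * ampl dB NA = ampl dB NA * PB k"
    unfolding PB_def using ampl_mult[OF dB] by metis
  have 2: "PB k * rh = rh * PB k" unfolding rh_def using pinch_commute[OF resol_PB k] by simp
  have "PB k * om = (PB k * ampl dB NA) * rh" by (simp only: om_def mult.assoc)
  also have "\<dots> = ampl dB NA * (PB k * rh)" by (simp only: 1 mult.assoc)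
  also have "\<dots> = om * PB k" by (simp only: 2 om_def mult.assoc)
  finally show ?thesis .
qed

lemma NA_props: "fits dA NA" "adj NA = NA" "fits D (ampl dB NA)" "adj (ampl dB NA) = ampl dB NA"
  using V by (auto simp: NA_def ampl_adj)

lemma joint:
  obtains W x n where "unitary D W" "rh = sp D W x" "ampl dB NA = sp D W n" "\<And>i. i < D \<Longrightarrow> 0 \<le> x i"
    "\<And>i. i < D \<Longrightarrow> n i \<in> ck ` {..<dA}" "om = sp D W (\<lambda>i. n i * x i)"
proof -
  obtain W x n where W: "unitary D W" "rh = sp D W x" "ampl dB NA = sp D W n"
    using spectral_pair[OF rh_props(1,3) NA_props(3,4) comm_NA[symmetric]] by metis
  have x: "\<forall>i<D. 0 \<le> x i" using psd_sp_iff[OF W(1), of x] rh_props W(2) by simp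
  have "n i \<in> ck ` {..<dA}" if i: "i < D" for i
  proof -
    have "sp D (ampl dB V) (\<lambda>k. ck (k div dB)) = sp D W n"
      using W(3) ampl_sp[OF dB, of dA V ck] by (simp add: NA_def)
    then have "n i \<in> (\<lambda>k. ck (k div dB)) ` {..<D}"
      using sp_values[OF unitary_ampl[OF dB V] W(1)] i by blast
    then show ?thesis using dB by (auto simp: div_less_iff_less_mult)
  qed
  moreover have "om = sp D W (\<lambda>i. n i * x i)" unfolding om_def W(2,3) by (rule sp_mult[OF W(1)])
  ultimately show thesis using that W x by blast
qed

lemma om_props: "fits D om" "psd_op om" "adj om = om" "ptr dB om = NA * sp dA V r"
proof -
  obtain W x n where W: "unitary D W" "om = sp D W (\<lambda>i. n i * x i)"
    "\<And>i. i < D \<Longrightarrow> 0 \<le> x i" "\<And>i. i < D \<Longrightarrow> n i \<in> ck ` {..<dA}"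
    using joint by metis
  have "0 \<le> n i * x i" if "i < D" for i using W(3,4)[OF that] ck_nonneg by (auto intro: mult_nonneg_nonneg)
  then show "fits D om" "psd_op om" "adj om = om" using W by (auto simp: psd_sp)
  show "ptr dB om = NA * sp dA V r" unfolding om_def by (simp add: ptr_ampl_mult[OF dB] rh_props)
qed

lemma rest: "\<sigma> - NA * sp dA V r = sp dA V (\<lambda>i. s i - ck i * r i)"
  unfolding \<sigma>_eq NA_def sp_mult[OF V] sp_minus ..

lemma ext_props: "fits D ext" "psd_op ext" "ptr dB ext = \<sigma>" "psd_op (ext - om)"
proof -
  have R: "fits dA (\<sigma> - NA * sp dA V r)" "psd_op (\<sigma> - NA * sp dA V r)"
    unfolding rest using V ck_le by (auto intro!: psd_sp)
  have A: "psd_op ((1 / real dB) *\<^sub>R ampl dB (\<sigma> - NA * sp dA V r))"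
    using R dB by (intro psd_scaleR psd_ampl) auto
  then show "psd_op (ext - om)" by (simp add: ext_def)
  show "psd_op ext" unfolding ext_def using A om_props by (intro psd_plus)
  show "fits D ext" unfolding ext_def using R om_props by auto
  show "ptr dB ext = \<sigma>"
    unfolding ext_def using dB by (simp add: ptr_plus ptr_scaleR ptr_ampl om_props)
qed

text \<open>In a joint eigenbasis \<open>rh\<close> and \<open>om\<close> have the eigenvalues x and
  n x, so the sandwich collapses to n^(1-a) x. As n belongs to an operator on A, tracing out B turns
  n into \<open>ck\<close> and x into \<open>r\<close>.\<close>

lemma Qren_rh_om:
  assumes a: "0 < a"
  shows "Qren D a rh om = (\<Sum>i<dA. ck i powr (1 - a) * r i)"
proof -
  obtain W x n where W: "unitary D W" "rh = sp D W x" "ampl dB NA = sp D W n" "\<And>i. i < D \<Longrightarrow> 0 \<le> x i"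
    "\<And>i. i < D \<Longrightarrow> n i \<in> ck ` {..<dA}" "om = sp D W (\<lambda>i. n i * x i)"
    by (rule joint, rule that, assumption+)
  have n: "0 \<le> n i" if "i < D" for i using W(5)[OF that] ck_nonneg by auto
  let ?t = "(1 - a) / (2 * a)"
  have val: "((n i * x i) powr ?t * x i * (n i * x i) powr ?t) powr a = n i powr (1 - a) * x i" if i: "i < D" for i
  proof -
    have tt: "?t + ?t = (1 - a) / a" using a by (simp add: field_simps)
    have "((n i * x i) powr ?t * x i * (n i * x i) powr ?t) = ((n i * x i) powr ?t * (n i * x i) powr ?t) * x i"
      by (simp only: mult_ac)
    also have "\<dots> = (n i * x i) powr ((1 - a) / a) * x i" by (simp only: powr_add[symmetric] tt)
    finally have "((n i * x i) powr ?t * x i * (n i * x i) powr ?t) powr a = ((n i * x i) powr ((1 - a) / a) * x i) powr a"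
      by (rule arg_cong)
    also have "\<dots> = (n i * x i) powr (1 - a) * x i powr a"
      using a W(4)[OF i] by (simp add: powr_mult powr_powr)
    also have "\<dots> = n i powr (1 - a) * (x i powr (1 - a) * x i powr a)"
      using n[OF i] W(4)[OF i] by (simp add: powr_mult)
    also have "x i powr (1 - a) * x i powr a = x i"
      using W(4)[OF i] by (cases "x i = 0") (simp_all flip: powr_add)
    finally show ?thesis .
  qed
  have pwom: "pw D om ?t = sp D W (\<lambda>i. (n i * x i) powr ?t)" unfolding W(6) by (rule pw_sp[OF W(1)])
  have "pw D om ?t * rh * pw D om ?t = sp D W (\<lambda>i. (n i * x i) powr ?t * x i * (n i * x i) powr ?t)"
    unfolding pwom W(2) sp_mult[OF W(1)] ..
  then have "Qren D a rh om = (\<Sum>i<D. ((n i * x i) powr ?t * x i * (n i * x i) powr ?t) powr a)"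
    unfolding Qren_def by (simp only: trp_sp[OF W(1)])
  also have "\<dots> = (\<Sum>i<D. n i powr (1 - a) * x i)" using val by (intro sum.cong) auto
  also have "\<dots> = Re (tr (sp D W (\<lambda>i. n i powr (1 - a)) * sp D W x))"
    unfolding sp_mult[OF W(1)] tr_sp[OF W(1)] by simp
  also have "sp D W (\<lambda>i. n i powr (1 - a)) = ampl dB (sp dA V (\<lambda>i. ck i powr (1 - a)))"
  proof -
    have "sp D W n = sp D (ampl dB V) (\<lambda>k. ck (k div dB))"
      using W(3) ampl_sp[OF dB, of dA V ck] by (simp add: NA_def)
    then show ?thesis
      unfolding ampl_sp[OF dB] by (rule sp_fun_cong[OF W(1) unitary_ampl[OF dB V]])
  qed
  also have "tr (ampl dB (sp dA V (\<lambda>i. ck i powr (1 - a))) * sp D W x)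
     = tr (sp dA V (\<lambda>i. ck i powr (1 - a)) * ptr dB rh)"
    unfolding W(2)[symmetric] using V rh_props by (intro tr_ampl_mult[OF dB]) auto
  also have "Re \<dots> = (\<Sum>i<dA. ck i powr (1 - a) * r i)"
    unfolding rh_props(4) sp_mult[OF V] tr_sp[OF V] by simp
  finally show ?thesis .
qed

text \<open>For a < 1 the larger second argument \<open>ext\<close> only raises \<open>Qren\<close>
  above its value at \<open>om\<close>. Since \<open>om\<close> commutes with the bins, pinching the
  sandwich means pinching the state alone.\<close>

lemma upper_lt:
  assumes a: "1 / 2 \<le> a" "a < 1"
  shows "Mren a \<le> 2 powr (1 - a) * Nk powr (1 - a) * Qren D a \<rho>AB ext + 2 powr (- real L * a) + 2 powr (- real L * (1 - a))"
proof -
  let ?T = "pw D om ((1 - a) / (2 * a))"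
  have T: "fits D ?T" "adj ?T = ?T" using om_props fits_pw adj_pw by auto
  have X: "fits D (?T * \<rho>AB * ?T)" "psd_op (?T * \<rho>AB * ?T)"
    using T fits_\<rho>AB psd_\<rho>AB by (auto intro!: psd_sandwich')
  have comm: "PB k * ?T = ?T * PB k" if "k \<in> Sk" for k
    using that om_props by (intro pw_commute comm_PB) (auto simp: resol_dim[OF resol_PB])
  have "pinch Sk PB (?T * \<rho>AB * ?T) = ?T * rh * ?T"
    unfolding pinch_def rh_def sum_distrib_left sum_distrib_right
  proof (rule sum.cong)
    fix k assume k: "k \<in> Sk"
    have "PB k * (?T * \<rho>AB * ?T) * PB k = (PB k * ?T) * \<rho>AB * (?T * PB k)" by (simp only: mult.assoc)
    also have "\<dots> = (?T * PB k) * \<rho>AB * (PB k * ?T)" by (simp only: comm[OF k])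
    finally show "PB k * (?T * \<rho>AB * ?T) * PB k = ?T * (PB k * \<rho>AB * PB k) * ?T" by (simp only: mult.assoc)
  qed simp
  then have "Qren D a rh om = trp D (pinch Sk PB (?T * \<rho>AB * ?T)) a" by (simp only: Qren_def)
  also have "\<dots> \<le> Nk powr (1 - a) * Qren D a \<rho>AB om"
    unfolding Qren_def using a by (intro trp_pinch_lt[OF resol_PB X]) auto
  also have "\<dots> \<le> Nk powr (1 - a) * Qren D a \<rho>AB ext"
    using fits_\<rho>AB psd_\<rho>AB om_props ext_props a by (intro mult_left_mono Qren_mono_lt) auto
  finally have Q: "(\<Sum>i<dA. ck i powr (1 - a) * r i) \<le> Nk powr (1 - a) * Qren D a \<rho>AB ext"
    using Qren_rh_om a by simp
  have "Mren a \<le> (\<Sum>i<dA. 2 powr (1 - a) * (ck i powr (1 - a) * r i) + 2 powr (- real L * a) * s i + 2 powr (- real L * (1 - a)) * r i)"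
    unfolding Mren_def ck_def using a r_nonneg s_nonneg by (intro sum_mono bin_scale_lt) auto
  also have "\<dots> = 2 powr (1 - a) * (\<Sum>i<dA. ck i powr (1 - a) * r i) + 2 powr (- real L * a) + 2 powr (- real L * (1 - a))"
    by (simp only: sum.distrib sum_distrib_left[symmetric] sum_r sum_s mult_1_right)
  also have "\<dots> \<le> 2 powr (1 - a) * (Nk powr (1 - a) * Qren D a \<rho>AB ext) + 2 powr (- real L * a) + 2 powr (- real L * (1 - a))"
    using Q by (intro add_right_mono mult_left_mono) auto
  finally show ?thesis by (simp only: mult.assoc)
qed

lemma upper_gt:
  assumes a: "1 < a" and rs: "\<And>i. i < dA \<Longrightarrow> r i \<le> 2 ^ L * s i"
  shows "abs_cont \<rho>AB ext"
    and "Qren D a \<rho>AB ext \<le> Nk powr a * (2 powr (a - 1) * Mren a + 2 powr (- real L * (a - 1)))"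
proof -
  obtain W x n where W: "unitary D W" "rh = sp D W x" "ampl dB NA = sp D W n" "\<And>i. i < D \<Longrightarrow> 0 \<le> x i"
    "\<And>i. i < D \<Longrightarrow> n i \<in> ck ` {..<dA}" "om = sp D W (\<lambda>i. n i * x i)"
    by (rule joint, rule that, assumption+)
  have bin: "bin L (r i) (s i) \<le> 2 * L" if "i < dA" for i using bin_le_2L rs that by blast
  then have n: "0 < n i" if "i < D" for i using W(5)[OF that] by (auto simp: ck_def)
  \<comment> \<open>Without an overflow bin all scales are positive, so \<open>om\<close> has the
    support of \<open>rh\<close>, which contains that of the state by the pinching
    inequality.\<close>
  have "pw D om 0 = pw D rh 0"
  proof -
    have "(n i * x i) powr 0 = x i powr 0" if "i < D" for i using n[OF that] by simp
    then show ?thesis unfolding W(2,6) pw_sp[OF W(1)] by (intro sp_cong)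
  qed
  moreover have "abs_cont \<rho>AB rh"
    unfolding rh_def using pinching_inequality[OF resol_PB fits_\<rho>AB psd_\<rho>AB] psd_\<rho>AB fits_\<rho>AB
    by (intro abs_cont_le)
  ultimately have supp: "\<rho>AB * pw D om 0 = \<rho>AB" and ac: "abs_cont \<rho>AB om"
    using abs_cont_supp[OF rh_props(1,2) fits_\<rho>AB] abs_cont_supp[OF om_props(1,2) fits_\<rho>AB] by auto
  have "abs_cont om ext"
    using abs_cont_le[of om 1 ext D] om_props ext_props by simp
  then show "abs_cont \<rho>AB ext" using ac abs_cont_trans by blast
  let ?T = "pw D om ((1 - a) / (2 * a))"
  have T: "fits D ?T" "adj ?T = ?T" using om_props fits_pw adj_pw by auto
  have "Qren D a \<rho>AB ext \<le> Qren D a \<rho>AB om"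
    using fits_\<rho>AB psd_\<rho>AB om_props ext_props a supp by (intro Qren_antimono_gt) auto
  also have "\<dots> \<le> trp D (Nk *\<^sub>R (?T * rh * ?T)) a"
    unfolding Qren_def
  proof (rule trp_mono)
    have eq: "Nk *\<^sub>R (?T * rh * ?T) - ?T * \<rho>AB * ?T = ?T * (Nk *\<^sub>R rh - \<rho>AB) * ?T"
      by (simp add: algebra_simps)
    show "psd_op (Nk *\<^sub>R (?T * rh * ?T) - ?T * \<rho>AB * ?T)"
      unfolding eq unfolding rh_def by (rule psd_sandwich'[OF pinching_inequality[OF resol_PB fits_\<rho>AB psd_\<rho>AB] T(2)])
  qed (use T fits_\<rho>AB psd_\<rho>AB rh_props a in \<open>auto intro!: psd_sandwich'\<close>)
  also have "\<dots> = Nk powr a * Qren D a rh om"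
    unfolding Qren_def using T rh_props by (intro trp_scaleR) (auto intro!: psd_sandwich')
  also have "Qren D a rh om = (\<Sum>i<dA. ck i powr (1 - a) * r i)" using a by (intro Qren_rh_om) simp
  also have "Nk powr a * (\<Sum>i<dA. ck i powr (1 - a) * r i)
     \<le> Nk powr a * (\<Sum>i<dA. 2 powr (a - 1) * (r i powr a * s i powr (1 - a)) + 2 powr (- real L * (a - 1)) * r i)"
  proof (intro mult_left_mono sum_mono)
    fix i assume "i \<in> {..<dA}"
    then have "bin L (r i) (s i) \<le> 2 * L" using bin by simp
    then show "ck i powr (1 - a) * r i \<le> 2 powr (a - 1) * (r i powr a * s i powr (1 - a)) + 2 powr (- real L * (a - 1)) * r i"
      using bin_scale_gt[OF a r_nonneg s_nonneg] by (simp add: ck_def)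
  qed simp
  also have "\<dots> = Nk powr a * (2 powr (a - 1) * Mren a + 2 powr (- real L * (a - 1)))"
    by (simp only: sum.distrib sum_distrib_left[symmetric] sum_r Mren_def mult_1_right)
  finally show "Qren D a \<rho>AB ext \<le> Nk powr a * (2 powr (a - 1) * Mren a + 2 powr (- real L * (a - 1)))" .
qed

end

section \<open>Tensor powers\<close>

text \<open>All that is used of an index encoding is that it identifies the indices below
  \<open>N\<close> with n-tuples of digits. The locale thus serves both A^n and the reordered powers
  of AB.\<close>

locale digits =
  fixes N n d :: nat and dig :: "nat \<Rightarrow> nat \<Rightarrow> nat"
  assumes bij: "bij_betw (\<lambda>k. \<lambda>t\<in>{..<n}. dig t k) {..<N} ({..<n} \<rightarrow>\<^sub>E {..<d})"
begin

lemma dig_less: "k < N \<Longrightarrow> t < n \<Longrightarrow> dig t k < d"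
  using bij_betwE[OF bij] by (fastforce simp: PiE_iff)

lemma dig_inj: "k < N \<Longrightarrow> l < N \<Longrightarrow> (\<And>t. t < n \<Longrightarrow> dig t k = dig t l) \<Longrightarrow> k = l"
  using bij by (auto simp: bij_betw_def inj_on_def restrict_def fun_eq_iff)

lemma dig_surj: "j < d \<Longrightarrow> \<exists>k<N. \<forall>t<n. dig t k = j"
proof -
  assume j: "j < d"
  then have "(\<lambda>t\<in>{..<n}. j) \<in> (\<lambda>k. \<lambda>t\<in>{..<n}. dig t k) ` {..<N}"
    using bij by (auto simp: bij_betw_def)
  then obtain k where k: "k < N" and eq: "(\<lambda>t\<in>{..<n}. j) = (\<lambda>t\<in>{..<n}. dig t k)" by auto
  have "dig t k = j" if "t < n" for t using fun_cong[OF eq, of t] that by simp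
  with k show ?thesis by blast
qed

lemma sum_prod_dig:
  fixes f :: "nat \<Rightarrow> nat \<Rightarrow> 'a::comm_semiring_1"
  shows "(\<Sum>k<N. \<Prod>t<n. f t (dig t k)) = (\<Prod>t<n. \<Sum>j<d. f t j)"
proof -
  have "(\<Prod>t<n. \<Sum>j<d. f t j) = (\<Sum>g\<in>{..<n} \<rightarrow>\<^sub>E {..<d}. \<Prod>t<n. f t (g t))"
    by (rule prod_sum_PiE) auto
  also have "\<dots> = (\<Sum>k<N. \<Prod>t<n. f t ((\<lambda>t\<in>{..<n}. dig t k) t))"
    by (rule sum.reindex_bij_betw[OF bij, symmetric])
  also have "\<dots> = (\<Sum>k<N. \<Prod>t<n. f t (dig t k))" by (intro sum.cong prod.cong) auto
  finally show ?thesis by simp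
qed

text \<open>The factors may differ, for the sake of replacing them one at a time in
  \<open>tens_mono\<close>.\<close>

definition tensf :: "(nat \<Rightarrow> cmat) \<Rightarrow> cmat" where
  "tensf F = mk N (\<lambda>k l. \<Prod>t<n. ent (F t) (dig t k) (dig t l))"

lemma fits_tensf [simp, intro]: "fits N (tensf F)"
  by (simp add: tensf_def)

lemma ent_tensf: "k < N \<Longrightarrow> l < N \<Longrightarrow> ent (tensf F) k l = (\<Prod>t<n. ent (F t) (dig t k) (dig t l))"
  by (simp add: tensf_def ent_mk)

lemma tensf_cong: "(\<And>t. t < n \<Longrightarrow> F t = G t) \<Longrightarrow> tensf F = tensf G"
  unfolding tensf_def by (intro mk_cong prod.cong) auto

lemma tensf_mult:
  assumes "\<And>t. t < n \<Longrightarrow> fits d (F t)"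
  shows "tensf F * tensf G = tensf (\<lambda>t. F t * G t)"
proof (rule cmat_eqI'[of N])
  fix k l assume kl: "k < N" "l < N"
  have "ent (tensf F * tensf G) k l = (\<Sum>m<N. \<Prod>t<n. ent (F t) (dig t k) (dig t m) * ent (G t) (dig t m) (dig t l))"
    using kl by (simp add: ent_mult_l[OF fits_tensf] ent_tensf prod.distrib)
  also have "\<dots> = (\<Prod>t<n. \<Sum>j<d. ent (F t) (dig t k) j * ent (G t) j (dig t l))"
    by (rule sum_prod_dig)
  also have "\<dots> = ent (tensf (\<lambda>t. F t * G t)) k l"
    using kl by (auto simp: ent_tensf intro!: prod.cong ent_mult_l[OF assms, symmetric])
  finally show "ent (tensf F * tensf G) k l = ent (tensf (\<lambda>t. F t * G t)) k l" .
qed auto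

lemma tensf_adj: "adj (tensf F) = tensf (\<lambda>t. adj (F t))"
  by (rule cmat_eqI'[of N]) (auto simp: ent_tensf)

lemma tensf_dg: "tensf (\<lambda>_. dg d l) = dg N (\<lambda>k. \<Prod>t<n. l (dig t k))"
proof (rule cmat_eqI'[of N])
  fix k j assume kj: "k < N" "j < N"
  show "ent (tensf (\<lambda>_. dg d l)) k j = ent (dg N (\<lambda>k. \<Prod>t<n. l (dig t k))) k j"
  proof (cases "k = j")
    case True
    then show ?thesis using kj by (simp add: ent_tensf ent_dg dig_less)
  next
    case False
    then obtain t where "t < n" "dig t k \<noteq> dig t j" using dig_inj[OF kj] by blast
    then have "(\<Prod>t<n. ent (dg d l) (dig t k) (dig t j)) = 0" by (auto simp: ent_dg intro!: prod_zero)
    then show ?thesis using kj False by (simp add: ent_tensf ent_dg)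
  qed
qed auto

lemma tensf_gram: "(\<And>t. t < n \<Longrightarrow> fits d (F t)) \<Longrightarrow> adj (tensf F) * tensf F = tensf (\<lambda>t. adj (F t) * F t)"
  unfolding tensf_adj by (rule tensf_mult) simp

lemma unitary_tensf: "unitary d U \<Longrightarrow> unitary N (tensf (\<lambda>_. U))"
  unfolding unitary_def by (simp add: tensf_adj tensf_mult tensf_dg)

lemma tensf_sp: "unitary d U \<Longrightarrow> tensf (\<lambda>_. sp d U l) = sp N (tensf (\<lambda>_. U)) (\<lambda>k. \<Prod>t<n. l (dig t k))"
proof -
  assume U: "unitary d U"
  let ?D = "dg d (\<lambda>i. complex_of_real (l i))"
  have "tensf (\<lambda>_. U) * tensf (\<lambda>_. ?D) * adj (tensf (\<lambda>_. U)) = tensf (\<lambda>_. sp d U l)"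
    using unitary_dim[OF U] by (simp add: tensf_adj tensf_mult sp_def)
  then show ?thesis by (simp add: tensf_dg sp_def)
qed

lemma tr_tensf: "(\<And>t. t < n \<Longrightarrow> fits d (F t)) \<Longrightarrow> tr (tensf F) = (\<Prod>t<n. tr (F t))"
  using sum_prod_dig[of "\<lambda>t j. ent (F t) j j"] by (simp add: tr_eq[OF fits_tensf] tr_eq[of d] ent_tensf)

lemma psd_tensf:
  assumes "\<And>t. t < n \<Longrightarrow> fits d (F t)" "\<And>t. t < n \<Longrightarrow> psd_op (F t)"
  shows "psd_op (tensf F)"
proof -
  have "\<forall>t. \<exists>K. t < n \<longrightarrow> fits d K \<and> F t = adj K * K"
    using ex_gram assms by metis
  then obtain K where K: "\<And>t. t < n \<Longrightarrow> fits d (K t) \<and> F t = adj (K t) * K t" by metis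
  have "tensf F = adj (tensf K) * tensf K"
    using K by (simp add: tensf_gram cong: tensf_cong)
  then show ?thesis by (simp only: psdI_gram)
qed

abbreviation "tens M \<equiv> tensf (\<lambda>_. M)"

lemma pw_tens:
  assumes "fits d M" "psd_op M"
  shows "pw N (tens M) p = tens (pw d M p)"
proof -
  obtain U l where U: "unitary d U" "M = sp d U l" "\<And>i. 0 \<le> l i" using spectral_psd assms by blast
  have "(\<Prod>t<n. l (dig t k)) powr p = (\<Prod>t<n. l (dig t k) powr p)" for k
    by (rule prod_powr_distrib)
  then show ?thesis
    unfolding U(2) pw_sp[OF U(1)] tensf_sp[OF U(1)] pw_sp[OF unitary_tensf[OF U(1)]] by simp
qed

lemma trp_tens:
  assumes "fits d M" "psd_op M"
  shows "trp N (tens M) p = trp d M p ^ n"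
proof -
  have h: "adj M = M" using assms psd_adj by blast
  have c: "tr (pw d M p) = complex_of_real (trp d M p)"
    using tr_herm_Im[OF adj_pw[OF assms(1) h]] by (simp add: trp_def complex_eq_iff)
  have "tr (tens (pw d M p)) = tr (pw d M p) ^ n"
    using fits_pw[OF assms(1) h] by (subst tr_tensf) auto
  then show ?thesis unfolding trp_def[of N] pw_tens[OF assms] by (simp add: c flip: of_real_power)
qed

lemma Qren_tens:
  assumes "fits d \<rho>" "fits d \<sigma>" "psd_op \<rho>" "psd_op \<sigma>"
  shows "Qren N a (tens \<rho>) (tens \<sigma>) = Qren d a \<rho> \<sigma> ^ n"
proof -
  have h: "adj \<sigma> = \<sigma>" using assms psd_adj by blast
  let ?T = "pw d \<sigma> ((1 - a) / (2 * a))"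
  have T: "fits d ?T" "adj ?T = ?T" using assms h fits_pw adj_pw by auto
  have "tens ?T * tens \<rho> * tens ?T = tens (?T * \<rho> * ?T)"
    using T assms by (simp add: tensf_mult)
  then show ?thesis
    unfolding Qren_def pw_tens[OF assms(2,4)] using T assms
    by (simp add: psd_sandwich' trp_tens)
qed

text \<open>Replace the tensor factors \<open>Y\<close> by \<open>X\<close> one at a time.\<close>

lemma tens_mono:
  assumes d: "fits d X" "fits d Y" and X: "psd_op X" and le: "psd_op (Y - X)"
  shows "psd_op (tens Y - tens X)"
proof -
  have Y: "psd_op Y" using X le by (rule psd_trans_le)
  define T where "T j = tensf (\<lambda>t. if t < j then X else Y)" for j
  have step: "T j - T (Suc j) = tensf (\<lambda>t. if t < j then X else if t = j then Y - X else Y)" if j: "j < n" for j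
  proof (rule cmat_eqI'[of N])
    fix k l assume kl: "k < N" "l < N"
    have split: "(\<Prod>t<n. f t) = f j * (\<Prod>t\<in>{..<n} - {j}. f t)" for f :: "nat \<Rightarrow> complex"
      using j by (intro prod.remove) auto
    have c: "(\<Prod>t\<in>{..<n} - {j}. ent (if t < Suc j then X else Y) (dig t k) (dig t l))
        = (\<Prod>t\<in>{..<n} - {j}. ent (if t < j then X else Y) (dig t k) (dig t l))"
      "(\<Prod>t\<in>{..<n} - {j}. ent (if t < j then X else if t = j then Y - X else Y) (dig t k) (dig t l))
        = (\<Prod>t\<in>{..<n} - {j}. ent (if t < j then X else Y) (dig t k) (dig t l))"
      by (intro prod.cong; auto)+
    show "ent (T j - T (Suc j)) k l = ent (tensf (\<lambda>t. if t < j then X else if t = j then Y - X else Y)) k l"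
      using kl by (simp only: T_def ent_minus ent_tensf split c) (simp add: left_diff_distrib)
  qed (auto simp: T_def)
  have "psd_op (T 0 - T j)" if "j \<le> n" for j
    using that
  proof (induction j)
    case (Suc j)
    have "psd_op (T j - T (Suc j))"
      unfolding step[OF Suc_le_lessD[OF Suc.prems]] using d X Y le by (intro psd_tensf) auto
    with Suc have "psd_op ((T 0 - T j) + (T j - T (Suc j)))" by (intro psd_plus) auto
    then show ?case by simp
  qed simp
  from this[of n] show ?thesis by (simp add: T_def cong: tensf_cong)
qed

lemma tens_scaleR: "tens (c *\<^sub>R M) = c ^ n *\<^sub>R tens M"
  by (rule cmat_eqI'[of N]) (auto simp: ent_tensf prod.distrib)

text \<open>Test the inequality on product vectors.\<close>

lemma tens_le_cancel:
  assumes n: "0 < n" and r: "0 \<le> r" and d: "fits d \<rho>" "fits d \<sigma>" and p: "psd_op \<rho>" "psd_op \<sigma>"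
    and le: "psd_op (r ^ n *\<^sub>R tens \<sigma> - tens \<rho>)"
  shows "psd_op (r *\<^sub>R \<sigma> - \<rho>)"
proof -
  have h: "adj \<rho> = \<rho>" "adj \<sigma> = \<sigma>" using p psd_adj by auto
  obtain U l where U: "unitary d U" "r *\<^sub>R \<sigma> - \<rho> = sp d U l"
    using spectral_herm[of d "r *\<^sub>R \<sigma> - \<rho>"] d h by auto
  have q: "ent (adj U * M * U) j j = complex_of_real (qf M U j)" if "adj M = M" for M j
    using psd_diag_Im[of "adj U * M * U" j] that by (simp add: qf_def complex_eq_iff mult.assoc)
  have "0 \<le> l j" if j: "j < d" for j
  proof -
    \<comment> \<open>All digits of \<open>J\<close> are \<open>j\<close>, so column
      \<open>J\<close> of \<open>tens U\<close> is the tensor power of column \<open>j\<close> of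
      \<open>U\<close>.\<close>
    obtain J where J: "J < N" "\<forall>t<n. dig t J = j" using dig_surj[OF j] by blast
    have t: "qf (tens M) (tens U) J = qf M U j ^ n" if "fits d M" "adj M = M" for M
    proof -
      have "adj (tens U) * tens M * tens U = tens (adj U * M * U)"
        using unitary_dim[OF U(1)] that by (simp add: tensf_adj tensf_mult)
      then have "qf (tens M) (tens U) J = Re (\<Prod>t<n. ent (adj U * M * U) (dig t J) (dig t J))"
        using J by (simp add: qf_def ent_tensf)
      also have "(\<Prod>t<n. ent (adj U * M * U) (dig t J) (dig t J)) = (\<Prod>t<n. complex_of_real (qf M U j))"
        using J q[OF that(2)] by (intro prod.cong) auto
      finally show ?thesis by (simp flip: of_real_power)
    qed
    have "qf (tens \<rho>) (tens U) J \<le> r ^ n * qf (tens \<sigma>) (tens U) J"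
      using qf_mono[OF le] by (simp add: qf_scaleR)
    then have "qf \<rho> U j ^ n \<le> (r * qf \<sigma> U j) ^ n" by (simp add: t d h power_mult_distrib)
    \<comment> \<open>\<open>power_le_imp_le_base\<close> concerns successor exponents, hence its
      instance at \<open>n - 1\<close>.\<close>
    then have "qf \<rho> U j \<le> r * qf \<sigma> U j"
      using n r p power_le_imp_le_base[of "qf \<rho> U j" "n - 1" "r * qf \<sigma> U j"] by (simp add: qf_nonneg)
    moreover have "qf (r *\<^sub>R \<sigma> - \<rho>) U j = l j" unfolding U(2) using U(1) j by (rule qf_own)
    ultimately show ?thesis by (simp add: qf_minus qf_scaleR)
  qed
  then show ?thesis unfolding U(2) by (rule psd_sp)
qed

text \<open>Absolute continuity becomes an operator inequality with a constant 2^C; its n-th root is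
  the constant for a single copy.\<close>

lemma abs_cont_tens_cancel:
  assumes n: "0 < n" and d: "fits d \<rho>" "fits d \<sigma>" and p: "psd_op \<rho>" "psd_op \<sigma>" and ac: "abs_cont (tens \<rho>) (tens \<sigma>)"
  shows "abs_cont \<rho> \<sigma>"
proof -
  obtain C :: nat where C: "psd_op (2 ^ C *\<^sub>R tens \<sigma> - tens \<rho>)"
    using abs_cont_bound[OF fits_tensf fits_tensf psd_tensf psd_tensf ac] d p by blast
  have eq: "(2 powr (real C / real n)) ^ n = (2::real) ^ C"
    using n by (simp add: powr_realpow[symmetric] powr_powr)
  have "psd_op ((2 powr (real C / real n)) ^ n *\<^sub>R tens \<sigma> - tens \<rho>)"
    unfolding eq by (rule C)
  from tens_le_cancel[OF n _ d p this] have "psd_op ((2 powr (real C / real n)) *\<^sub>R \<sigma> - \<rho>)"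
    by simp
  from abs_cont_le[OF p(1) this d(1)] show ?thesis .
qed

text \<open>The product depends only on how often each digit occurs.\<close>

lemma card_prod_values: "card ((\<lambda>k. \<Prod>t<n. l (dig t k)) ` {..<N}) \<le> (n + 1) ^ d" for l :: "nat \<Rightarrow> real"
proof -
  define c where "c k = (\<lambda>j\<in>{..<d}. card {t \<in> {..<n}. dig t k = j})" for k
  define g where "g m = (\<Prod>j<d. l j ^ m j)" for m :: "nat \<Rightarrow> nat"
  have eq: "(\<Prod>t<n. l (dig t k)) = g (c k)" if k: "k < N" for k
  proof -
    have "(\<Prod>t<n. l (dig t k)) = (\<Prod>j<d. \<Prod>t\<in>{t \<in> {..<n}. dig t k = j}. l (dig t k))"
      by (rule prod.group[symmetric]) (use dig_less[OF k] in auto)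
    also have "\<dots> = (\<Prod>j<d. l j ^ card {t \<in> {..<n}. dig t k = j})" by (intro prod.cong) auto
    finally show ?thesis by (simp add: g_def c_def)
  qed
  have "(\<lambda>k. \<Prod>t<n. l (dig t k)) ` {..<N} \<subseteq> g ` ({..<d} \<rightarrow>\<^sub>E {..n})"
  proof
    fix x assume "x \<in> (\<lambda>k. \<Prod>t<n. l (dig t k)) ` {..<N}"
    then obtain k where k: "k < N" "x = g (c k)" using eq by auto
    have "card {t \<in> {..<n}. dig t k = j} \<le> n" for j
      using card_mono[of "{..<n}" "{t \<in> {..<n}. dig t k = j}"] by auto
    then have "c k \<in> {..<d} \<rightarrow>\<^sub>E {..n}" by (auto simp: c_def)
    with k show "x \<in> g ` ({..<d} \<rightarrow>\<^sub>E {..n})" by blast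
  qed
  then have "card ((\<lambda>k. \<Prod>t<n. l (dig t k)) ` {..<N}) \<le> card (g ` ({..<d} \<rightarrow>\<^sub>E {..n}))"
    by (intro card_mono finite_imageI finite_PiE) auto
  also have "\<dots> \<le> card ({..<d} \<rightarrow>\<^sub>E {..n})" by (intro card_image_le finite_PiE) auto
  also have "\<dots> = (n + 1) ^ d" by (simp add: card_PiE)
  finally show ?thesis .
qed

end

section \<open>The digit encodings of A^n and of (AB)^n\<close>

lemma digitsI:
  assumes "\<And>k t. k < N \<Longrightarrow> t < n \<Longrightarrow> dig t k < d"
    and "\<And>k l. k < N \<Longrightarrow> l < N \<Longrightarrow> (\<And>t. t < n \<Longrightarrow> dig t k = dig t l) \<Longrightarrow> k = l"
    and "N = d ^ n"
  shows "digits N n d dig"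
proof
  let ?f = "\<lambda>k. \<lambda>t\<in>{..<n}. dig t k"
  have inj: "inj_on ?f {..<N}"
  proof (rule inj_onI)
    fix k l assume "k \<in> {..<N}" "l \<in> {..<N}" and eq: "?f k = ?f l"
    moreover have "dig t k = dig t l" if "t < n" for t using fun_cong[OF eq, of t] that by simp
    ultimately show "k = l" using assms(2) by simp
  qed
  have "?f ` {..<N} = {..<n} \<rightarrow>\<^sub>E {..<d}"
  proof (rule card_subset_eq)
    show "?f ` {..<N} \<subseteq> {..<n} \<rightarrow>\<^sub>E {..<d}" using assms(1) by (auto intro!: restrict_PiE_iff[THEN iffD2])
    show "card (?f ` {..<N}) = card ({..<n} \<rightarrow>\<^sub>E {..<d})"
      using card_image[OF inj] by (simp add: card_PiE assms(3))
  qed (auto intro: finite_PiE)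
  with inj show "bij_betw ?f {..<N} ({..<n} \<rightarrow>\<^sub>E {..<d})" by (simp add: bij_betw_def)
qed

lemma digit_inj:
  assumes d: "0 < d"
  shows "k < d ^ n \<Longrightarrow> l < d ^ n \<Longrightarrow> (\<And>t. t < n \<Longrightarrow> digit d t k = digit d t l) \<Longrightarrow> k = l"
proof (induction n arbitrary: k l)
  case (Suc n)
  have "k div d = l div d"
  proof (rule Suc.IH)
    show "k div d < d ^ n" "l div d < d ^ n"
      using Suc.prems(1,2) d by (simp_all add: div_less_iff_less_mult mult.commute)
    fix t assume "t < n"
    then show "digit d t (k div d) = digit d t (l div d)"
      using Suc.prems(3)[of "Suc t"] by (simp add: digit_def div_mult2_eq)
  qed
  moreover have "k mod d = l mod d" using Suc.prems(3)[of 0] by (simp add: digit_def)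
  ultimately show ?case by (metis div_mult_mod_eq)
qed simp

lemma digits_digit: "0 < d \<Longrightarrow> digits (d ^ n) n d (digit d)"
  by (rule digitsI) (auto simp: digit_def intro: digit_inj[unfolded digit_def])

lemma digits_pair_digit:
  assumes "0 < dA" "0 < dB"
  shows "digits (dA ^ n * dB ^ n) n (dA * dB) (pair_digit dA dB n)"
proof (rule digitsI)
  have less: "i * dB + j < dA * dB" if "i < dA" "j < dB" for i j
  proof -
    have "i * dB + j < Suc i * dB" using that by simp
    also have "\<dots> \<le> dA * dB" using that by (intro mult_le_mono1) simp
    finally show ?thesis .
  qed
  show "pair_digit dA dB n t k < dA * dB" for k t
    unfolding pair_digit_def digit_def using assms by (intro less) auto
  fix k l assume kl: "k < dA ^ n * dB ^ n" "l < dA ^ n * dB ^ n"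
    and eq: "\<And>t. t < n \<Longrightarrow> pair_digit dA dB n t k = pair_digit dA dB n t l"
  have B: "0 < dB ^ n" using assms by simp
  have dl: "digit dB t m < dB" for t m using assms by (simp add: digit_def)
  have e: "digit dA t (k div dB ^ n) = digit dA t (l div dB ^ n)"
    "digit dB t (k mod dB ^ n) = digit dB t (l mod dB ^ n)" if "t < n" for t
    using arg_cong[OF eq[OF that], of "\<lambda>x. x div dB"] arg_cong[OF eq[OF that], of "\<lambda>x. x mod dB"] dl assms
    by (simp_all add: pair_digit_def)
  have "k div dB ^ n = l div dB ^ n"
    by (rule digit_inj[OF assms(1) _ _ e(1)]) (use kl B in \<open>simp_all add: div_less_iff_less_mult\<close>)
  moreover have "k mod dB ^ n = l mod dB ^ n"
    by (rule digit_inj[OF assms(2) _ _ e(2)]) (use B in simp_all)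
  ultimately show "k = l" by (metis div_mult_mod_eq)
qed (simp add: power_mult_distrib)

text \<open>Summing over one index of B^n means summing over all tuples of its digits, which
  distributes over the product of the factors.\<close>

lemma ptr_tens:
  assumes "0 < dA" "0 < dB"
  shows "ptr (dB ^ n) (digits.tensf (dA ^ n * dB ^ n) n (pair_digit dA dB n) (\<lambda>_. M))
    = digits.tensf (dA ^ n) n (digit dA) (\<lambda>_. ptr dB M)"
proof -
  interpret A: digits "dA ^ n" n dA "digit dA" using assms(1) by (rule digits_digit)
  interpret B: digits "dB ^ n" n dB "digit dB" using assms(2) by (rule digits_digit)
  interpret AB: digits "dA ^ n * dB ^ n" n "dA * dB" "pair_digit dA dB n" using assms by (rule digits_pair_digit)
  show ?thesis
  proof (rule cmat_eqI'[of "dA ^ n"])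
    fix i i' assume i: "i < dA ^ n" "i' < dA ^ n"
    have less: "x * dB ^ n + j < dA ^ n * dB ^ n" if "x < dA ^ n" "j < dB ^ n" for x j
    proof -
      have "x * dB ^ n + j < Suc x * dB ^ n" using that by simp
      also have "\<dots> \<le> dA ^ n * dB ^ n" using that by (intro mult_le_mono1) simp
      finally show ?thesis .
    qed
    have pd: "pair_digit dA dB n t (x * dB ^ n + j) = digit dA t x * dB + digit dB t j" if "j < dB ^ n" for t x j
      using that assms by (simp add: pair_digit_def)
    have "ent (ptr (dB ^ n) (AB.tens M)) i i' = (\<Sum>j<dB ^ n. \<Prod>t<n. ent M (digit dA t i * dB + digit dB t j) (digit dA t i' * dB + digit dB t j))"
      unfolding ent_ptr using i less by (intro sum.cong refl) (simp add: AB.ent_tensf pd)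
    also have "\<dots> = (\<Prod>t<n. \<Sum>j<dB. ent M (digit dA t i * dB + j) (digit dA t i' * dB + j))"
      by (rule B.sum_prod_dig)
    also have "\<dots> = ent (A.tens (ptr dB M)) i i'"
      using i by (simp add: A.ent_tensf ent_ptr)
    finally show "ent (ptr (dB ^ n) (AB.tens M)) i i' = ent (A.tens (ptr dB M)) i i'" .
  qed auto
qed

section \<open>From matrices to operators\<close>

definition opm :: "nat \<Rightarrow> complex mat \<Rightarrow> cmat" where
  "opm d M = mk d (\<lambda>i j. M $$ (i, j))"

definition mt :: "nat \<Rightarrow> cmat \<Rightarrow> complex mat" where
  "mt d A = Matrix.mat d d (\<lambda>(i, j). ent A i j)"

lemma fits_opm [simp, intro]: "fits d (opm d M)"
  by (simp add: opm_def)

lemma mt_carrier [simp, intro]: "mt d A \<in> carrier_mat d d"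
  by (simp add: mt_def)

lemma opm_mt: "fits d A \<Longrightarrow> opm d (mt d A) = A"
  by (rule cmat_eqI'[of d]) (auto simp: opm_def ent_mk mt_def)

lemma ent_opm: "i < d \<Longrightarrow> j < d \<Longrightarrow> ent (opm d M) i j = M $$ (i, j)"
  by (simp add: opm_def ent_mk)

lemma opm_inj: "A \<in> carrier_mat d d \<Longrightarrow> B \<in> carrier_mat d d \<Longrightarrow> opm d A = opm d B \<Longrightarrow> A = B"
  by (rule eq_matI) (auto dest!: arg_cong[where f = "\<lambda>X. ent X _ _"] simp: ent_opm[symmetric])

lemma mt_opm: "M \<in> carrier_mat d d \<Longrightarrow> mt d (opm d M) = M"
  by (rule opm_inj[of _ d]) (auto simp: opm_mt)

lemma opm_mult: "A \<in> carrier_mat d d \<Longrightarrow> B \<in> carrier_mat d d \<Longrightarrow> opm d (A * B) = opm d A * opm d B"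
  by (rule cmat_eqI'[of d])
    (auto simp: ent_opm ent_mult_l[OF fits_opm] scalar_prod_def atLeast0LessThan intro!: sum.cong)

lemma mat_adjoint_index: "A \<in> carrier_mat d d \<Longrightarrow> i < d \<Longrightarrow> j < d \<Longrightarrow> mat_adjoint A $$ (i, j) = cnj (A $$ (j, i))"
  by (auto simp: mat_adjoint_def mat_of_rows_def)

lemma mat_adjoint_carrier: "A \<in> carrier_mat d d \<Longrightarrow> mat_adjoint A \<in> carrier_mat d d"
  by (auto simp: mat_adjoint_def)

lemma opm_adjoint: "A \<in> carrier_mat d d \<Longrightarrow> opm d (mat_adjoint A) = adj (opm d A)"
  by (rule cmat_eqI'[of d]) (auto simp: ent_opm mat_adjoint_index)

lemma opm_one: "opm d (1\<^sub>m d) = idm d"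
  by (rule cmat_eqI'[of d]) (auto simp: ent_opm ent_dg)

lemma opm_diag: "opm d (mat_diag d l) = dg d l"
  by (rule cmat_eqI'[of d]) (auto simp: ent_opm ent_dg mat_diag_def)

lemma opm_minus: "A \<in> carrier_mat d d \<Longrightarrow> B \<in> carrier_mat d d \<Longrightarrow> opm d (A - B) = opm d A - opm d B"
  by (rule cmat_eqI'[of d]) (auto simp: ent_opm)

lemma opm_smult: "A \<in> carrier_mat d d \<Longrightarrow> opm d (complex_of_real c \<cdot>\<^sub>m A) = c *\<^sub>R opm d A"
  by (rule cmat_eqI'[of d]) (auto simp: ent_opm)

lemma mat_tr_opm: "M \<in> carrier_mat d d \<Longrightarrow> mat_tr M = tr (opm d M)"
  by (auto simp: mat_tr_def tr_eq[OF fits_opm] ent_opm intro!: sum.cong)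

lemma unitary_opm: "U \<in> carrier_mat d d \<Longrightarrow> unitary_mat d U \<longleftrightarrow> unitary d (opm d U)"
  unfolding unitary_mat_def unitary_def
  by (metis fits_opm mat_adjoint_carrier mult_carrier_mat one_carrier_mat opm_adjoint opm_inj opm_mult opm_one)

lemma spectral_carrier: "U \<in> carrier_mat d d \<Longrightarrow> U * mat_diag d f * mat_adjoint U \<in> carrier_mat d d"
  using mat_adjoint_carrier[of U d] by (intro mult_carrier_mat[of _ d d]) (auto simp: mat_diag_def)

lemma opm_spectral:
  assumes "U \<in> carrier_mat d d"
  shows "opm d (U * mat_diag d (\<lambda>i. complex_of_real (l i)) * mat_adjoint U) = sp d (opm d U) l"
proof -
  have D: "mat_diag d (\<lambda>i. complex_of_real (l i)) \<in> carrier_mat d d" by (simp add: mat_diag_def)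
  have "opm d (U * mat_diag d (\<lambda>i. complex_of_real (l i)) * mat_adjoint U)
     = opm d (U * mat_diag d (\<lambda>i. complex_of_real (l i))) * opm d (mat_adjoint U)"
    using assms D by (intro opm_mult mult_carrier_mat mat_adjoint_carrier)
  also have "opm d (U * mat_diag d (\<lambda>i. complex_of_real (l i))) = opm d U * opm d (mat_diag d (\<lambda>i. complex_of_real (l i)))"
    using assms D by (intro opm_mult)
  finally show ?thesis using assms by (simp only: opm_diag opm_adjoint sp_def)
qed

lemma mat_powr_props:
  assumes M: "M \<in> carrier_mat d d" and h: "adj (opm d M) = opm d M"
  shows "mat_powr M p \<in> carrier_mat d d" "opm d (mat_powr M p) = pw d (opm d M) p"
proof -
  obtain U l where U: "unitary d U" "opm d M = sp d U l" using spectral_herm[OF fits_opm h] by blast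
  have dr: "dim_row M = d" using M by simp
  have "mat_powr M p = mt d (pw d (opm d M) p)"
    unfolding mat_powr_def dr
  proof (rule the_equality)
    let ?U = "mt d U"
    have oU: "opm d ?U = U" using U by (simp add: opm_mt unitary_dim)
    have c: "?U * mat_diag d f * mat_adjoint ?U \<in> carrier_mat d d" for f
      by (rule spectral_carrier) simp
    have "M = ?U * mat_diag d (\<lambda>i. complex_of_real (l i)) * mat_adjoint ?U"
      by (rule opm_inj[OF M c]) (simp only: opm_spectral[OF mt_carrier] oU U)
    moreover have "mt d (pw d (opm d M) p) = ?U * mat_diag d (\<lambda>i. complex_of_real (l i powr p)) * mat_adjoint ?U"
      by (rule opm_inj[OF mt_carrier c])
        (simp only: opm_spectral[OF mt_carrier] oU opm_mt fits_pw[OF fits_opm h], simp only: U pw_sp)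
    moreover have "unitary_mat d ?U" using U oU by (simp add: unitary_opm)
    ultimately show "\<exists>U l. unitary_mat d U \<and> M = U * mat_diag d (\<lambda>i. complex_of_real (l i)) * mat_adjoint U
        \<and> mt d (pw d (opm d M) p) = U * mat_diag d (\<lambda>i. complex_of_real (l i powr p)) * mat_adjoint U"
      by blast
    fix X
    assume "\<exists>U l. unitary_mat d U \<and> M = U * mat_diag d (\<lambda>i. complex_of_real (l i)) * mat_adjoint U
        \<and> X = U * mat_diag d (\<lambda>i. complex_of_real (l i powr p)) * mat_adjoint U"
    then obtain W m where W: "unitary_mat d W" "M = W * mat_diag d (\<lambda>i. complex_of_real (m i)) * mat_adjoint W"
      "X = W * mat_diag d (\<lambda>i. complex_of_real (m i powr p)) * mat_adjoint W" by blast
    have Wc: "W \<in> carrier_mat d d" using W(1) by (simp add: unitary_mat_def)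
    have u: "unitary d (opm d W)" using W(1) unitary_opm[OF Wc] by simp
    have X: "X \<in> carrier_mat d d"
      unfolding W(3) using Wc by (rule spectral_carrier)
    have oM: "opm d M = sp d (opm d W) m" unfolding W(2) by (rule opm_spectral[OF Wc])
    have "opm d X = sp d (opm d W) (\<lambda>i. m i powr p)" unfolding W(3) by (rule opm_spectral[OF Wc])
    also have "\<dots> = pw d (opm d M) p" unfolding oM by (rule pw_sp[OF u, symmetric])
    finally have "opm d X = pw d (opm d M) p" .
    then show "X = mt d (pw d (opm d M) p)" using mt_opm[OF X] by simp
  qed
  then show "mat_powr M p \<in> carrier_mat d d" "opm d (mat_powr M p) = pw d (opm d M) p"
    by (simp_all add: opm_mt fits_pw[OF fits_opm h])
qed

definition colop :: "nat \<Rightarrow> complex Matrix.vec \<Rightarrow> cmat" where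
  "colop d v = mk (Suc d) (\<lambda>i j. if j = 0 \<and> i < d then vec_index v i else 0)"

lemma ent_colop: "ent (colop d v) i j = (if i < d \<and> j = 0 then vec_index v i else 0)"
  by (auto simp: colop_def ent_mk)

lemma ent_quad: "fits d M \<Longrightarrow> ent (adj V * M * V) j j = (\<Sum>i<d. cnj (ent V i j) * (\<Sum>k<d. ent M i k * ent V k j))"
proof -
  assume M: "fits d M"
  have "ent (adj V * (M * V)) j j = (\<Sum>i<d. ent (adj V) j i * ent (M * V) i j)"
    by (rule ent_mult_aux) (use M in \<open>simp add: ent_mult_l[OF M] fits_def\<close>)
  then show ?thesis using M by (simp add: ent_mult_l mult.assoc)
qed

lemma mult_mat_vec_index: "M \<in> carrier_mat d d \<Longrightarrow> v \<in> carrier_vec d \<Longrightarrow> i < d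
   \<Longrightarrow> vec_index (M *\<^sub>v v) i = (\<Sum>k<d. M $$ (i, k) * vec_index v k)"
  by (auto simp: scalar_prod_def atLeast0LessThan intro!: sum.cong)

lemma quad_form_opm:
  assumes "M \<in> carrier_mat d d" "v \<in> carrier_vec d"
  shows "(M *\<^sub>v v) \<bullet>c v = (\<Sum>i<d. cnj (vec_index v i) * (\<Sum>k<d. ent (opm d M) i k * vec_index v k))"
proof -
  have "(M *\<^sub>v v) \<bullet>c v = (\<Sum>i<d. vec_index (M *\<^sub>v v) i * cnj (vec_index v i))"
    using assms by (auto simp: scalar_prod_def atLeast0LessThan intro!: sum.cong)
  also have "\<dots> = (\<Sum>i<d. cnj (vec_index v i) * (\<Sum>k<d. ent (opm d M) i k * vec_index v k))"
    using assms by (intro sum.cong) (auto simp: mult_mat_vec_index ent_opm mult.commute simp del: index_mult_mat_vec)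
  finally show ?thesis .
qed

lemma psd_opm: "psd d M \<longleftrightarrow> M \<in> carrier_mat d d \<and> psd_op (opm d M)"
proof (cases "M \<in> carrier_mat d d")
  case M: True
  have 1: "mat_adjoint M = M \<longleftrightarrow> adj (opm d M) = opm d M"
    using M mat_adjoint_carrier opm_adjoint opm_inj by metis
  have 2: "(\<forall>v\<in>carrier_vec d. 0 \<le> Re ((M *\<^sub>v v) \<bullet>c v)) \<longleftrightarrow> (\<forall>V j. 0 \<le> Re (ent (adj V * opm d M * V) j j))"
  proof (intro iffI allI ballI)
    fix V j assume a: "\<forall>v\<in>carrier_vec d. 0 \<le> Re ((M *\<^sub>v v) \<bullet>c v)"
    define v where "v = Matrix.vec d (\<lambda>i. ent V i j)"
    have v: "v \<in> carrier_vec d" by (simp add: v_def)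
    have "(M *\<^sub>v v) \<bullet>c v = ent (adj V * opm d M * V) j j"
      unfolding quad_form_opm[OF M v] ent_quad[OF fits_opm] by (auto simp: v_def intro!: sum.cong)
    then show "0 \<le> Re (ent (adj V * opm d M * V) j j)" using a v by metis
  next
    fix v :: "complex Matrix.vec" assume a: "\<forall>V j. 0 \<le> Re (ent (adj V * opm d M * V) j j)" and v: "v \<in> carrier_vec d"
    have "(M *\<^sub>v v) \<bullet>c v = ent (adj (colop d v) * opm d M * colop d v) 0 0"
      unfolding quad_form_opm[OF M v] ent_quad[OF fits_opm] by (auto simp: ent_colop intro!: sum.cong)
    then show "0 \<le> Re ((M *\<^sub>v v) \<bullet>c v)" using a by metis
  qed
  show ?thesis using M 1 2 by (simp add: psd_def psd_op_def)
qed (simp add: psd_def)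

lemma kernel_opm:
  assumes M: "M \<in> carrier_mat d d" and v: "v \<in> carrier_vec d"
  shows "v \<in> mat_kernel M \<longleftrightarrow> opm d M * colop d v = 0"
proof -
  have e: "ent (opm d M * colop d v) i j = (if i < d \<and> j = 0 then vec_index (M *\<^sub>v v) i else 0)" for i j
  proof -
    have "ent (opm d M * colop d v) i j = (\<Sum>k<d. ent (opm d M) i k * ent (colop d v) k j)"
      by (rule ent_mult_l[OF fits_opm])
    also have "\<dots> = (if i < d \<and> j = 0 then \<Sum>k<d. M $$ (i, k) * vec_index v k else 0)"
      by (auto simp: ent_colop opm_def ent_mk)
    finally show ?thesis using mult_mat_vec_index[OF M v] by auto
  qed
  have "v \<in> mat_kernel M \<longleftrightarrow> M *\<^sub>v v = 0\<^sub>v d" using M v by (auto simp: mat_kernel_def)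
  also have "\<dots> \<longleftrightarrow> (\<forall>i<d. vec_index (M *\<^sub>v v) i = 0)"
  proof
    assume "\<forall>i<d. vec_index (M *\<^sub>v v) i = 0"
    then show "M *\<^sub>v v = 0\<^sub>v d" using M by (intro eq_vecI) auto
  qed auto
  also have "\<dots> \<longleftrightarrow> opm d M * colop d v = 0"
  proof
    assume "\<forall>i<d. vec_index (M *\<^sub>v v) i = 0"
    then show "opm d M * colop d v = 0" by (intro cmat_eqI) (simp only: e ent_0, auto)
  next
    assume z: "opm d M * colop d v = 0"
    show "\<forall>i<d. vec_index (M *\<^sub>v v) i = 0"
    proof (intro allI impI)
      fix i assume "i < d"
      then show "vec_index (M *\<^sub>v v) i = 0" using e[of i 0] by (simp only: z ent_0 if_True simp_thms)
    qed
  qed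
  finally show ?thesis .
qed

text \<open>Supports are orthogonal complements of kernels. If v lies in the kernel of \<sigma>,
  then \<rho> v lies in the support of \<rho>, hence in that of \<sigma>, and is orthogonal to v;
  positivity then gives \<rho> v = 0.\<close>

lemma supp_opm:
  assumes \<rho>: "psd d \<rho>" and \<sigma>: "psd d \<sigma>"
  shows "mat_supp \<rho> \<subseteq> mat_supp \<sigma> \<longleftrightarrow> abs_cont (opm d \<rho>) (opm d \<sigma>)"
proof -
  have c: "\<rho> \<in> carrier_mat d d" "\<sigma> \<in> carrier_mat d d" and p: "psd_op (opm d \<rho>)" "psd_op (opm d \<sigma>)"
    using \<rho> \<sigma> by (auto simp: psd_opm)
  have ker_carrier: "v \<in> mat_kernel A \<Longrightarrow> v \<in> carrier_vec d" if "A \<in> carrier_mat d d" for A :: "complex mat" and v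
    using that by (auto simp: mat_kernel_def)
  show ?thesis
  proof
    assume ac: "abs_cont (opm d \<rho>) (opm d \<sigma>)"
    have "mat_kernel \<sigma> \<subseteq> mat_kernel \<rho>"
    proof
      fix v assume v: "v \<in> mat_kernel \<sigma>"
      then show "v \<in> mat_kernel \<rho>"
        using ac kernel_opm[OF c(1)] kernel_opm[OF c(2)] ker_carrier[OF c(2) v] unfolding abs_cont_def by blast
    qed
    then show "mat_supp \<rho> \<subseteq> mat_supp \<sigma>" using c by (auto simp: mat_supp_def)
  next
    assume sub: "mat_supp \<rho> \<subseteq> mat_supp \<sigma>"
    have ker: "opm d \<rho> * colop d v = 0" if v: "v \<in> carrier_vec d" and z: "opm d \<sigma> * colop d v = 0" for v
    proof -
      have v\<sigma>: "v \<in> mat_kernel \<sigma>" using kernel_opm[OF c(2) v] z by simp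
      have "\<rho> *\<^sub>v v \<in> mat_supp \<rho>"
        unfolding mat_supp_def
      proof (intro CollectI conjI ballI)
        show "\<rho> *\<^sub>v v \<in> carrier_vec (dim_col \<rho>)" using c v by auto
        fix w assume w: "w \<in> mat_kernel \<rho>"
        have wc: "w \<in> carrier_vec d" using ker_carrier[OF c(1) w] .
        have "(\<rho> *\<^sub>v v) \<bullet>c w = (\<Sum>i<d. (\<Sum>k<d. \<rho> $$ (i, k) * vec_index v k) * cnj (vec_index w i))"
          using c v wc by (auto simp: scalar_prod_def[of "\<rho> *\<^sub>v v"] atLeast0LessThan mult_mat_vec_index simp del: index_mult_mat_vec intro!: sum.cong)
        also have "\<dots> = (\<Sum>k<d. vec_index v k * cnj (\<Sum>i<d. \<rho> $$ (k, i) * vec_index w i))"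
        proof -
          have h: "cnj (\<rho> $$ (k, i)) = \<rho> $$ (i, k)" if "i < d" "k < d" for i k
            using arg_cong[OF psd_adj[OF p(1)], of "\<lambda>A. ent A i k"] that by (simp add: ent_opm)
          have "(\<Sum>i<d. (\<Sum>k<d. \<rho> $$ (i, k) * vec_index v k) * cnj (vec_index w i))
             = (\<Sum>i<d. \<Sum>k<d. vec_index v k * cnj (\<rho> $$ (k, i) * vec_index w i))"
            unfolding sum_distrib_right by (intro sum.cong refl) (simp add: h mult_ac)
          also have "\<dots> = (\<Sum>k<d. \<Sum>i<d. vec_index v k * cnj (\<rho> $$ (k, i) * vec_index w i))"
            by (rule sum.swap)
          finally show ?thesis by (simp only: cnj_sum sum_distrib_left)
        qed
        also have "\<dots> = (\<Sum>k<d. vec_index v k * cnj (vec_index (\<rho> *\<^sub>v w) k))"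
          using c wc by (intro sum.cong refl) (simp add: mult_mat_vec_index del: index_mult_mat_vec)
        also have "\<dots> = 0"
          using w c by (auto simp: mat_kernel_def simp del: index_mult_mat_vec intro!: sum.neutral)
        finally show "(\<rho> *\<^sub>v v) \<bullet>c w = 0" .
      qed
      then have "\<rho> *\<^sub>v v \<in> mat_supp \<sigma>" using sub by blast
      then have "(\<rho> *\<^sub>v v) \<bullet>c v = 0" using v\<sigma> by (simp add: mat_supp_def)
      then have 0: "ent (adj (colop d v) * opm d \<rho> * colop d v) 0 0 = 0"
        unfolding quad_form_opm[OF c(1) v] ent_quad[OF fits_opm] by (auto simp: ent_colop)
      have "adj (colop d v) * opm d \<rho> * colop d v = 0"
      proof (rule cmat_eqI)
        fix i j
        have dc: "fits (Suc d) (colop d v)" by (simp add: colop_def)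
        have "i \<noteq> 0 \<Longrightarrow> ent (adj (colop d v) * (opm d \<rho> * colop d v)) i j = 0"
          by (simp add: ent_gram[OF dc] ent_colop)
        moreover have "j \<noteq> 0 \<Longrightarrow> ent (adj (colop d v) * opm d \<rho> * colop d v) i j = 0"
          by (simp add: ent_mult_r[OF dc] ent_colop)
        ultimately show "ent (adj (colop d v) * opm d \<rho> * colop d v) i j = ent 0 i j"
          using 0 by (cases "i = 0"; cases "j = 0") (auto simp: mult.assoc)
      qed
      then show ?thesis by (rule psd_sandwich_eq_0[OF fits_opm p(1)])
    qed
    show "abs_cont (opm d \<rho>) (opm d \<sigma>)"
      unfolding abs_cont_def
    proof (intro allI impI)
      fix V assume 0: "opm d \<sigma> * V = 0"
      show "opm d \<rho> * V = 0"
      proof (rule cmat_eqI)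
        fix i j
        define v where "v = Matrix.vec d (\<lambda>i. ent V i j)"
        have col: "ent (opm d M * V) i j = ent (opm d M * colop d v) i 0" for M i
          by (simp add: ent_mult_l[OF fits_opm] ent_colop v_def)
        have "opm d \<sigma> * colop d v = 0"
        proof (rule cmat_eqI)
          fix i' j'
          show "ent (opm d \<sigma> * colop d v) i' j' = ent 0 i' j'"
            using col[of \<sigma> i'] 0 by (cases "j' = 0") (auto simp: ent_mult_l[OF fits_opm] ent_colop)
        qed
        then have "opm d \<rho> * colop d v = 0" by (intro ker) (simp add: v_def)
        then show "ent (opm d \<rho> * V) i j = ent 0 i j" by (simp add: col)
      qed
    qed
  qed
qed

section \<open>Divergences, partial traces and tensor powers in operator form\<close>

lemma D_sandwiched_opm:
  assumes "psd d \<rho>" "psd d \<sigma>"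
  shows "D_sandwiched a \<rho> \<sigma> = (if a < 1 \<or> abs_cont (opm d \<rho>) (opm d \<sigma>)
    then ereal (1 / (a - 1)) * elog2 (Qren d a (opm d \<rho>) (opm d \<sigma>)) else \<infinity>)"
proof -
  have c: "\<rho> \<in> carrier_mat d d" "\<sigma> \<in> carrier_mat d d" and p: "psd_op (opm d \<rho>)" "psd_op (opm d \<sigma>)"
    using assms by (auto simp: psd_opm)
  let ?T = "mat_powr \<sigma> ((1 - a) / (2 * a))"
  note T = mat_powr_props[OF c(2) psd_adj[OF p(2)], of "(1 - a) / (2 * a)"]
  have TT: "adj (opm d ?T) = opm d ?T"
    using T p adj_pw[OF fits_opm psd_adj[OF p(2)]] by auto
  have X: "?T * \<rho> * ?T \<in> carrier_mat d d" using T c by (meson mult_carrier_mat)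
  have oX: "opm d (?T * \<rho> * ?T) = opm d ?T * opm d \<rho> * opm d ?T"
    using T c by (simp add: opm_mult[of _ d] mult_carrier_mat[of _ d d] mult.assoc)
  have "psd_op (opm d (?T * \<rho> * ?T))" unfolding oX using p TT by (intro psd_sandwich')
  note P = mat_powr_props[OF X psd_adj[OF this], of a]
  have "mat_tr (mat_powr (?T * \<rho> * ?T) a) = tr (pw d (opm d (?T * \<rho> * ?T)) a)"
    using mat_tr_opm[OF P(1)] P(2) by simp
  then have "Re (mat_tr (mat_powr (?T * \<rho> * ?T) a)) = Qren d a (opm d \<rho>) (opm d \<sigma>)"
    by (simp only: oX T(2) Qren_def trp_def)
  then show ?thesis unfolding D_sandwiched_def supp_opm[OF assms] by simp
qed

lemma D_max_opm:
  assumes "\<rho> \<in> carrier_mat d d" "\<sigma> \<in> carrier_mat d d"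
  shows "D_max \<rho> \<sigma> = Inf (ereal ` {r. psd_op (2 powr r *\<^sub>R opm d \<sigma> - opm d \<rho>)})"
proof -
  have "psd (dim_row \<rho>) (complex_of_real (2 powr r) \<cdot>\<^sub>m \<sigma> - \<rho>) \<longleftrightarrow> psd_op (2 powr r *\<^sub>R opm d \<sigma> - opm d \<rho>)" for r
  proof -
    have c: "complex_of_real (2 powr r) \<cdot>\<^sub>m \<sigma> - \<rho> \<in> carrier_mat d d" using assms by auto
    have "opm d (complex_of_real (2 powr r) \<cdot>\<^sub>m \<sigma> - \<rho>) = 2 powr r *\<^sub>R opm d \<sigma> - opm d \<rho>"
      using assms by (simp add: opm_minus opm_smult)
    then show ?thesis using c assms by (simp add: psd_opm)
  qed
  then show ?thesis by (simp add: D_max_def)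
qed

lemma opm_partial_trace: "opm dA (partial_trace dA dB M) = ptr dB (opm (dA * dB) M)"
proof (rule cmat_eqI'[of dA])
  fix i i' assume i: "i < dA" "i' < dA"
  have less: "x * dB + j < dA * dB" if "x < dA" "j < dB" for x j
  proof -
    have "x * dB + j < Suc x * dB" using that by simp
    also have "\<dots> \<le> dA * dB" using that by (intro mult_le_mono1) simp
    finally show ?thesis .
  qed
  show "ent (opm dA (partial_trace dA dB M)) i i' = ent (ptr dB (opm (dA * dB) M)) i i'"
    using i less by (simp add: ent_opm partial_trace_def ent_ptr)
qed auto

lemma partial_trace_carrier: "partial_trace dA dB M \<in> carrier_mat dA dA"
  by (simp add: partial_trace_def)

lemma opm_tensor_power:
  assumes "0 < d"
  shows "opm (d ^ n) (tensor_power d n M) = digits.tensf (d ^ n) n (digit d) (\<lambda>_. opm d M)"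
proof -
  interpret digits "d ^ n" n d "digit d" using assms by (rule digits_digit)
  show ?thesis
    by (rule cmat_eqI'[of "d ^ n"]) (auto simp: ent_opm tensor_power_def ent_tensf dig_less intro!: prod.cong)
qed

lemma opm_bipartite_tensor_power:
  assumes "0 < dA" "0 < dB"
  shows "opm (dA ^ n * dB ^ n) (bipartite_tensor_power dA dB n M)
    = digits.tensf (dA ^ n * dB ^ n) n (pair_digit dA dB n) (\<lambda>_. opm (dA * dB) M)"
proof -
  interpret digits "dA ^ n * dB ^ n" n "dA * dB" "pair_digit dA dB n" using assms by (rule digits_pair_digit)
  show ?thesis
    by (rule cmat_eqI'[of "dA ^ n * dB ^ n"])
      (auto simp: ent_opm bipartite_tensor_power_def ent_tensf dig_less intro!: prod.cong)
qed

lemma density_opm: "\<rho> \<in> density d \<longleftrightarrow> \<rho> \<in> carrier_mat d d \<and> psd_op (opm d \<rho>) \<and> tr (opm d \<rho>) = 1"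
  using mat_tr_opm[of \<rho> d] by (auto simp: density_def psd_opm)

section \<open>Asymptotics\<close>

lemma powr_neg_mult_le:
  fixes q \<delta> :: real
  assumes "0 < q" "0 < \<delta>"
  shows "\<exists>C0::nat. \<forall>C\<ge>C0. 2 powr (- real C * \<delta>) \<le> q"
proof -
  obtain C0 :: nat where C0: "- log 2 q / \<delta> \<le> real C0" using real_arch_simple by blast
  have "2 powr (- real C * \<delta>) \<le> q" if "C0 \<le> C" for C
  proof -
    have "- log 2 q \<le> real C0 * \<delta>" using C0 assms by (simp add: field_simps)
    also have "\<dots> \<le> real C * \<delta>" using that assms by (intro mult_right_mono) auto
    finally have "2 powr (- real C * \<delta>) \<le> 2 powr (log 2 q)" by (intro powr_mono) auto
    then show ?thesis using assms by simp
  qed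
  then show ?thesis by blast
qed

lemma powr_neg_mult_pow: "2 powr (- real (C * n) * \<delta>) = (2 powr (- real C * \<delta>)) ^ n"
  by (cases "n = 0") (simp_all add: powr_realpow[symmetric] powr_powr mult_ac)

locale iid =
  fixes dA dB :: nat and \<rho> \<sigma> :: cmat
  assumes dA: "0 < dA" and dB: "0 < dB"
    and \<rho>: "fits (dA * dB) \<rho>" "psd_op \<rho>" "tr \<rho> = 1"
    and \<sigma>: "fits dA \<sigma>" "psd_op \<sigma>" "tr \<sigma> = 1"
begin

abbreviation "\<rho>A \<equiv> ptr dB \<rho>"

definition Dn :: "nat \<Rightarrow> nat" where "Dn n = dA ^ n * dB ^ n"

definition rn :: "nat \<Rightarrow> cmat" where
  "rn n = digits.tensf (dA ^ n * dB ^ n) n (pair_digit dA dB n) (\<lambda>_. \<rho>)"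

definition sn :: "nat \<Rightarrow> cmat" where
  "sn n = digits.tensf (dA ^ n) n (digit dA) (\<lambda>_. \<sigma>)"

definition an :: "nat \<Rightarrow> cmat" where
  "an n = digits.tensf (dA ^ n) n (digit dA) (\<lambda>_. \<rho>A)"

text \<open>Trace one follows from the prescribed marginal, see \<open>tr_exts\<close>.\<close>

definition exts :: "nat \<Rightarrow> cmat set" where
  "exts n = {\<tau>. fits (Dn n) \<tau> \<and> psd_op \<tau> \<and> ptr (dB ^ n) \<tau> = sn n}"

lemma digs: "digits (dA ^ n) n dA (digit dA)" "digits (dA ^ n * dB ^ n) n (dA * dB) (pair_digit dA dB n)"
  using digits_digit[OF dA] digits_pair_digit[OF dA dB] by auto

lemma \<rho>A: "fits dA \<rho>A" "psd_op \<rho>A" "tr \<rho>A = 1"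
  using \<rho> dB psd_ptr tr_ptr[OF \<rho>(1)] by auto

lemma ptr_rn: "ptr (dB ^ n) (rn n) = an n"
  unfolding rn_def an_def by (rule ptr_tens[OF dA dB])

lemma rn_props: "fits (Dn n) (rn n)" "psd_op (rn n)" "tr (rn n) = 1"
proof -
  interpret digits "dA ^ n * dB ^ n" n "dA * dB" "pair_digit dA dB n" by (rule digs)
  show "fits (Dn n) (rn n)" "psd_op (rn n)" "tr (rn n) = 1"
    using \<rho> by (auto simp: rn_def Dn_def tr_tensf intro!: psd_tensf)
qed

lemma sn_props: "fits (dA ^ n) (sn n)" "psd_op (sn n)" "tr (sn n) = 1"
  and an_props: "fits (dA ^ n) (an n)" "psd_op (an n)"
  and Qren_n: "Qren (dA ^ n) a (an n) (sn n) = Qren dA a \<rho>A \<sigma> ^ n"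
proof -
  interpret digits "dA ^ n" n dA "digit dA" by (rule digs)
  show "fits (dA ^ n) (sn n)" "psd_op (sn n)" "tr (sn n) = 1" "fits (dA ^ n) (an n)" "psd_op (an n)"
    using \<sigma> \<rho>A by (auto simp: sn_def an_def tr_tensf intro!: psd_tensf)
  show "Qren (dA ^ n) a (an n) (sn n) = Qren dA a \<rho>A \<sigma> ^ n"
    unfolding an_def sn_def using \<rho>A \<sigma> by (intro Qren_tens) auto
qed

lemma tr_exts: "\<tau> \<in> exts n \<Longrightarrow> tr \<tau> = 1"
  using tr_ptr[of "dA ^ n" "dB ^ n" \<tau>] sn_props(3) by (auto simp: exts_def Dn_def)

text \<open>The range \<open>L\<close> of the bins does not occur in the assumptions of the locale,
  so the same basis can be interpreted with any \<open>L\<close> later on. The eigenvalues are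
  counted in the product basis.\<close>

lemma ex_bipartite:
  obtains V r s where "bipartite (dA ^ n) (dB ^ n) (rn n) (sn n) V r s"
    "card (s ` {..<dA ^ n}) \<le> (n + 1) ^ dA"
proof -
  interpret digits "dA ^ n" n dA "digit dA" by (rule digs)
  obtain U l where U: "unitary dA U" "\<sigma> = sp dA U l" using spectral_psd \<sigma>(1,2) by blast
  let ?l = "\<lambda>k. \<Prod>t<n. l (digit dA t k)"
  have "sn n = tens (sp dA U l)" by (simp only: sn_def U(2)[symmetric])
  also have "\<dots> = sp (dA ^ n) (tens U) ?l" by (rule tensf_sp[OF U(1)])
  finally have snU: "sn n = sp (dA ^ n) (tens U) ?l" .
  obtain V r s where V: "unitary (dA ^ n) V" "sn n = sp (dA ^ n) V s" "\<And>i. 0 \<le> s i" "\<And>i. 0 \<le> r i"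
    "s ` {..<dA ^ n} = ?l ` {..<dA ^ n}"
    "pinch (s ` {..<dA ^ n}) (\<lambda>x. sp (dA ^ n) V (\<lambda>i. if s i = x then 1 else 0)) (an n) = sp (dA ^ n) V r"
    by (rule joint_eigenbasis[OF an_props(1) sn_props(1) an_props(2) sn_props(2) unitary_tensf[OF U(1)] snU],
        rule that, assumption+)
  have "bipartite (dA ^ n) (dB ^ n) (rn n) (sn n) V r s"
    by unfold_locales
      (use V an_props rn_props[of n] sn_props[of n] dB in \<open>simp_all add: ptr_rn Dn_def\<close>)
  moreover have "card (s ` {..<dA ^ n}) \<le> (n + 1) ^ dA"
    unfolding V(5) by (rule card_prod_values)
  ultimately show thesis by (rule that)
qed

text \<open>With \<open>L = C * n\<close> there are at most (n+1)^dA eigenvalues and 2 C n + 2 bins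
  for each of them; this is a product bound for all the pairs.\<close>

definition Wn :: "nat \<Rightarrow> nat \<Rightarrow> real" where
  "Wn C n = real (2 * C + 2) * real (n + 1) ^ (dA + 1)"

lemma Wn_ge_1: "1 \<le> Wn C n"
proof -
  have "1 \<le> real (n + 1) ^ (dA + 1)" by (rule one_le_power) simp
  then have "1 * 1 \<le> real (2 * C + 2) * real (n + 1) ^ (dA + 1)" by (intro mult_mono) auto
  then show ?thesis by (simp add: Wn_def)
qed

lemma card_bounds:
  assumes "bipartite (dA ^ n) (dB ^ n) (rn n) (sn n) V r s" "card (s ` {..<dA ^ n}) \<le> (n + 1) ^ dA"
  shows "real (card (s ` {..<dA ^ n})) \<le> Wn C n" "real (card (bipartite.Sk (dA ^ n) s (C * n))) \<le> Wn C n"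
proof -
  have le: "real (card (s ` {..<dA ^ n})) \<le> real (n + 1) ^ dA"
    using assms(2) by (metis of_nat_le_iff of_nat_power)
  have "real (n + 1) ^ dA * (2 * real (C * n) + 2) \<le> real (n + 1) ^ dA * (real (2 * C + 2) * real (n + 1))"
    by (intro mult_left_mono) (auto simp: algebra_simps)
  then have W: "real (n + 1) ^ dA * (2 * real (C * n) + 2) \<le> Wn C n"
    by (simp add: Wn_def mult_ac)
  have "real (card (bipartite.Sk (dA ^ n) s (C * n))) = real (card (s ` {..<dA ^ n})) * (2 * real (C * n) + 2)"
    using bipartite.card_Sk[OF assms(1)] by (simp add: algebra_simps)
  also have "\<dots> \<le> real (n + 1) ^ dA * (2 * real (C * n) + 2)" using le by (intro mult_right_mono) auto
  finally show "real (card (bipartite.Sk (dA ^ n) s (C * n))) \<le> Wn C n" using W by simp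
  have "real (n + 1) ^ dA * 1 \<le> Wn C n"
    by (rule order_trans[OF _ W], intro mult_left_mono) auto
  with le show "real (card (s ` {..<dA ^ n})) \<le> Wn C n" by (simp only: mult_1_right)
qed

lemma powr_le_base: "1 \<le> W \<Longrightarrow> 0 \<le> x \<Longrightarrow> x \<le> W \<Longrightarrow> 0 \<le> e \<Longrightarrow> e \<le> 1 \<Longrightarrow> x powr e \<le> W" for x W e :: real
  using powr_mono2[of e x W] powr_mono[of e 1 W] by auto

text \<open>In the bound for every extension, one factor \<open>Wn C n\<close> pays for the bins and
  one for passing between \<open>Mren\<close> and \<open>Qren\<close>.\<close>

lemma asym_lt:
  assumes a: "1 / 2 \<le> a" "a < 1" and Q: "0 < Qren dA a \<rho>A \<sigma>"
  shows "\<exists>C. \<forall>n>0. (\<forall>\<tau>\<in>exts n. Qren (Dn n) a (rn n) \<tau> \<le> 4 * Wn C n powr 2 * Qren dA a \<rho>A \<sigma> ^ n)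
     \<and> (\<exists>\<tau>\<in>exts n. Qren dA a \<rho>A \<sigma> ^ n \<le> 4 * Wn C n powr 2 * Qren (Dn n) a (rn n) \<tau>)"
proof -
  let ?Q = "Qren dA a \<rho>A \<sigma>"
  \<comment> \<open>A quarter for each of the two truncation errors: together they take at most half
    of \<open>?Q ^ n\<close>, which can be moved to the other side.\<close>
  obtain C1 C2 where "\<forall>C\<ge>C1. 2 powr (- real C * a) \<le> ?Q / 4" "\<forall>C\<ge>C2. 2 powr (- real C * (1 - a)) \<le> ?Q / 4"
    using powr_neg_mult_le[of "?Q / 4" a] powr_neg_mult_le[of "?Q / 4" "1 - a"] Q a by auto
  then have C: "2 powr (- real (max C1 C2) * a) \<le> ?Q / 4" "2 powr (- real (max C1 C2) * (1 - a)) \<le> ?Q / 4"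
    by (meson max.cobounded1 max.cobounded2)+
  define C where "C = max C1 C2"
  have small: "2 powr (- real (C * n) * e) \<le> ?Q ^ n / 4" if "0 < n" "2 powr (- real C * e) \<le> ?Q / 4" for n e
  proof -
    have "2 powr (- real (C * n) * e) \<le> (?Q / 4) ^ n"
      unfolding powr_neg_mult_pow using that by (intro power_mono) auto
    also have "\<dots> = ?Q ^ n / 4 ^ n" by (simp add: power_divide)
    also have "\<dots> \<le> ?Q ^ n / 4 ^ 1"
      using Q that by (intro divide_left_mono power_increasing) auto
    finally show ?thesis by simp
  qed
  show ?thesis
  proof (intro exI[of _ C] allI impI)
    fix n :: nat assume n: "0 < n"
    obtain V r s where V: "bipartite (dA ^ n) (dB ^ n) (rn n) (sn n) V r s"
      "card (s ` {..<dA ^ n}) \<le> (n + 1) ^ dA" using ex_bipartite by blast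
    interpret B: bipartite "dA ^ n" "dB ^ n" "rn n" "sn n" V r s "C * n" by (rule V)
    note card = card_bounds[OF V]
    define W where "W = Wn C n"
    have W: "1 \<le> W" unfolding W_def by (rule Wn_ge_1)
    have W2: "W powr 2 = W * W" using W by (simp add: powr_numeral power2_eq_square)
    have v: "B.Nk powr e \<le> W" "real (card B.\<Lambda>) powr e \<le> W" if "0 \<le> e" "e \<le> 1" for e
      using powr_le_base[OF W _ _ that] card by (auto simp: W_def)
    have QM: "?Q ^ n \<le> B.Mren a" "B.Mren a \<le> real (card B.\<Lambda>) powr (1 - a) * ?Q ^ n"
      using B.Qren_le_lt[of a] B.Mren_le_lt[of a] a by (simp_all add: ptr_rn Qren_n)
    have e1: "2 powr (- real (C * n) * a) \<le> ?Q ^ n / 4" "2 powr (- real (C * n) * (1 - a)) \<le> ?Q ^ n / 4"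
      using small[OF n] C by (auto simp: C_def)
    have Qn: "0 < ?Q ^ n" using Q by simp
    have two: "2 powr (1 - a) \<le> (2::real)" using powr_mono[of "1 - a" 1 2] a by simp
    show "(\<forall>\<tau>\<in>exts n. Qren (Dn n) a (rn n) \<tau> \<le> 4 * Wn C n powr 2 * ?Q ^ n)
     \<and> (\<exists>\<tau>\<in>exts n. ?Q ^ n \<le> 4 * Wn C n powr 2 * Qren (Dn n) a (rn n) \<tau>)"
    proof (intro conjI ballI)
      fix \<tau> assume "\<tau> \<in> exts n"
      then have \<tau>: "fits (dA ^ n * dB ^ n) \<tau>" "psd_op \<tau>" "ptr (dB ^ n) \<tau> = sn n" by (auto simp: exts_def Dn_def)
      have "B.Mren a \<le> W * ?Q ^ n"
        by (rule order_trans[OF QM(2)], intro mult_right_mono v) (use a Qn in auto)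
      then have "2 powr (1 - a) * B.Mren a \<le> 2 * (W * ?Q ^ n)"
        using two QM(1) Qn by (intro mult_mono) auto
      then have s1: "2 powr (1 - a) * B.Mren a + 2 powr (- real (C * n) * a) + 2 powr (- real (C * n) * (1 - a)) \<le> 4 * (W * ?Q ^ n)"
        using e1 mult_right_mono[OF W less_imp_le[OF Qn]] Qn by linarith
      have "Qren (Dn n) a (rn n) \<tau> \<le> B.Nk powr a * (2 powr (1 - a) * B.Mren a + 2 powr (- real (C * n) * a) + 2 powr (- real (C * n) * (1 - a)))"
        unfolding Dn_def by (rule B.lower_lt[OF \<tau> a])
      also have "\<dots> \<le> W * (4 * (W * ?Q ^ n))"
        using v(1)[of a] a s1 W QM(1) Qn by (intro mult_mono) (auto intro!: add_nonneg_nonneg mult_nonneg_nonneg)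
      finally show "Qren (Dn n) a (rn n) \<tau> \<le> 4 * Wn C n powr 2 * ?Q ^ n"
        by (simp add: W_def[symmetric] W2 mult_ac)
    next
      have ext: "B.ext \<in> exts n" using B.ext_props by (simp add: exts_def Dn_def)
      let ?q = "Qren (dA ^ n * dB ^ n) a (rn n) B.ext"
      have q: "0 \<le> ?q"
        using B.ext_props(1,2) rn_props[of n] by (intro Qren_nonneg) (auto simp: Dn_def)
      have "?Q ^ n \<le> 2 powr (1 - a) * B.Nk powr (1 - a) * ?q + ?Q ^ n / 4 + ?Q ^ n / 4"
        using QM(1) B.upper_lt[OF a] e1 by linarith
      also have "2 powr (1 - a) * B.Nk powr (1 - a) * ?q \<le> 2 * W * ?q"
        using two v(1)[of "1 - a"] a q by (intro mult_right_mono mult_mono) auto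
      finally have "?Q ^ n \<le> 4 * W * ?q" by simp
      also have "\<dots> \<le> 4 * (W * W) * ?q"
        using q W by (intro mult_right_mono mult_left_mono) auto
      finally show "\<exists>\<tau>\<in>exts n. ?Q ^ n \<le> 4 * Wn C n powr 2 * Qren (Dn n) a (rn n) \<tau>"
        using ext by (intro bexI[of _ B.ext]) (simp_all add: Dn_def W_def[symmetric] W2)
    qed
  qed
qed

text \<open>No choice of C makes the truncation errors small against 0. But \<open>Mren\<close>
  vanishes, so at fixed n only these errors remain, and they decay exponentially in L while the
  number of bins grows linearly.\<close>

lemma asym_lt_0:
  assumes a: "1 / 2 \<le> a" "a < 1" and Q: "Qren dA a \<rho>A \<sigma> = 0" and n: "0 < n" and \<tau>: "\<tau> \<in> exts n"
  shows "Qren (Dn n) a (rn n) \<tau> \<le> 0"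
proof -
  obtain V r s where V: "bipartite (dA ^ n) (dB ^ n) (rn n) (sn n) V r s" using ex_bipartite by blast
  have \<tau>': "fits (dA ^ n * dB ^ n) \<tau>" "psd_op \<tau>" "ptr (dB ^ n) \<tau> = sn n" using \<tau> by (auto simp: exts_def Dn_def)
  let ?v = "real (card (s ` {..<dA ^ n}))"
  have le: "Qren (Dn n) a (rn n) \<tau> \<le> (?v * (2 * real L + 2)) powr a * (2 powr (- real L * a) + 2 powr (- real L * (1 - a)))" for L
  proof -
    interpret B: bipartite "dA ^ n" "dB ^ n" "rn n" "sn n" V r s L by (rule V)
    have "B.Mren a \<le> 0" using B.Mren_le_lt[of a] a Q n by (simp add: ptr_rn Qren_n power_0_left)
    moreover have "0 \<le> B.Mren a" unfolding B.Mren_def by (intro sum_nonneg) auto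
    ultimately have M: "B.Mren a = 0" by simp
    have "B.Nk = ?v * (2 * real L + 2)" by (simp add: B.card_Sk algebra_simps)
    then show ?thesis using B.lower_lt[OF \<tau>' a] by (simp add: Dn_def M)
  qed
  have lim: "(\<lambda>L::nat. (?v * (2 * real L + 2)) powr a * (2 powr (- real L * a) + 2 powr (- real L * (1 - a)))) \<longlonglongrightarrow> 0"
  proof -
    have a': "0 < a" "0 < 1 - a" using a by auto
    have "(\<lambda>L::nat. ?v powr a * ((2 * real L + 2) powr a * (2 powr (- real L * a) + 2 powr (- real L * (1 - a))))) \<longlonglongrightarrow> ?v powr a * 0"
    proof (intro tendsto_mult tendsto_const)
      have e: "2 powr (- real L * b) = exp (- (b * ln 2) * real L)" for L b by (simp add: powr_def)
      have l: "(\<lambda>L::nat. (2 * real L + 2) powr a * exp (- c * real L)) \<longlonglongrightarrow> 0" if "0 < c" for c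
        using a' that by real_asymp
      show "(\<lambda>L::nat. (2 * real L + 2) powr a * (2 powr (- real L * a) + 2 powr (- real L * (1 - a)))) \<longlonglongrightarrow> 0"
        unfolding e distrib_left using a' by (intro tendsto_add_zero l) auto
    qed
    then show ?thesis by (simp add: powr_mult mult.assoc)
  qed
  show ?thesis by (rule LIMSEQ_le_const[OF lim]) (use le in blast)
qed

text \<open>Of the power a + 1, the lower bound spends a on passing from \<open>Qren\<close> to
  \<open>Mren\<close> and 1 on summing over the bins; the upper bound spends a on the
  pinching.\<close>

lemma asym_gt:
  assumes a: "1 < a" and ac: "abs_cont \<rho>A \<sigma>"
  shows "0 < Qren dA a \<rho>A \<sigma>"
    and "\<exists>C. \<forall>n>0. (\<forall>\<tau>\<in>exts n. abs_cont (rn n) \<tau> \<longrightarrow> Qren dA a \<rho>A \<sigma> ^ n \<le> 2 powr (a + 1) * Wn C n powr (a + 1) * Qren (Dn n) a (rn n) \<tau>)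
     \<and> (\<exists>\<tau>\<in>exts n. abs_cont (rn n) \<tau> \<and> Qren (Dn n) a (rn n) \<tau> \<le> 2 powr (a + 1) * Wn C n powr (a + 1) * Qren dA a \<rho>A \<sigma> ^ n)"
proof -
  let ?Q = "Qren dA a \<rho>A \<sigma>"
  obtain C1 :: nat where C1: "psd_op (2 ^ C1 *\<^sub>R \<sigma> - \<rho>A)"
    using abs_cont_bound[OF \<rho>A(1) \<sigma>(1) \<rho>A(2) \<sigma>(2) ac] by blast
  have dom: "psd_op (2 ^ (C * n) *\<^sub>R sn n - an n)" if "C1 \<le> C" for C n
  proof -
    interpret digits "dA ^ n" n dA "digit dA" by (rule digs)
    have "psd_op ((2 ^ C - 2 ^ C1) *\<^sub>R \<sigma> + (2 ^ C1 *\<^sub>R \<sigma> - \<rho>A))"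
      using C1 \<sigma> that by (intro psd_plus psd_scaleR) auto
    then have "psd_op (2 ^ C *\<^sub>R \<sigma> - \<rho>A)" by (simp add: scaleR_left_diff_distrib)
    then have "psd_op (tens (2 ^ C *\<^sub>R \<sigma>) - tens \<rho>A)"
      using \<rho>A \<sigma> by (intro tens_mono) auto
    then show ?thesis by (simp add: tens_scaleR sn_def an_def power_mult)
  qed
  have rs: "r i \<le> 2 ^ (C * n) * s i"
    if "bipartite (dA ^ n) (dB ^ n) (rn n) (sn n) V r s" "C1 \<le> C" "i < dA ^ n" for n V r s C i
  proof -
    \<comment> \<open>\<open>r\<close> and \<open>s\<close> are independent of the range of the
      bins, so 0 serves as well as any other value.\<close>
    interpret B: bipartite "dA ^ n" "dB ^ n" "rn n" "sn n" V r s 0 by (rule that)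
    show ?thesis
      using qf_mono[OF dom[OF that(2), of n], of V i] B.qf_\<rho>[OF that(3)] B.qf_\<sigma>[OF that(3)]
      by (simp add: qf_scaleR ptr_rn)
  qed
  \<comment> \<open>On a single copy the \<open>r i\<close> add up to 1, so one of them is positive,
    and domination makes the corresponding \<open>s i\<close> positive too.\<close>
  show Q: "0 < ?Q"
  proof -
    obtain V r s where V: "bipartite (dA ^ 1) (dB ^ 1) (rn 1) (sn 1) V r s" using ex_bipartite by blast
    interpret B: bipartite "dA ^ 1" "dB ^ 1" "rn 1" "sn 1" V r s 0 by (rule V)
    have "\<exists>i<dA. 0 < r i"
    proof (rule ccontr)
      assume "\<not> ?thesis"
      then have "r i = 0" if "i < dA" for i using that B.r_nonneg[of i] by force
      then have "(\<Sum>i<dA. r i) = 0" by simp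
      then show False using B.sum_r by simp
    qed
    then obtain i where i: "i < dA" "0 < r i" by blast
    then have "s i \<noteq> 0" using rs[OF V, of C1 i] by auto
    then have "0 < r i powr a * s i powr (1 - a)" using i by simp
    then have "0 < B.Mren a" unfolding B.Mren_def using i by (intro sum_pos2[of _ i]) auto
    then show ?thesis using B.Mren_le_gt[OF a] Qren_n[of 1 a] by (simp add: ptr_rn[of 1, simplified])
  qed
  \<comment> \<open>The error will be multiplied by the a-th power of the number of eigenvalues, at
    most \<open>(2 powr (real dA * a)) ^ n\<close>; with this \<open>q\<close> the product is at
    most \<open>(?Q / 2) ^ n\<close>.\<close>
  define q where "q = ?Q / 2 / 2 powr (real dA * a)"
  obtain C2 where C2: "\<forall>C\<ge>C2. 2 powr (- real C * (a - 1)) \<le> q"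
    using powr_neg_mult_le[of q "a - 1"] Q a by (auto simp: q_def)
  define C where "C = max C1 C2"
  have C: "C1 \<le> C" "2 powr (- real C * (a - 1)) \<le> q" using C2 by (auto simp: C_def)
  show "\<exists>C. \<forall>n>0. (\<forall>\<tau>\<in>exts n. abs_cont (rn n) \<tau> \<longrightarrow> ?Q ^ n \<le> 2 powr (a + 1) * Wn C n powr (a + 1) * Qren (Dn n) a (rn n) \<tau>)
     \<and> (\<exists>\<tau>\<in>exts n. abs_cont (rn n) \<tau> \<and> Qren (Dn n) a (rn n) \<tau> \<le> 2 powr (a + 1) * Wn C n powr (a + 1) * ?Q ^ n)"
  proof (intro exI[of _ C] allI impI)
    fix n :: nat assume n: "0 < n"
    obtain V r s where V: "bipartite (dA ^ n) (dB ^ n) (rn n) (sn n) V r s"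
      "card (s ` {..<dA ^ n}) \<le> (n + 1) ^ dA" using ex_bipartite by blast
    interpret B: bipartite "dA ^ n" "dB ^ n" "rn n" "sn n" V r s "C * n" by (rule V)
    note card = card_bounds[OF V]
    define W where "W = Wn C n"
    have W: "1 \<le> W" unfolding W_def by (rule Wn_ge_1)
    have Wa: "1 \<le> W powr a" using W a by (intro ge_one_powr_ge_zero) auto
    have two: "1 \<le> 2 powr (a - 1)" using a by (intro ge_one_powr_ge_zero) auto
    have Wa1: "W powr (a + 1) = W powr a * W" using W by (simp add: powr_add)
    have t1: "2 powr (a + 1) = 4 * 2 powr (a - 1)" using powr_add[of 2 2 "a - 1"] by (simp add: add.commute)
    have Nk: "B.Nk \<le> W" "B.Nk powr a \<le> W powr a" "real (card B.\<Lambda>) powr a \<le> W powr a"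
      using card a by (auto simp: W_def intro!: powr_mono2)
    have rs': "\<And>i. i < dA ^ n \<Longrightarrow> r i \<le> 2 ^ (C * n) * s i" using rs[OF V(1) C(1)] .
    let ?e = "2 powr (- real (C * n) * (a - 1))"
    have Qn: "0 < ?Q ^ n" using Q by simp
    have QM: "B.Mren a \<le> ?Q ^ n" "?Q ^ n \<le> real (card B.\<Lambda>) powr a * B.Mren a"
      using B.Mren_le_gt[OF a] B.Qren_le_gt[OF a] by (simp_all add: ptr_rn Qren_n)
    have eq: "real (card B.\<Lambda>) powr a * ?e \<le> ?Q ^ n / 2"
    proof -
      have "real (card B.\<Lambda>) \<le> real (n + 1) ^ dA" using V(2) by (metis of_nat_le_iff of_nat_power)
      also have "\<dots> \<le> (2 ^ n) ^ dA"
      proof (rule power_mono)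
        have "n + 1 \<le> 2 ^ n" by (induction n) auto
        then show "real (n + 1) \<le> 2 ^ n" by (metis of_nat_le_iff of_nat_numeral of_nat_power)
      qed simp
      finally have "real (card B.\<Lambda>) powr a \<le> ((2 ^ n) ^ dA) powr a" using a by (intro powr_mono2) auto
      also have "\<dots> = (2 powr (real dA * a)) ^ n"
        by (simp add: powr_powr mult_ac flip: powr_realpow)
      finally have "real (card B.\<Lambda>) powr a * ?e \<le> (2 powr (real dA * a)) ^ n * q ^ n"
        unfolding powr_neg_mult_pow using C by (intro mult_mono power_mono) auto
      also have "\<dots> = (?Q / 2) ^ n" by (simp add: q_def flip: power_mult_distrib)
      also have "\<dots> = ?Q ^ n / 2 ^ n" by (simp add: power_divide)
      also have "\<dots> \<le> ?Q ^ n / 2 ^ 1" using Q n by (intro divide_left_mono power_increasing) auto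
      finally show ?thesis by simp
    qed
    have v1: "?e \<le> ?Q ^ n"
    proof -
      have "B.\<Lambda> \<noteq> {}" using dA by (auto simp: lessThan_empty_iff)
      then have "1 \<le> real (card B.\<Lambda>)" by (simp add: Suc_le_eq card_gt_0_iff)
      then have "1 * ?e \<le> real (card B.\<Lambda>) powr a * ?e" using a by (intro mult_right_mono ge_one_powr_ge_zero) auto
      then show ?thesis using eq Qn by linarith
    qed
    show "(\<forall>\<tau>\<in>exts n. abs_cont (rn n) \<tau> \<longrightarrow> ?Q ^ n \<le> 2 powr (a + 1) * Wn C n powr (a + 1) * Qren (Dn n) a (rn n) \<tau>)
     \<and> (\<exists>\<tau>\<in>exts n. abs_cont (rn n) \<tau> \<and> Qren (Dn n) a (rn n) \<tau> \<le> 2 powr (a + 1) * Wn C n powr (a + 1) * ?Q ^ n)"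
    proof (intro conjI ballI impI)
      fix \<tau> assume "\<tau> \<in> exts n" and ac': "abs_cont (rn n) \<tau>"
      then have \<tau>: "fits (dA ^ n * dB ^ n) \<tau>" "psd_op \<tau>" "ptr (dB ^ n) \<tau> = sn n" by (auto simp: exts_def Dn_def)
      let ?q = "Qren (dA ^ n * dB ^ n) a (rn n) \<tau>"
      have q: "0 \<le> ?q"
        using \<tau> rn_props[of n] by (intro Qren_nonneg) (auto simp: Dn_def)
      have "?Q ^ n \<le> real (card B.\<Lambda>) powr a * (B.Nk * 2 powr (a - 1) * ?q + ?e)"
        using QM(2) mult_left_mono[OF B.lower_gt[OF \<tau> a ac' rs'], of "real (card B.\<Lambda>) powr a"] by simp
      also have "\<dots> = real (card B.\<Lambda>) powr a * (B.Nk * 2 powr (a - 1) * ?q) + real (card B.\<Lambda>) powr a * ?e"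
        by (rule distrib_left)
      also have "\<dots> \<le> W powr a * (W * 2 powr (a - 1) * ?q) + ?Q ^ n / 2"
        using Nk eq q W by (intro add_mono mult_mono) auto
      finally have "?Q ^ n \<le> 2 * (W powr a * (W * 2 powr (a - 1) * ?q))" by simp
      also have "\<dots> \<le> 4 * (W powr a * (W * 2 powr (a - 1) * ?q))"
        using q W by (intro mult_right_mono) auto
      finally show "?Q ^ n \<le> 2 powr (a + 1) * Wn C n powr (a + 1) * Qren (Dn n) a (rn n) \<tau>"
        unfolding W_def[symmetric] Wa1 t1 by (simp add: mult_ac Dn_def)
    next
      have ext: "B.ext \<in> exts n" using B.ext_props by (simp add: exts_def Dn_def)
      have "Qren (dA ^ n * dB ^ n) a (rn n) B.ext \<le> B.Nk powr a * (2 powr (a - 1) * B.Mren a + ?e)"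
        by (rule B.upper_gt[OF a rs'])
      also have "\<dots> \<le> W powr a * (2 powr (a - 1) * ?Q ^ n + 2 powr (a - 1) * ?Q ^ n)"
      proof (intro mult_mono add_mono)
        show "?e \<le> 2 powr (a - 1) * ?Q ^ n" using v1 mult_right_mono[OF two less_imp_le[OF Qn]] by simp
        show "0 \<le> 2 powr (a - 1) * B.Mren a + ?e"
          unfolding B.Mren_def by (intro add_nonneg_nonneg mult_nonneg_nonneg sum_nonneg) auto
      qed (use Nk QM in \<open>auto simp: B.Mren_def intro!: sum_nonneg\<close>)
      also have "\<dots> = 2 * (W powr a * 2 powr (a - 1) * ?Q ^ n)" by (simp add: algebra_simps)
      also have "\<dots> \<le> 4 * (W powr a * 2 powr (a - 1) * ?Q ^ n * W)"
      proof (rule mult_mono)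
        show "W powr a * 2 powr (a - 1) * ?Q ^ n \<le> W powr a * 2 powr (a - 1) * ?Q ^ n * W"
          using W Qn mult_left_mono[of 1 W "W powr a * 2 powr (a - 1) * ?Q ^ n"] by simp
      qed (use W Qn in auto)
      finally have "Qren (dA ^ n * dB ^ n) a (rn n) B.ext \<le> 4 * (W powr a * 2 powr (a - 1) * ?Q ^ n * W)" .
      then have "Qren (Dn n) a (rn n) B.ext \<le> 2 powr (a + 1) * Wn C n powr (a + 1) * ?Q ^ n"
        unfolding W_def[symmetric] Wa1 t1 by (simp add: mult_ac Dn_def)
      moreover have "abs_cont (rn n) B.ext" using B.upper_gt(1)[OF a rs'] .
      ultimately show "\<exists>\<tau>\<in>exts n. abs_cont (rn n) \<tau> \<and> Qren (Dn n) a (rn n) \<tau> \<le> 2 powr (a + 1) * Wn C n powr (a + 1) * ?Q ^ n"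
        using ext by blast
    qed
  qed
qed

text \<open>Tracing out B^n and cancelling the tensor power: a finite divergence for some n and some
  extension forces a finite one on A.\<close>

lemma abs_cont_exts: "0 < n \<Longrightarrow> \<tau> \<in> exts n \<Longrightarrow> abs_cont (rn n) \<tau> \<Longrightarrow> abs_cont \<rho>A \<sigma>"
proof -
  assume n: "0 < n" and \<tau>: "\<tau> \<in> exts n" and ac: "abs_cont (rn n) \<tau>"
  interpret digits "dA ^ n" n dA "digit dA" by (rule digs)
  have "abs_cont (ptr (dB ^ n) (rn n)) (ptr (dB ^ n) \<tau>)"
    using \<tau> rn_props[of n] dB ac by (intro abs_cont_ptr[of _ "dA ^ n"]) (auto simp: exts_def Dn_def)
  then have "abs_cont (tens \<rho>A) (tens \<sigma>)" using \<tau> by (simp add: ptr_rn exts_def an_def sn_def)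
  then show ?thesis using abs_cont_tens_cancel[OF n \<rho>A(1) \<sigma>(1) \<rho>A(2) \<sigma>(2)] by blast
qed

text \<open>The partial trace preserves the operator inequality, and product vectors allow taking
  the n-th root of its constant.\<close>

lemma max_lower:
  assumes n: "0 < n" and \<tau>: "\<tau> \<in> exts n" and le: "psd_op (2 powr x *\<^sub>R \<tau> - rn n)"
  shows "psd_op (2 powr (x / real n) *\<^sub>R \<sigma> - \<rho>A)"
proof -
  interpret digits "dA ^ n" n dA "digit dA" by (rule digs)
  have "psd_op (ptr (dB ^ n) (2 powr x *\<^sub>R \<tau> - rn n))" using le dB by (intro psd_ptr) auto
  also have "ptr (dB ^ n) (2 powr x *\<^sub>R \<tau> - rn n) = (2 powr (x / real n)) ^ n *\<^sub>R tens \<sigma> - tens \<rho>A"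
    using \<tau> n by (simp add: ptr_minus ptr_scaleR ptr_rn exts_def an_def sn_def powr_powr flip: powr_realpow)
  finally show ?thesis using n \<rho>A \<sigma> by (intro tens_le_cancel[of "2 powr (x / real n)"]) auto
qed

text \<open>If \<open>\<rho>\<^sub>A \<le> c \<sigma>\<^sub>A\<close>, then \<open>\<rho>\<^sub>A\<^sub>B / c + (\<sigma>\<^sub>A - \<rho>\<^sub>A / c) \<otimes> 1 / d\<^sub>B\<close> is an extension of
  \<open>\<sigma>\<^sub>A\<close> that dominates \<open>\<rho>\<^sub>A\<^sub>B / c\<close>.\<close>

lemma max_upper:
  assumes le: "psd_op (2 powr x *\<^sub>R \<sigma> - \<rho>A)"
  shows "\<exists>\<tau>\<in>exts n. psd_op (2 powr (real n * x) *\<^sub>R \<tau> - rn n)"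
proof -
  interpret digits "dA ^ n" n dA "digit dA" by (rule digs)
  define c where "c = 2 powr (real n * x)"
  have c: "0 < c" by (simp add: c_def)
  have cn: "c = (2 powr x) ^ n" by (simp add: c_def powr_powr mult.commute flip: powr_realpow)
  have "psd_op (tens (2 powr x *\<^sub>R \<sigma>) - tens \<rho>A)" using \<rho>A \<sigma> le by (intro tens_mono) auto
  then have "psd_op ((1 / c) *\<^sub>R (c *\<^sub>R sn n - an n))"
    using c by (intro psd_scaleR) (auto simp: tens_scaleR cn sn_def an_def)
  also have "(1 / c) *\<^sub>R (c *\<^sub>R sn n - an n) = sn n - (1 / c) *\<^sub>R an n" using c by (simp add: scaleR_right_diff_distrib)
  finally have R: "psd_op (sn n - (1 / c) *\<^sub>R an n)" .
  have dR: "fits (dA ^ n) (sn n - (1 / c) *\<^sub>R an n)" using sn_props an_props by auto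
  let ?X = "(1 / real (dB ^ n)) *\<^sub>R ampl (dB ^ n) (sn n - (1 / c) *\<^sub>R an n)"
  have X: "psd_op ?X" using dB dR R by (intro psd_scaleR psd_ampl) auto
  define \<tau> where "\<tau> = (1 / c) *\<^sub>R rn n + ?X"
  have "fits (Dn n) \<tau>" unfolding \<tau>_def using rn_props[of n] fits_ampl[OF dR, of "dB ^ n"] by (auto simp: Dn_def)
  moreover have "psd_op \<tau>" unfolding \<tau>_def using c by (intro psd_plus X psd_scaleR[OF rn_props(2)]) simp
  moreover have "ptr (dB ^ n) \<tau> = sn n"
    unfolding \<tau>_def using dB ptr_ampl[of "dB ^ n"] by (simp add: ptr_plus ptr_scaleR ptr_rn del: of_nat_power)
  ultimately have "\<tau> \<in> exts n" by (simp add: exts_def)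
  moreover have "c *\<^sub>R \<tau> - rn n = c *\<^sub>R ?X" using c by (simp add: \<tau>_def scaleR_right_distrib)
  moreover have "psd_op (c *\<^sub>R ?X)" using c by (intro psd_scaleR[OF X]) simp
  ultimately show ?thesis unfolding c_def[symmetric] by (intro bexI[of _ \<tau>]) auto
qed

end

section \<open>From bounds on traces to convergence of rates\<close>

definition Eren :: "real \<Rightarrow> real \<Rightarrow> ereal" where
  "Eren a x = ereal (1 / (a - 1)) * elog2 x"

lemma Eren_pos: "0 < x \<Longrightarrow> Eren a x = ereal (log 2 x / (a - 1))"
  by (simp add: Eren_def elog2_def)

lemma Eren_nonpos_lt: "a < 1 \<Longrightarrow> x \<le> 0 \<Longrightarrow> Eren a x = \<infinity>"
  by (simp add: Eren_def elog2_def)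

lemma Eren_nonpos_gt: "1 < a \<Longrightarrow> x \<le> 0 \<Longrightarrow> Eren a x = - \<infinity>"
  by (simp add: Eren_def elog2_def)

lemma log_mult_power: "0 < P \<Longrightarrow> 0 < Q \<Longrightarrow> log 2 (P * Q ^ n) = log 2 P + real n * log 2 Q"
  by (simp add: log_mult log_nat_power)

text \<open>The factor \<open>P\<close> becomes an additive error of size log P / |a - 1|. For a < 1
  the sign of 1/(a - 1) turns an upper bound on the trace into a lower bound on the divergence, and
  a trace 0 gives \<infinity>.\<close>

lemma Eren_lower_lt:
  assumes "a < 1" "0 < P" "0 < Q" "x \<le> P * Q ^ n"
  shows "ereal (real n * (log 2 Q / (a - 1)) - log 2 P / \<bar>a - 1\<bar>) \<le> Eren a x"
proof (cases "0 < x")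
  case True
  then have "log 2 x \<le> log 2 P + real n * log 2 Q"
    using assms by (simp flip: log_mult_power)
  then have "(log 2 P + real n * log 2 Q) / (a - 1) \<le> log 2 x / (a - 1)"
    using assms by (intro divide_right_mono_neg) auto
  moreover have "log 2 P / \<bar>a - 1\<bar> = - (log 2 P / (a - 1))" using assms by (simp add: minus_divide_right)
  ultimately show ?thesis using True by (simp add: Eren_pos add_divide_distrib)
qed (use assms in \<open>simp add: Eren_nonpos_lt\<close>)

lemma Eren_upper_lt:
  assumes "a < 1" "0 < P" "0 < Q" "Q ^ n \<le> P * x"
  shows "Eren a x \<le> ereal (real n * (log 2 Q / (a - 1)) + log 2 P / \<bar>a - 1\<bar>)"
proof -
  have "0 < P * x" using assms by (meson less_le_trans zero_less_power)
  then have x: "0 < x" using assms by (simp add: zero_less_mult_iff)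
  have "log 2 (Q ^ n) \<le> log 2 (P * x)" using assms x by simp
  then have "real n * log 2 Q \<le> log 2 P + log 2 x"
    using assms x by (simp add: log_mult log_nat_power)
  then have "(log 2 P + log 2 x) / (a - 1) \<le> real n * log 2 Q / (a - 1)"
    using assms by (intro divide_right_mono_neg) auto
  moreover have "log 2 P / \<bar>a - 1\<bar> = - (log 2 P / (a - 1))" using assms by (simp add: minus_divide_right)
  ultimately show ?thesis using x by (simp add: Eren_pos add_divide_distrib)
qed

lemma Eren_lower_gt:
  assumes "1 < a" "0 < P" "0 < Q" "Q ^ n \<le> P * x"
  shows "ereal (real n * (log 2 Q / (a - 1)) - log 2 P / \<bar>a - 1\<bar>) \<le> Eren a x"
proof -
  have "0 < P * x" using assms by (meson less_le_trans zero_less_power)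
  then have x: "0 < x" using assms by (simp add: zero_less_mult_iff)
  have "log 2 (Q ^ n) \<le> log 2 (P * x)" using assms x by simp
  then have "real n * log 2 Q \<le> log 2 P + log 2 x"
    using assms x by (simp add: log_mult log_nat_power)
  then have "real n * log 2 Q / (a - 1) \<le> (log 2 P + log 2 x) / (a - 1)"
    using assms by (intro divide_right_mono) auto
  then show ?thesis using x assms by (simp add: Eren_pos add_divide_distrib)
qed

lemma Eren_upper_gt:
  assumes "1 < a" "0 < P" "0 < Q" "x \<le> P * Q ^ n"
  shows "Eren a x \<le> ereal (real n * (log 2 Q / (a - 1)) + log 2 P / \<bar>a - 1\<bar>)"
proof (cases "0 < x")
  case True
  then have "log 2 x \<le> log 2 P + real n * log 2 Q"
    using assms by (simp flip: log_mult_power)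
  then have "log 2 x / (a - 1) \<le> (log 2 P + real n * log 2 Q) / (a - 1)"
    using assms by (intro divide_right_mono) auto
  then show ?thesis using True assms by (simp add: Eren_pos add_divide_distrib)
qed (use assms in \<open>simp add: Eren_nonpos_gt\<close>)

lemma rate_tendsto:
  fixes F :: "nat \<Rightarrow> 'a \<Rightarrow> ereal" and D :: real
  assumes lower: "\<And>n \<tau>. 0 < n \<Longrightarrow> \<tau> \<in> X n \<Longrightarrow> ereal (real n * D - g n) \<le> F n \<tau>"
    and upper: "\<And>n. 0 < n \<Longrightarrow> \<exists>\<tau>\<in>X n. F n \<tau> \<le> ereal (real n * D + g n)"
    and lim: "(\<lambda>n. g n / real n) \<longlonglongrightarrow> 0"
  shows "(\<lambda>n. (INF \<tau>\<in>X n. F n \<tau>) / ereal (real n)) \<longlonglongrightarrow> ereal D"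
proof (rule tendsto_sandwich)
  have div: "ereal (real n * D + b) / ereal (real n) = ereal (D + b / real n)" if "0 < n" for n b
    using that by (simp add: add_divide_distrib)
  show "\<forall>\<^sub>F n in sequentially. ereal (D - g n / real n) \<le> (INF \<tau>\<in>X n. F n \<tau>) / ereal (real n)"
    using eventually_gt_at_top[of 0]
  proof eventually_elim
    case (elim n)
    have "ereal (real n * D + - g n) \<le> (INF \<tau>\<in>X n. F n \<tau>)"
      using lower[OF elim] by (intro INF_greatest) simp
    then have "ereal (real n * D + - g n) / ereal (real n) \<le> (INF \<tau>\<in>X n. F n \<tau>) / ereal (real n)"
      using elim by (intro ereal_divide_right_mono) auto
    then show ?case unfolding div[OF elim] by simp
  qed
  show "\<forall>\<^sub>F n in sequentially. (INF \<tau>\<in>X n. F n \<tau>) / ereal (real n) \<le> ereal (D + g n / real n)"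
    using eventually_gt_at_top[of 0]
  proof eventually_elim
    case (elim n)
    obtain \<tau> where "\<tau> \<in> X n" "F n \<tau> \<le> ereal (real n * D + g n)" using upper[OF elim] by blast
    then have "(INF \<tau>\<in>X n. F n \<tau>) \<le> ereal (real n * D + g n)" by (rule INF_lower2)
    then have "(INF \<tau>\<in>X n. F n \<tau>) / ereal (real n) \<le> ereal (real n * D + g n) / ereal (real n)"
      using elim by (intro ereal_divide_right_mono) auto
    then show ?case unfolding div[OF elim] .
  qed
  have "(\<lambda>n. D - g n / real n) \<longlonglongrightarrow> D - 0" "(\<lambda>n. D + g n / real n) \<longlonglongrightarrow> D + 0"
    by (rule tendsto_diff[OF tendsto_const lim], rule tendsto_add[OF tendsto_const lim])
  then show "(\<lambda>n. ereal (D - g n / real n)) \<longlonglongrightarrow> ereal D" "(\<lambda>n. ereal (D + g n / real n)) \<longlonglongrightarrow> ereal D"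
    by simp_all
qed

lemma (in iid) log_Wn_lim:
  assumes c: "0 < c"
  shows "(\<lambda>n. (log 2 (c * Wn C n powr e) / k) / real n) \<longlonglongrightarrow> 0"
proof -
  have eq: "log 2 (c * Wn C n powr e) / k / real n
    = ((log 2 c + e * log 2 (real (2 * C + 2))) / k) * (1 / real n) + (e * real (dA + 1) / k) * (log 2 (real n + 1) / real n)" for n
  proof -
    have "log 2 (c * Wn C n powr e) = log 2 c + e * log 2 (Wn C n)"
      using c Wn_ge_1[of C n] by (simp add: log_mult log_powr)
    also have "log 2 (Wn C n) = log 2 (real (2 * C + 2)) + real (dA + 1) * log 2 (real n + 1)"
    proof -
      have "real (n + 1) = real n + 1" by simp
      then show ?thesis
        unfolding Wn_def using log_mult_power[of "real (2 * C + 2)" "real n + 1" "dA + 1"] by (simp only:)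
    qed
    finally show ?thesis by (simp add: add_divide_distrib ring_distribs)
  qed
  have "(\<lambda>n::nat. ((log 2 c + e * log 2 (real (2 * C + 2))) / k) * (1 / real n) + (e * real (dA + 1) / k) * (log 2 (real n + 1) / real n))
     \<longlonglongrightarrow> ((log 2 c + e * log 2 (real (2 * C + 2))) / k) * 0 + (e * real (dA + 1) / k) * 0"
    by (intro tendsto_add tendsto_mult tendsto_const; real_asymp)
  then show ?thesis unfolding eq by simp
qed

lemma Inf_ereal_top: "(\<And>\<tau>. \<tau> \<in> X \<Longrightarrow> F \<tau> = \<infinity>) \<Longrightarrow> (INF \<tau>\<in>X. F \<tau>) = (\<infinity>::ereal)"
  by (metis INF_greatest ereal_infty_less_eq(1) order_refl)

text \<open>For finite orders the limit is infinite in two cases: orthogonality for \<alpha> < 1 and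
  failing inclusion of supports for \<alpha> > 1. There every term with n > 0 is infinite; otherwise
  the polynomial bounds squeeze the rate.\<close>

lemma D_renyi_rate_tendsto:
  assumes \<rho>: "\<rho> \<in> density (dA * dB)" and \<sigma>: "\<sigma> \<in> density dA"
    and \<alpha>: "1 / 2 \<le> \<alpha> \<and> \<alpha> < 1 \<or> 1 < \<alpha>"
  shows "D_renyi_rate \<alpha> dA dB \<rho> \<sigma> \<longlonglongrightarrow> D_renyi \<alpha> (partial_trace dA dB \<rho>) \<sigma>"
proof -
  let ?R = "opm (dA * dB) \<rho>" and ?S = "opm dA \<sigma>"
  have c: "\<rho> \<in> carrier_mat (dA * dB) (dA * dB)" "\<sigma> \<in> carrier_mat dA dA"
    and R: "psd_op ?R" "tr ?R = 1" and S: "psd_op ?S" "tr ?S = 1"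
    using \<rho> \<sigma> by (auto simp: density_opm)
  have pos: "0 < dA" "0 < dB"
  \<comment> \<open>A state of trace 1 excludes dimension 0.\<close>
  proof -
    have "dA * dB \<noteq> 0"
    proof
      assume "dA * dB = 0"
      then have "tr ?R = 0" by (simp only: tr_eq[OF fits_opm]) simp
      then show False using R by simp
    qed
    then show "0 < dA" "0 < dB" by auto
  qed
  interpret iid dA dB ?R ?S by unfold_locales (use pos R S in auto)
  let ?pt = "partial_trace dA dB \<rho>"
  have pt: "opm dA ?pt = \<rho>A" by (rule opm_partial_trace)
  have psd_pt: "psd dA ?pt" "psd dA \<sigma>"
    using \<rho>A S c partial_trace_carrier by (auto simp: psd_opm pt)
  let ?bip = "\<lambda>n. bipartite_tensor_power dA dB n \<rho>"
  have bip: "opm (Dn n) (?bip n) = rn n" for n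
    unfolding rn_def Dn_def by (rule opm_bipartite_tensor_power[OF pos])
  have bipc: "?bip n \<in> carrier_mat (Dn n) (Dn n)" for n by (simp add: bipartite_tensor_power_def Dn_def)
  have psd_bip: "psd (Dn n) (?bip n)" for n using bipc rn_props[of n] by (simp add: psd_opm bip)
  have tp: "opm (dA ^ n) (tensor_power dA n \<sigma>) = sn n" for n
    unfolding sn_def by (rule opm_tensor_power[OF pos(1)])
  have tpc: "tensor_power dA n \<sigma> \<in> carrier_mat (dA ^ n) (dA ^ n)" for n by (simp add: tensor_power_def)
  have ext1: "psd (Dn n) \<tau>" "opm (Dn n) \<tau> \<in> exts n" if "\<tau> \<in> extensions dA dB n \<sigma>" for n \<tau>
  proof -
    have \<tau>: "\<tau> \<in> density (Dn n)" "partial_trace (dA ^ n) (dB ^ n) \<tau> = tensor_power dA n \<sigma>"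
      using that by (auto simp: extensions_def Dn_def)
    have "ptr (dB ^ n) (opm (Dn n) \<tau>) = sn n"
      using opm_partial_trace[of "dA ^ n" "dB ^ n" \<tau>] \<tau>(2) tp by (simp add: Dn_def)
    then show "psd (Dn n) \<tau>" "opm (Dn n) \<tau> \<in> exts n"
      using \<tau>(1) by (auto simp: exts_def density_opm psd_opm)
  qed
  have ext2: "mt (Dn n) T \<in> extensions dA dB n \<sigma>" "opm (Dn n) (mt (Dn n) T) = T" if T: "T \<in> exts n" for n T
  proof -
    show o: "opm (Dn n) (mt (Dn n) T) = T" using T by (simp add: opm_mt exts_def)
    have "partial_trace (dA ^ n) (dB ^ n) (mt (Dn n) T) = tensor_power dA n \<sigma>"
      using o T by (intro opm_inj[OF partial_trace_carrier tpc]) (simp add: opm_partial_trace tp exts_def Dn_def)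
    moreover have "mt (Dn n) T \<in> density (Dn n)"
      using o T tr_exts[OF T] by (simp add: density_opm exts_def)
    ultimately show "mt (Dn n) T \<in> extensions dA dB n \<sigma>" by (simp add: extensions_def Dn_def)
  qed
  have rate: "D_renyi_rate \<alpha> dA dB \<rho> \<sigma> = (\<lambda>n. (INF \<tau>\<in>extensions dA dB n \<sigma>. D_renyi \<alpha> (?bip n) \<tau>) / ereal (real n))"
    by (rule ext) (simp add: D_renyi_rate_def D_renyi_set_def)
  \<comment> \<open>The term n = 0 involves a division by zero and is left out by an eventuality
    argument.\<close>
  have inf: "(\<lambda>n. (INF \<tau>\<in>extensions dA dB n \<sigma>. D_renyi \<alpha> (?bip n) \<tau>) / ereal (real n)) \<longlonglongrightarrow> \<infinity>"
    if "\<And>n \<tau>. 0 < n \<Longrightarrow> \<tau> \<in> extensions dA dB n \<sigma> \<Longrightarrow> D_renyi \<alpha> (?bip n) \<tau> = \<infinity>"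
  proof (rule tendsto_eventually, use eventually_gt_at_top[of "0::nat"] in eventually_elim)
    case (elim n)
    then have "(INF \<tau>\<in>extensions dA dB n \<sigma>. D_renyi \<alpha> (?bip n) \<tau>) = \<infinity>" using that by (intro Inf_ereal_top)
    then show ?case using elim by simp
  qed
  show ?thesis
  proof (cases "\<alpha> = \<infinity>")
    case True
    have DA: "D_renyi \<alpha> ?pt \<sigma> = Inf (ereal ` {x. psd_op (2 powr x *\<^sub>R ?S - \<rho>A)})" (is "_ = Inf (ereal ` ?XA)")
      using True c D_max_opm[OF partial_trace_carrier c(2)] by (simp add: D_renyi_def pt)
    have DT: "D_renyi \<alpha> (?bip n) \<tau> = Inf (ereal ` {x. psd_op (2 powr x *\<^sub>R opm (Dn n) \<tau> - rn n)})"
      if "\<tau> \<in> extensions dA dB n \<sigma>" for n \<tau>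
    proof -
      have "\<tau> \<in> carrier_mat (Dn n) (Dn n)" using ext1(1)[OF that] by (simp add: psd_opm)
      then show ?thesis using True D_max_opm[OF bipc] by (simp add: D_renyi_def bip)
    qed
    \<comment> \<open>For order \<infinity> the rate is constant in n > 0: \<open>max_lower\<close>
      and \<open>max_upper\<close> match the admissible exponents for n copies with n times those
      for one copy.\<close>
    have "(INF \<tau>\<in>extensions dA dB n \<sigma>. D_renyi \<alpha> (?bip n) \<tau>) / ereal (real n) = D_renyi \<alpha> ?pt \<sigma>"
      if n: "0 < n" for n
    proof (rule antisym)
      show "D_renyi \<alpha> ?pt \<sigma> \<le> (INF \<tau>\<in>extensions dA dB n \<sigma>. D_renyi \<alpha> (?bip n) \<tau>) / ereal (real n)"
      proof -
        have "D_renyi \<alpha> ?pt \<sigma> * ereal (real n) \<le> D_renyi \<alpha> (?bip n) \<tau>" if \<tau>: "\<tau> \<in> extensions dA dB n \<sigma>" for \<tau>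
          unfolding DT[OF \<tau>]
        proof (rule INF_greatest)
          fix x assume "x \<in> {x. psd_op (2 powr x *\<^sub>R opm (Dn n) \<tau> - rn n)}"
          then have "x / real n \<in> ?XA" using max_lower[OF n ext1(2)[OF \<tau>], of x] by simp
          then have "D_renyi \<alpha> ?pt \<sigma> \<le> ereal (x / real n)" unfolding DA by (rule INF_lower)
          then have "D_renyi \<alpha> ?pt \<sigma> * ereal (real n) \<le> ereal (x / real n) * ereal (real n)"
            by (intro ereal_mult_right_mono) auto
          then show "D_renyi \<alpha> ?pt \<sigma> * ereal (real n) \<le> ereal x" using n by simp
        qed
        then have "D_renyi \<alpha> ?pt \<sigma> * ereal (real n) \<le> (INF \<tau>\<in>extensions dA dB n \<sigma>. D_renyi \<alpha> (?bip n) \<tau>)"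
          by (intro INF_greatest)
        then have "D_renyi \<alpha> ?pt \<sigma> * ereal (real n) / ereal (real n) \<le> (INF \<tau>\<in>extensions dA dB n \<sigma>. D_renyi \<alpha> (?bip n) \<tau>) / ereal (real n)"
          using n by (intro ereal_divide_right_mono) auto
        moreover have "D_renyi \<alpha> ?pt \<sigma> * ereal (real n) / ereal (real n) = D_renyi \<alpha> ?pt \<sigma>"
          using n by (cases "D_renyi \<alpha> ?pt \<sigma>") auto
        ultimately show ?thesis by simp
      qed
      show "(INF \<tau>\<in>extensions dA dB n \<sigma>. D_renyi \<alpha> (?bip n) \<tau>) / ereal (real n) \<le> D_renyi \<alpha> ?pt \<sigma>"
        unfolding DA
      proof (rule INF_greatest)
        fix x assume "x \<in> ?XA"
        then obtain T where T: "T \<in> exts n" "psd_op (2 powr (real n * x) *\<^sub>R T - rn n)" using max_upper by blast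
        have "D_renyi \<alpha> (?bip n) (mt (Dn n) T) \<le> ereal (real n * x)"
          unfolding DT[OF ext2(1)[OF T(1)]] ext2(2)[OF T(1)] using T(2) by (intro INF_lower) simp
        then have "(INF \<tau>\<in>extensions dA dB n \<sigma>. D_renyi \<alpha> (?bip n) \<tau>) \<le> ereal (real n * x)"
          using ext2(1)[OF T(1)] by (intro INF_lower2)
        then have "(INF \<tau>\<in>extensions dA dB n \<sigma>. D_renyi \<alpha> (?bip n) \<tau>) / ereal (real n) \<le> ereal (real n * x) / ereal (real n)"
          using n by (intro ereal_divide_right_mono) auto
        then show "(INF \<tau>\<in>extensions dA dB n \<sigma>. D_renyi \<alpha> (?bip n) \<tau>) / ereal (real n) \<le> ereal x" using n by simp
      qed
    qed
    then have "\<forall>\<^sub>F n in sequentially. D_renyi_rate \<alpha> dA dB \<rho> \<sigma> n = D_renyi \<alpha> ?pt \<sigma>"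
      unfolding rate using eventually_gt_at_top[of "0::nat"] by (rule eventually_mono[rotated]) blast
    then show ?thesis by (rule tendsto_eventually)
  next
    case False
    moreover have "\<alpha> \<noteq> - \<infinity>" using \<alpha> by auto
    ultimately obtain a where a: "\<alpha> = ereal a" by (cases \<alpha>) auto
    have a': "1 / 2 \<le> a \<and> a < 1 \<or> 1 < a"
    proof -
      have "(1 / 2 :: ereal) = ereal 1 / ereal 2" by (simp add: one_ereal_def)
      also have "\<dots> = ereal (1 / 2)" by (subst ereal_divide) simp_all
      finally have "(1 / 2 :: ereal) = ereal (1 / 2)" .
      then show ?thesis using \<alpha> unfolding a by (simp add: one_ereal_def)
    qed
    let ?Q = "Qren dA a \<rho>A ?S"
    have DA: "D_renyi \<alpha> ?pt \<sigma> = (if a < 1 \<or> abs_cont \<rho>A ?S then Eren a ?Q else \<infinity>)"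
      using D_sandwiched_opm[OF psd_pt, of a] by (simp add: D_renyi_def a pt Eren_def)
    have DT: "D_renyi \<alpha> (?bip n) \<tau> = (if a < 1 \<or> abs_cont (rn n) (opm (Dn n) \<tau>)
        then Eren a (Qren (Dn n) a (rn n) (opm (Dn n) \<tau>)) else \<infinity>)"
      if "\<tau> \<in> extensions dA dB n \<sigma>" for n \<tau>
      using D_sandwiched_opm[OF psd_bip ext1(1)[OF that], of a] by (simp add: D_renyi_def a bip Eren_def)
    from a' consider "1 / 2 \<le> a" "a < 1" "0 < ?Q" | "1 / 2 \<le> a" "a < 1" "\<not> 0 < ?Q"
      | "1 < a" "abs_cont \<rho>A ?S" | "1 < a" "\<not> abs_cont \<rho>A ?S" by blast
    then show ?thesis
    proof cases
      case 1
      obtain C where C: "\<And>n \<tau>. 0 < n \<Longrightarrow> \<tau> \<in> exts n \<Longrightarrow> Qren (Dn n) a (rn n) \<tau> \<le> 4 * Wn C n powr 2 * ?Q ^ n"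
        "\<And>n. 0 < n \<Longrightarrow> \<exists>\<tau>\<in>exts n. ?Q ^ n \<le> 4 * Wn C n powr 2 * Qren (Dn n) a (rn n) \<tau>"
        using asym_lt[OF 1] by blast
      have W: "0 < 4 * Wn C n powr 2" for n using Wn_ge_1[of C n] by simp
      have "D_renyi \<alpha> ?pt \<sigma> = ereal (log 2 ?Q / (a - 1))" using 1 by (simp add: DA Eren_pos)
      moreover have "(\<lambda>n. (INF \<tau>\<in>extensions dA dB n \<sigma>. D_renyi \<alpha> (?bip n) \<tau>) / ereal (real n)) \<longlonglongrightarrow> ereal (log 2 ?Q / (a - 1))"
      proof (rule rate_tendsto[where g = "\<lambda>n. log 2 (4 * Wn C n powr 2) / \<bar>a - 1\<bar>"])
        fix n \<tau> assume n: "0 < n" and \<tau>: "\<tau> \<in> extensions dA dB n \<sigma>"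
        show "ereal (real n * (log 2 ?Q / (a - 1)) - log 2 (4 * Wn C n powr 2) / \<bar>a - 1\<bar>) \<le> D_renyi \<alpha> (?bip n) \<tau>"
          unfolding DT[OF \<tau>] using 1 Eren_lower_lt[OF 1(2) W 1(3) C(1)[OF n ext1(2)[OF \<tau>]]] by simp
      next
        fix n :: nat assume n: "0 < n"
        obtain T where T: "T \<in> exts n" "?Q ^ n \<le> 4 * Wn C n powr 2 * Qren (Dn n) a (rn n) T" using C(2)[OF n] by blast
        show "\<exists>\<tau>\<in>extensions dA dB n \<sigma>. D_renyi \<alpha> (?bip n) \<tau> \<le> ereal (real n * (log 2 ?Q / (a - 1)) + log 2 (4 * Wn C n powr 2) / \<bar>a - 1\<bar>)"
          using ext2[OF T(1)] DT[OF ext2(1)[OF T(1)]] 1 Eren_upper_lt[OF 1(2) W 1(3) T(2)]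
          by (intro bexI[of _ "mt (Dn n) T"]) auto
      qed (rule log_Wn_lim, simp)
      ultimately show ?thesis by (simp only: rate)
    next
      case 2
      have Q0: "?Q = 0" using 2 Qren_nonneg[of dA \<rho>A ?S a] \<rho>A S by force
      have "D_renyi \<alpha> ?pt \<sigma> = \<infinity>" using 2 Q0 by (simp add: DA Eren_nonpos_lt)
      moreover have "D_renyi \<alpha> (?bip n) \<tau> = \<infinity>" if "0 < n" "\<tau> \<in> extensions dA dB n \<sigma>" for n \<tau>
        unfolding DT[OF that(2)] using 2 asym_lt_0[OF 2(1,2) Q0 that(1) ext1(2)[OF that(2)]] by (simp add: Eren_nonpos_lt)
      ultimately show ?thesis using inf by (simp only: rate)
    next
      case 3
      note Q = asym_gt(1)[OF 3]
      obtain C where C: "\<And>n \<tau>. 0 < n \<Longrightarrow> \<tau> \<in> exts n \<Longrightarrow> abs_cont (rn n) \<tau> \<Longrightarrow> ?Q ^ n \<le> 2 powr (a + 1) * Wn C n powr (a + 1) * Qren (Dn n) a (rn n) \<tau>"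
        "\<And>n. 0 < n \<Longrightarrow> \<exists>\<tau>\<in>exts n. abs_cont (rn n) \<tau> \<and> Qren (Dn n) a (rn n) \<tau> \<le> 2 powr (a + 1) * Wn C n powr (a + 1) * ?Q ^ n"
        using asym_gt(2)[OF 3] by blast
      have W: "0 < 2 powr (a + 1) * Wn C n powr (a + 1)" for n using Wn_ge_1[of C n] by simp
      have "D_renyi \<alpha> ?pt \<sigma> = ereal (log 2 ?Q / (a - 1))" using 3 Q by (simp add: DA Eren_pos)
      moreover have "(\<lambda>n. (INF \<tau>\<in>extensions dA dB n \<sigma>. D_renyi \<alpha> (?bip n) \<tau>) / ereal (real n)) \<longlonglongrightarrow> ereal (log 2 ?Q / (a - 1))"
      proof (rule rate_tendsto[where g = "\<lambda>n. log 2 (2 powr (a + 1) * Wn C n powr (a + 1)) / \<bar>a - 1\<bar>"])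
        fix n \<tau> assume n: "0 < n" and \<tau>: "\<tau> \<in> extensions dA dB n \<sigma>"
        show "ereal (real n * (log 2 ?Q / (a - 1)) - log 2 (2 powr (a + 1) * Wn C n powr (a + 1)) / \<bar>a - 1\<bar>) \<le> D_renyi \<alpha> (?bip n) \<tau>"
        proof (cases "abs_cont (rn n) (opm (Dn n) \<tau>)")
          case True
          then show ?thesis
            unfolding DT[OF \<tau>] using Eren_lower_gt[OF 3(1) W Q C(1)[OF n ext1(2)[OF \<tau>] True]] by simp
        next
          case False
          then show ?thesis unfolding DT[OF \<tau>] using 3 by simp
        qed
      next
        fix n :: nat assume n: "0 < n"
        obtain T where T: "T \<in> exts n" "abs_cont (rn n) T" "Qren (Dn n) a (rn n) T \<le> 2 powr (a + 1) * Wn C n powr (a + 1) * ?Q ^ n"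
          using C(2)[OF n] by blast
        show "\<exists>\<tau>\<in>extensions dA dB n \<sigma>. D_renyi \<alpha> (?bip n) \<tau> \<le> ereal (real n * (log 2 ?Q / (a - 1)) + log 2 (2 powr (a + 1) * Wn C n powr (a + 1)) / \<bar>a - 1\<bar>)"
          using ext2[OF T(1)] DT[OF ext2(1)[OF T(1)]] T(2) Eren_upper_gt[OF 3(1) W Q T(3)]
          by (intro bexI[of _ "mt (Dn n) T"]) auto
      qed (rule log_Wn_lim, simp)
      ultimately show ?thesis by (simp only: rate)
    next
      case 4
      have "D_renyi \<alpha> ?pt \<sigma> = \<infinity>" using 4 by (simp add: DA)
      moreover have "D_renyi \<alpha> (?bip n) \<tau> = \<infinity>" if "0 < n" "\<tau> \<in> extensions dA dB n \<sigma>" for n \<tau>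
        unfolding DT[OF that(2)] using 4 abs_cont_exts[OF that(1) ext1(2)[OF that(2)]] by auto
      ultimately show ?thesis using inf by (simp only: rate)
    qed
  qed
qed

theorem theorem3p1:
  fixes dA dB :: nat and \<rho> \<sigma> :: "complex mat" and \<alpha> :: ereal
  assumes "\<rho> \<in> density (dA * dB)"
    and "\<sigma> \<in> density dA"
    and "1 / 2 \<le> \<alpha> \<and> \<alpha> < 1 \<or> 1 < \<alpha>"
  shows "convergent (D_renyi_rate \<alpha> dA dB \<rho> \<sigma>) \<and>
    D_renyi \<alpha> (partial_trace dA dB \<rho>) \<sigma> = D_renyi_reg \<alpha> dA dB \<rho> \<sigma>"
  using D_renyi_rate_tendsto[OF assms]
  by (simp add: D_renyi_reg_def convergent_def limI) blast

end
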